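(* Let $N\ge 1$, $m>0$, $\kappa>0$, $\mathcal V=(\nu_1,\dots,\nu_N)\in\mathbb R^N$, and let $\Theta=(\theta_1,\dots,\theta_N)$ be the global solution of the inertial Kuramoto model $$m\ddot\theta_i+\dot\theta_i=\nu_i+\frac{\kappa}{N}\sum_{j=1}^N\sin(\theta_j-\theta_i),\quad t>0,\qquad (\theta_i,\dot\theta_i)(0)=(\theta_i^0,\omega_i^0),\quad i\in[N].$$ Let $R^0=\left|\frac1N\sum_{j=1}^N e^{\mathrm i\theta_j^0}\right|$ and suppose $$\frac{\max_{1\le i,j\le N}|\nu_i-\nu_j|}{\kappa}\le x|R^0|^2,\qquad m\kappa\le y|R^0|^2,\qquad \frac{\max_{1\le i,j\le N}|\omega_i^0-\omega_j^0|}{\kappa}\le z|R^0|^2,$$ where $x,y,z$ are positive real numbers satisfying $$\inf_{\eta>0}\Bigg[(1-e^{-\eta})\,y\Big(\tfrac12(z+\eta x)+(1-e^{-\eta})^2y\big(\tfrac34 z+\eta x+2\eta\big)\Big)+\sqrt{3.068\Big(y(x+2)+\max\{1,\eta\}e^{-\max\{1,\eta\}}yz+\tfrac x2+\tfrac{e^{-\eta}}{1-e^{-\eta}}\tfrac z2\Big)}\Bigg]<1.$$ Then the following hold. (1) (Asymptotic phase-locking) With $\nu_c=\frac1N\sum_{i=1}^N\nu_i$, for all $i\in[N]$ the limit $\lim_{t\to\infty}(\theta_i(t)-\nu_ct)$ exists in $\mathbb R$ and $\lim_{t\to\infty}\dot\theta_i(t)=\nu_c$. (2) (Asymptotic partial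 phase-locking) There exist a subset $\mathcal A\subset[N]$ with $|\mathcal A|>\frac N2$ and integers $k_i$ for $i\in\mathcal A$ such that $$\limsup_{t\to\infty}\max_{i,j\in\mathcal A}\big|(\theta_i(t)-2k_i\pi)-(\theta_j(t)-2k_j\pi)\big|<\frac\pi2,$$ and a constant $c=c(x,y,z,R^0)$, depending only on $x,y,z,R^0$, such that for any $i,j\in\mathcal A$ with $\nu_i\ge\nu_j$, $$\frac{\nu_i-\nu_j}{\kappa}\le\lim_{t\to\infty}\big(\theta_i(t)-\theta_j(t)-2(k_i-k_j)\pi\big)\le c\,\frac{\nu_i-\nu_j}{\kappa}.$$
   Context: $[N]=\{1,\dots,N\}$. The unknowns $\theta_i$ are real-valued functions of $t\ge0$; the initial data $\theta_i^0,\omega_i^0$ are arbitrary reals. The Cauchy problem always has a unique global solution, which is real analytic. *)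

theory Defs
  imports "HOL-Analysis.Analysis"
begin

(* Oscillators are indexed by {1..N}; values of the families outside this range are irrelevant. *)

definition spread :: "nat set \<Rightarrow> (nat \<Rightarrow> real) \<Rightarrow> real" where
  "spread A v = (MAX (i, j) \<in> A \<times> A. \<bar>v i - v j\<bar>)"

definition order_parameter :: "nat \<Rightarrow> (nat \<Rightarrow> real) \<Rightarrow> real" where
  "order_parameter N \<phi> = cmod ((1 / of_nat N) * (\<Sum>j = 1..N. exp (\<i> * of_real (\<phi> j))))"

definition mean :: "nat \<Rightarrow> (nat \<Rightarrow> real) \<Rightarrow> real" where
  "mean N v = (1 / real N) * (\<Sum>i = 1..N. v i)"

(* Classical solution on [0, \<infinity>).  Only the values \<theta> i t with t \<ge> 0 enter: the velocity at time 0 is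
   the one-sided derivative, and the third clause says that the velocity is continuous there. *)
definition inertial_kuramoto_solution ::
  "nat \<Rightarrow> real \<Rightarrow> real \<Rightarrow> (nat \<Rightarrow> real) \<Rightarrow> (nat \<Rightarrow> real) \<Rightarrow> (nat \<Rightarrow> real) \<Rightarrow> (nat \<Rightarrow> real \<Rightarrow> real) \<Rightarrow> bool"
where
  "inertial_kuramoto_solution N m \<kappa> \<nu> \<theta>0 \<omega>0 \<theta> \<longleftrightarrow>
    (\<forall>i \<in> {1..N}.
       \<theta> i 0 = \<theta>0 i \<and>
       (\<theta> i has_real_derivative \<omega>0 i) (at 0 within {0..}) \<and>
       (deriv (\<theta> i) \<longlongrightarrow> \<omega>0 i) (at_right 0) \<and>
       (\<forall>t > 0.
          \<theta> i differentiable (at t) \<and>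
          deriv (\<theta> i) differentiable (at t) \<and>
          m * deriv (deriv (\<theta> i)) t + deriv (\<theta> i) t =
            \<nu> i + \<kappa> / real N * (\<Sum>j = 1..N. sin (\<theta> j t - \<theta> i t))))"

definition framework_bound :: "real \<Rightarrow> real \<Rightarrow> real \<Rightarrow> real \<Rightarrow> real" where
  "framework_bound x y z \<eta> =
     (1 - exp (-\<eta>)) * y *
       ((1/2) * (z + \<eta> * x) + (1 - exp (-\<eta>))\<^sup>2 * y * ((3/4) * z + \<eta> * x + 2 * \<eta>))
     + sqrt (3.068 *
         (y * (x + 2) + max 1 \<eta> * exp (- max 1 \<eta>) * y * z + x / 2
          + exp (-\<eta>) / (1 - exp (-\<eta>)) * (z / 2)))"

end

theory Submission
  imports Defs "HOL-Complex_Analysis.Conformal_Mappings"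
begin

text \<open>
Write \<open>R\<close> for the order parameter and \<open>F i\<close> for the mean of \<open>sin (\<theta> i - \<theta> k)\<close> over \<open>k\<close>, so that the model reads
\<open>m * \<omega>' i + \<omega> i = \<nu> i - \<kappa> * F i\<close>, the \<open>F i\<close> have mean zero, and \<open>(R\<^sup>2)' = - 2 * mean (\<omega> i * F i)\<close>.

\<^emph>\<open>Reduction to first order.\<close> Variation of constants, with the coupling frozen at the current time, gives
\<open>\<omega> i = \<kappa> * (P i - (1 - exp (- t / m)) * F i)\<close>. The differences of the \<open>P i\<close> come from the natural
frequencies, from what is left of the initial velocities, and from the memory of the coupling, which has
size \<open>m * \<kappa>\<close> (\<open>velocity_eq\<close>, \<open>forcing_spread\<close>). Up to time \<open>\<eta> * m\<close> this forcing can lower \<open>R\<close>, but only by the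
first summand of \<open>framework_bound\<close> (\<open>order_parameter_loss\<close>). Afterwards these differences are at
most \<open>2 * g * (1 - exp (- t / m))\<close> with \<open>g = effective_detuning x y z \<eta> * R0\<^sup>2\<close>, and the hypothesis on
\<open>framework_bound\<close> says that \<open>R\<^sup>2 > 3.068 * g\<close> at time \<open>\<eta> * m\<close> (\<open>coherence_after_initial_layer\<close>).

\<^emph>\<open>A trapped majority.\<close> While the \<open>F i\<close> exceed \<open>g\<close> in quadratic mean, \<open>R\<close> grows; since \<open>R \<le> 1\<close>, at some time they
are at most \<open>R\<^sup>2 / 3.068\<close> in quadratic mean. Then the phases accumulate near the mean phase and its antipode, and
the value of \<open>R\<close> puts more than half of them near the mean phase (\<open>majority_cluster\<close>). The constant \<open>3.068\<close>
is what is needed for the attraction inside this cluster to beat the forcing even if all other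
oscillators are opposed to it (\<open>majority_numerics\<close>). Hence the cluster never spreads beyond its initial
arc (\<open>cluster_trapped\<close>). The same estimate prevents the other oscillators from overtaking the
cluster, so that all phase differences remain bounded (\<open>outsider_bounded\<close>).

\<^emph>\<open>Convergence.\<close> Boundedness makes the energy converge, so the velocities tend to their mean and the accelerations to
zero, and \<open>F i\<close> tends to \<open>a i = (\<nu> i - \<nu>c) / \<kappa>\<close> (\<open>velocity_and_acceleration_limits\<close>, \<open>coupling_limit\<close>). The limit points
of the phase differences are therefore attained at equilibria with \<open>R > 0\<close>. At such an equilibrium
\<open>sin (u i - \<phi>) = a i / R\<close>, and \<open>R\<close> is the mean of \<open>sqrt (1 - (a i / R)\<^sup>2)\<close> with suitable signs. This is an
analytic equation for \<open>R\<close>, so only countably many phase differences are possible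
(\<open>countable_equilibrium_differences\<close>), and a bounded continuous function with countably many limit points
converges (\<open>convergent_if_limit_points_countable\<close>). The mean phase converges in the rotating frame by averaging the
equations.

\<^emph>\<open>The limit cluster.\<close> At equilibrium the balance between attraction and detuning at the two ends of the cluster
forces it into an arc of length at most \<open>pi / 3\<close>, on which the coupling is strictly monotone in the phase, with
a slope bounded from below in terms of \<open>g \<ge> x * R0\<^sup>2 / 2\<close> (\<open>cluster_equilibrium\<close>). This gives the constant
\<open>c x y z R0 = 8 / (x * R0\<^sup>2)\<close>.
\<close>

section \<open>Comparison and convergence of real functions\<close>

lemma increment_le_of_deriv_le:
  fixes f g f' g' :: "real \<Rightarrow> real"
  assumes "a \<le> b" "continuous_on {a..b} f" "continuous_on {a..b} g"
    and f: "\<And>t. a < t \<Longrightarrow> t < b \<Longrightarrow> (f has_real_derivative f' t) (at t)"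
    and g: "\<And>t. a < t \<Longrightarrow> t < b \<Longrightarrow> (g has_real_derivative g' t) (at t)"
    and le: "\<And>t. a < t \<Longrightarrow> t < b \<Longrightarrow> f' t \<le> g' t"
  shows "f b - f a \<le> g b - g a"
proof -
  have "g a - f a \<le> g b - f b"
  proof (rule DERIV_nonneg_imp_increasing_open[OF \<open>a \<le> b\<close>])
    show "\<exists>y. ((\<lambda>t. g t - f t) has_real_derivative y) (at t) \<and> 0 \<le> y" if "a < t" "t < b" for t
      using DERIV_diff[OF g[OF that] f[OF that]] le[OF that] by (intro exI[of _ "g' t - f' t"]) auto
    show "continuous_on {a..b} (\<lambda>t. g t - f t)"
      by (intro continuous_intros assms)
  qed
  then show ?thesis by simp
qed

lemma abs_increment_le_of_abs_deriv_le:
  fixes f g f' g' :: "real \<Rightarrow> real"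
  assumes "a \<le> b" "continuous_on {a..b} f" "continuous_on {a..b} g"
    and f: "\<And>t. a < t \<Longrightarrow> t < b \<Longrightarrow> (f has_real_derivative f' t) (at t)"
    and g: "\<And>t. a < t \<Longrightarrow> t < b \<Longrightarrow> (g has_real_derivative g' t) (at t)"
    and le: "\<And>t. a < t \<Longrightarrow> t < b \<Longrightarrow> \<bar>f' t\<bar> \<le> g' t"
  shows "\<bar>f b - f a\<bar> \<le> g b - g a"
proof -
  have "f b - f a \<le> g b - g a"
    by (rule increment_le_of_deriv_le[OF assms(1-3) f g]) (use le in \<open>auto simp: abs_le_iff\<close>)
  moreover have "(- f b) - (- f a) \<le> g b - g a"
  proof (rule increment_le_of_deriv_le[OF assms(1) _ assms(3) _ g])
    show "((\<lambda>t. - f t) has_real_derivative - f' t) (at t)" if "a < t" "t < b" for t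
      using f[OF that] by (rule DERIV_minus)
  qed (use le assms(2) in \<open>auto simp: abs_le_iff intro: continuous_intros\<close>)
  ultimately show ?thesis by (simp add: abs_le_iff)
qed

text \<open>
A first-exit argument: at the last time before some member exceeds the barrier, those members that
sit on it are strictly decreasing and the others are strictly below it, so by finiteness of the family
no member can get above it. The velocity condition is only asked at instants where the whole family
is still below the barrier, which is what makes estimates on extremal pairs of a cluster usable.
\<close>
lemma barrier_invariance:
  fixes f f' :: "'i \<Rightarrow> real \<Rightarrow> real"
  assumes "finite I"
    and deriv: "\<And>i t. i \<in> I \<Longrightarrow> t \<ge> t0 \<Longrightarrow> (f i has_real_derivative f' i t) (at t)"
    and init: "\<And>i. i \<in> I \<Longrightarrow> f i t0 \<le> b"
    and inward: "\<And>i t. i \<in> I \<Longrightarrow> t \<ge> t0 \<Longrightarrow> (\<And>j. j \<in> I \<Longrightarrow> f j t \<le> b) \<Longrightarrow> f i t = b \<Longrightarrow> f' i t < 0"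
    and "t \<ge> t0" "i \<in> I"
  shows "f i t \<le> b"
proof (rule ccontr)
  assume "\<not> f i t \<le> b"
  define B where "B = {s. s \<ge> t0 \<and> (\<exists>j\<in>I. f j s > b)}"
  define s where "s = Inf B"
  have tB: "t \<in> B" unfolding B_def using \<open>\<not> f i t \<le> b\<close> assms by force
  have bdd: "bdd_below B" by (auto simp: B_def intro!: bdd_belowI[of _ t0])
  have s0: "s \<ge> t0" unfolding s_def by (rule cInf_greatest) (use tB in \<open>auto simp: B_def\<close>)
  have before: "f j u \<le> b" if "j \<in> I" "t0 \<le> u" "u < s" for j u
    using cInf_lower[OF _ bdd, of u] that unfolding B_def s_def[unfolded B_def] by force
  have at_s: "f j s \<le> b" if j: "j \<in> I" for j
  proof (cases "s = t0")
    case True then show ?thesis using init j by simp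
  next
    case False
    have "(f j \<longlongrightarrow> f j s) (at_left s)"
      using DERIV_isCont[OF deriv[OF j s0]] by (simp add: continuous_at filterlim_at_split)
    moreover have "\<forall>\<^sub>F u in at_left s. f j u \<le> b"
      using before[OF j] False s0 unfolding eventually_at_left_field
      by (intro exI[of _ t0]) auto
    ultimately show ?thesis by (intro tendsto_upperbound) auto
  qed
  have "\<forall>j\<in>I. \<exists>d>0. \<forall>u. s \<le> u \<and> u < s + d \<longrightarrow> f j u \<le> b"
  proof
    fix j assume j: "j \<in> I"
    show "\<exists>d>0. \<forall>u. s \<le> u \<and> u < s + d \<longrightarrow> f j u \<le> b"
    proof (cases "f j s = b")
      case True
      from inward[OF j s0 at_s True] have "f' j s < 0" .
      from DERIV_neg_dec_right[OF deriv[OF j s0] this] obtain d where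
        d: "d > 0" "\<And>h. h > 0 \<Longrightarrow> h < d \<Longrightarrow> f j (s + h) < f j s" by auto
      have "f j u \<le> b" if "s \<le> u" "u < s + d" for u
        using d(2)[of "u - s"] that True by (cases "u = s") auto
      with d(1) show ?thesis by blast
    next
      case False
      then have lt: "f j s < b" using at_s[OF j] by simp
      have "(f j \<longlongrightarrow> f j s) (at_right s)"
        using DERIV_isCont[OF deriv[OF j s0]] by (simp add: continuous_at filterlim_at_split)
      from order_tendstoD(2)[OF this lt] obtain c where "c > s" "\<forall>u>s. u < c \<longrightarrow> f j u < b"
        unfolding eventually_at_right_field by blast
      with lt show ?thesis
        by (intro exI[of _ "c - s"]) (auto simp: less_imp_le le_less)
    qed
  qed
  then obtain d where d: "\<And>j. j \<in> I \<Longrightarrow> d j > 0"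
      "\<And>j u. j \<in> I \<Longrightarrow> s \<le> u \<Longrightarrow> u < s + d j \<Longrightarrow> f j u \<le> b"
    by metis
  define e where "e = Min (d ` I)"
  have "e \<in> d ` I" unfolding e_def using \<open>finite I\<close> \<open>i \<in> I\<close> by (intro Min_in) auto
  then have e: "e > 0" "\<And>j. j \<in> I \<Longrightarrow> e \<le> d j"
    using d(1) \<open>finite I\<close> by (auto simp: e_def)
  have "s + e \<le> Inf B"
  proof (rule cInf_greatest)
    fix u assume "u \<in> B"
    then obtain j where j: "t0 \<le> u" "j \<in> I" "f j u > b" by (auto simp: B_def)
    then have "s \<le> u" using cInf_lower[OF \<open>u \<in> B\<close> bdd] s_def by simp
    then show "s + e \<le> u" using d(2)[OF j(2), of u] e(2)[OF j(2)] j(3) by force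
  qed (use tB in auto)
  then show False using e(1) s_def by simp
qed

text \<open>
Barbalat's lemma in a form without integrals: over a short time step the increment of the convergent
function is small, so its derivative is small somewhere in the step, and a bounded second derivative
carries this smallness to the start of the step.
\<close>
lemma deriv_tendsto_zero_of_convergent:
  fixes f f' f'' :: "real \<Rightarrow> real"
  assumes lim: "(f \<longlongrightarrow> l) at_top"
    and f: "\<And>t. t \<ge> t0 \<Longrightarrow> (f has_real_derivative f' t) (at t)"
    and f': "\<And>t. t \<ge> t0 \<Longrightarrow> (f' has_real_derivative f'' t) (at t)"
    and bound: "\<And>t. t \<ge> t0 \<Longrightarrow> \<bar>f'' t\<bar> \<le> K"
  shows "(f' \<longlongrightarrow> 0) at_top"
proof (rule tendstoI)
  fix e :: real assume e: "e > 0"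
  have K: "K \<ge> 0" using bound[of t0] by linarith
  define d where "d = e / (2 * (K + 1))"
  have d: "d > 0" using e K by (simp add: d_def)
  have Kd: "K * d \<le> e / 2" using e K by (simp add: d_def field_simps)
  have "\<forall>\<^sub>F t in at_top. dist (f t) l < e * d / 4"
    by (rule tendstoD[OF lim]) (use e d in simp)
  then obtain T where T: "\<And>t. t \<ge> T \<Longrightarrow> dist (f t) l < e * d / 4"
    by (auto simp: eventually_at_top_linorder)
  show "\<forall>\<^sub>F t in at_top. dist (f' t) 0 < e"
    unfolding eventually_at_top_linorder
  proof (intro exI allI impI)
    fix t assume t: "t \<ge> max T t0"
    have "\<exists>z. z > t \<and> z < t + d \<and> f (t + d) - f t = (t + d - t) * f' z"
      by (rule MVT2) (use d f t in auto)
    then obtain z where z: "z > t" "z < t + d" "f (t + d) - f t = d * f' z" by auto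
    have "\<exists>w. w > t \<and> w < z \<and> f' z - f' t = (z - t) * f'' w"
      by (rule MVT2) (use z f' t in auto)
    then obtain w where w: "w > t" "w < z" "f' z - f' t = (z - t) * f'' w" by auto
    have "\<bar>f (t + d) - f t\<bar> < e * d / 2"
    proof -
      have "\<bar>f t - l\<bar> < e * d / 4" "\<bar>f (t + d) - l\<bar> < e * d / 4"
        using T[of t] T[of "t + d"] t d unfolding dist_real_def by auto
      then show ?thesis by linarith
    qed
    then have "d * \<bar>f' z\<bar> < d * (e / 2)" using z(3) d by (simp add: abs_mult mult.commute)
    then have 1: "\<bar>f' z\<bar> < e / 2" using d by simp
    have "\<bar>f' z - f' t\<bar> = (z - t) * \<bar>f'' w\<bar>" using w z by (simp add: abs_mult)
    also have "\<dots> \<le> d * K" by (rule mult_mono) (use bound[of w] w z d t in auto)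
    finally show "dist (f' t) 0 < e" using 1 Kd by (simp add: mult.commute)
  qed
qed

text \<open>
A continuous function that returns both near a value and a distance \<open>e\<close> above it takes every value
in between at arbitrarily late times, so every point of an interval is a limit point.
\<close>
lemma convergent_if_limit_points_countable_aux:
  fixes f :: "real \<Rightarrow> real"
  assumes cont: "continuous_on {t0..} f" and "countable C"
    and lp: "\<And>s L. filterlim s at_top sequentially \<Longrightarrow> (\<lambda>n. f (s n)) \<longlonglongrightarrow> L \<Longrightarrow> L \<in> C"
    and low: "\<And>T c. l < c \<Longrightarrow> \<exists>t\<ge>T. f t < c" and high: "\<And>T. \<exists>t\<ge>T. f t \<ge> l + e" and "e > 0"
  shows False
proof -
  have "L \<in> C" if L: "l < L" "L < l + e" for L
  proof -
    have "\<exists>t\<ge>real n. f t = L" for n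
    proof -
      obtain t1 where t1: "t1 \<ge> max (real n) t0" "f t1 < L" using low L by blast
      obtain t2 where t2: "t2 \<ge> t1" "f t2 \<ge> l + e" using high by blast
      have "continuous_on {t1..t2} f"
        by (rule continuous_on_subset[OF cont]) (use t1 in auto)
      from IVT'[OF _ _ t2(1) this, of L] obtain t where "t1 \<le> t" "f t = L"
        using t1 t2 L by force
      then show ?thesis using t1 by (intro exI[of _ t]) auto
    qed
    then obtain s where s: "\<And>n. s n \<ge> real n" "\<And>n. f (s n) = L" by metis
    have "filterlim s at_top sequentially"
      by (rule filterlim_at_top_mono[OF filterlim_real_sequentially]) (use s in auto)
    from lp[OF this] s(2) show ?thesis by simp
  qed
  then have "{l<..<l+e} \<subseteq> C" by auto
  then have "countable {l<..<l+e}" using \<open>countable C\<close> countable_subset by blast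
  moreover have "uncountable {l<..<l+e}" using \<open>e > 0\<close> by (simp add: uncountable_open_interval)
  ultimately show False by blast
qed

text \<open>
This replaces the gradient inequality of Lojasiewicz in the passage from convergence to the set of
equilibria to convergence to one equilibrium: for a scalar quantity it suffices that the values at
equilibria form a countable set, since two different limit points would produce an interval of them.
\<close>
lemma convergent_if_limit_points_countable:
  fixes f :: "real \<Rightarrow> real"
  assumes cont: "continuous_on {t0..} f" and "countable C"
    and bounded: "\<And>t. t \<ge> t0 \<Longrightarrow> \<bar>f t\<bar> \<le> K"
    and lp: "\<And>s L. filterlim s at_top sequentially \<Longrightarrow> (\<lambda>n. f (s n)) \<longlonglongrightarrow> L \<Longrightarrow> L \<in> C"
  shows "\<exists>L. (f \<longlongrightarrow> L) at_top"
proof -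
  have "bounded (range (\<lambda>n. f (t0 + real n)))"
    using bounded by (intro boundedI[of _ K]) auto
  from bounded_imp_convergent_subsequence[OF this] obtain l r where r:
    "strict_mono (r :: nat \<Rightarrow> nat)" "((\<lambda>n. f (t0 + real n)) \<circ> r) \<longlonglongrightarrow> l" by blast
  have big: "\<exists>n\<ge>M. t0 + real (r n) \<ge> T" for T M
  proof -
    obtain k where k: "T - t0 \<le> real k" using real_arch_simple by blast
    have "real (r (max k M)) \<ge> real k" using seq_suble[OF r(1), of "max k M"] by linarith
    then show ?thesis using k by (intro exI[of _ "max k M"]) auto
  qed
  have near: "\<exists>t\<ge>T. \<bar>f t - l\<bar> < d" if "d > 0" for T d
  proof -
    from LIMSEQ_D[OF r(2) that] obtain M where M: "\<And>n. n \<ge> M \<Longrightarrow> \<bar>f (t0 + real (r n)) - l\<bar> < d"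
      by auto
    then show ?thesis using big[of M T] by blast
  qed
  have "(f \<longlongrightarrow> l) at_top"
  proof (rule ccontr)
    assume "\<not> (f \<longlongrightarrow> l) at_top"
    then obtain e where e: "e > 0" "\<And>T. \<exists>t\<ge>T. \<bar>f t - l\<bar> \<ge> e"
      unfolding tendsto_iff eventually_at_top_linorder by (auto simp: dist_real_def not_less)
    consider "\<And>T. \<exists>t\<ge>T. f t \<ge> l + e" | T0 where "\<And>t. t \<ge> T0 \<Longrightarrow> f t < l + e"
      by (meson not_le)
    then show False
    proof cases
      case 1
      show False
      proof (rule convergent_if_limit_points_countable_aux[OF cont \<open>countable C\<close> lp _ 1 e(1)])
        show "\<exists>t\<ge>T. f t < c" if "l < c" for T c
          using near[of "c - l" T] that by fastforce
      qed
    next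
      case 2
      have 3: "\<exists>t\<ge>T. - f t \<ge> - l + e" for T
      proof -
        obtain t where t: "t \<ge> max T T0" "\<bar>f t - l\<bar> \<ge> e" using e(2) by blast
        with 2[of t] show ?thesis by (intro exI[of _ t]) auto
      qed
      show False
      proof (rule convergent_if_limit_points_countable_aux[of t0 "\<lambda>t. - f t" "uminus ` C" "- l" e])
        show "continuous_on {t0..} (\<lambda>t. - f t)" by (intro continuous_intros cont)
        show "L \<in> uminus ` C" if "filterlim s at_top sequentially" "(\<lambda>n. - f (s n)) \<longlonglongrightarrow> L" for s L
          using lp[OF that(1), of "- L"] tendsto_minus[OF that(2)] by (auto intro: image_eqI[of _ _ "-L"])
        show "\<exists>t\<ge>T. - f t < c" if "- l < c" for T c
          using near[of "c + l" T] that by fastforce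
      qed (use \<open>countable C\<close> 3 e in auto)
    qed
  qed
  then show ?thesis by blast
qed

lemma decreasing_bounded_below_tendsto:
  fixes f :: "real \<Rightarrow> real"
  assumes anti: "\<And>s t. t0 \<le> s \<Longrightarrow> s \<le> t \<Longrightarrow> f t \<le> f s" and low: "\<And>t. t \<ge> t0 \<Longrightarrow> c \<le> f t"
  shows "\<exists>l. (f \<longlongrightarrow> l) at_top"
proof -
  define l where "l = Inf (f ` {t0..})"
  have bdd: "bdd_below (f ` {t0..})" using low by (auto intro!: bdd_belowI[of _ c])
  have "(f \<longlongrightarrow> l) at_top"
  proof (rule decreasing_tendsto)
    show "\<forall>\<^sub>F t in at_top. l \<le> f t"
      unfolding eventually_at_top_linorder l_def by (intro exI[of _ t0]) (auto intro!: cInf_lower bdd)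
    fix x assume "l < x"
    then obtain s where s: "s \<ge> t0" "f s < x"
      using cInf_lessD[of "f ` {t0..}" x] by (auto simp: l_def)
    then show "\<forall>\<^sub>F t in at_top. f t < x"
      unfolding eventually_at_top_linorder by (intro exI[of _ s]) (auto intro: le_less_trans[OF anti])
  qed
  then show ?thesis by blast
qed

lemma simultaneous_convergent_subsequence:
  fixes f :: "'i \<Rightarrow> nat \<Rightarrow> real"
  assumes "finite I" and "\<And>i. i \<in> I \<Longrightarrow> Bseq (f i)"
  shows "\<exists>r. strict_mono (r :: nat \<Rightarrow> nat) \<and> (\<forall>i\<in>I. convergent (\<lambda>n. f i (r n)))"
  using assms
proof (induction I)
  case empty
  show ?case by (intro exI[of _ id]) (auto simp: strict_mono_def)
next
  case (insert a I)
  then obtain r where r: "strict_mono r" "\<And>i. i \<in> I \<Longrightarrow> convergent (\<lambda>n. f i (r n))" by auto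
  have "Bseq (\<lambda>n. f a (r n))"
    using insert.prems[of a] Bseq_subseq[of "f a" r] by auto
  then have "bounded (range (\<lambda>n. f a (r n)))" by (simp add: Bseq_eq_bounded)
  from bounded_imp_convergent_subsequence[OF this] obtain l q where q:
    "strict_mono (q :: nat \<Rightarrow> nat)" "((\<lambda>n. f a (r n)) \<circ> q) \<longlonglongrightarrow> l" by blast
  have "convergent (\<lambda>n. f i (r (q n)))" if "i \<in> I" for i
    using convergent_subseq_convergent[OF r(2)[OF that] q(1)] by (simp add: o_def)
  moreover have "convergent (\<lambda>n. f a (r (q n)))" using q(2) by (auto simp: o_def convergent_def)
  ultimately show ?case using r(1) q(1)
    by (intro exI[of _ "\<lambda>n. r (q n)"]) (auto simp: strict_mono_def)
qed

section \<open>Order parameter, coupling and majority clusters\<close>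

text \<open>
In terms of the order parameter \<open>R\<close> and the mean phase \<open>\<phi>\<close>, this is \<open>R * sin (u i - \<phi>)\<close> (see
\<open>polar_phase\<close>); the definition as an average avoids choosing a mean phase when \<open>R\<close> vanishes.
\<close>
definition coupling :: "nat \<Rightarrow> (nat \<Rightarrow> real) \<Rightarrow> nat \<Rightarrow> real" where
  "coupling N u i = mean N (\<lambda>k. sin (u i - u k))"

text \<open>
The component \<open>R * cos (c - \<phi>)\<close> of the complex order parameter in the direction \<open>c\<close>.
\<close>
definition alignment :: "nat \<Rightarrow> (nat \<Rightarrow> real) \<Rightarrow> real \<Rightarrow> real" where
  "alignment N u c = mean N (\<lambda>k. cos (u k - c))"

lemma mean_add: "mean N (\<lambda>i. f i + g i) = mean N f + mean N g"
  and mean_diff: "mean N (\<lambda>i. f i - g i) = mean N f - mean N g"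
  and mean_cmult: "mean N (\<lambda>i. c * f i) = c * mean N f"
  and mean_cmult_right: "mean N (\<lambda>i. f i * c) = mean N f * c"
  and mean_minus: "mean N (\<lambda>i. - f i) = - mean N f"
  by (simp_all add: mean_def sum.distrib sum_subtractf sum_distrib_left sum_distrib_right
      sum_negf algebra_simps)

lemma mean_const: "N \<ge> 1 \<Longrightarrow> mean N (\<lambda>i. c) = c"
  by (simp add: mean_def)

lemma mean_mono: "(\<And>i. i \<in> {1..N} \<Longrightarrow> f i \<le> g i) \<Longrightarrow> mean N f \<le> mean N g"
  unfolding mean_def by (intro mult_left_mono sum_mono) auto

lemma mean_cong: "(\<And>i. i \<in> {1..N} \<Longrightarrow> f i = g i) \<Longrightarrow> mean N f = mean N g"
  unfolding mean_def by (intro arg_cong2[of _ _ _ _ "(*)"] sum.cong) auto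

lemma abs_mean_le: "\<bar>mean N f\<bar> \<le> mean N (\<lambda>i. \<bar>f i\<bar>)"
  unfolding mean_def abs_mult by (intro mult_mono) (auto intro: sum_abs)

lemma abs_mean_le_bound: "N \<ge> 1 \<Longrightarrow> (\<And>i. i \<in> {1..N} \<Longrightarrow> \<bar>f i\<bar> \<le> c) \<Longrightarrow> \<bar>mean N f\<bar> \<le> c"
  by (rule order_trans[OF abs_mean_le], rule order_trans[OF mean_mono[of N _ "\<lambda>i. c"]]) (simp_all add: mean_const)

lemma mean_square_le: 
  assumes "N \<ge> 1" shows "(mean N f)\<^sup>2 \<le> mean N (\<lambda>i. (f i)\<^sup>2)"
proof -
  let ?a = "mean N f"
  have "0 \<le> mean N (\<lambda>i. (f i - ?a)\<^sup>2)" unfolding mean_def by (intro mult_nonneg_nonneg sum_nonneg) auto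
  also have "mean N (\<lambda>i. (f i - ?a)\<^sup>2) = mean N (\<lambda>i. ((f i)\<^sup>2 - (2 * ?a) * f i) + ?a\<^sup>2)"
    by (intro mean_cong) (simp add: power2_eq_square algebra_simps)
  also have "\<dots> = mean N (\<lambda>i. (f i)\<^sup>2) - ?a\<^sup>2"
    by (simp add: mean_add mean_diff mean_cmult mean_const[OF assms] power2_eq_square)
  finally show ?thesis by simp
qed

lemma DERIV_mean:
  assumes "\<And>i. i \<in> {1..N} \<Longrightarrow> (f i has_real_derivative f' i) (at t within S)"
  shows "((\<lambda>t. mean N (\<lambda>i. f i t)) has_real_derivative mean N f') (at t within S)"
  unfolding mean_def by (intro DERIV_cmult DERIV_sum assms) auto

lemma continuous_on_mean:
  fixes f :: "nat \<Rightarrow> 'a::topological_space \<Rightarrow> real"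
  assumes "\<And>i. i \<in> {1..N} \<Longrightarrow> continuous_on S (f i)"
  shows "continuous_on S (\<lambda>t. mean N (\<lambda>i. f i t))"
  unfolding mean_def by (intro continuous_intros assms) auto

lemma tendsto_mean:
  assumes "\<And>i. i \<in> {1..N} \<Longrightarrow> (f i \<longlongrightarrow> l i) F"
  shows "((\<lambda>t. mean N (\<lambda>i. f i t)) \<longlongrightarrow> mean N l) F"
  unfolding mean_def by (intro tendsto_intros assms) auto

lemma alignment_eq:
  "alignment N u c = mean N (\<lambda>k. cos (u k)) * cos c + mean N (\<lambda>k. sin (u k)) * sin c"
  by (simp add: alignment_def cos_diff mean_add mean_cmult_right)

lemma coupling_eq:
  "coupling N u i = sin (u i) * mean N (\<lambda>k. cos (u k)) - cos (u i) * mean N (\<lambda>k. sin (u k))"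
  by (simp add: coupling_def sin_diff mean_diff mean_cmult)

lemma mean_coupling: "mean N (coupling N u) = 0"
  unfolding coupling_eq by (simp add: mean_diff mean_cmult_right)

lemma order_parameter_sq:
  "(order_parameter N u)\<^sup>2 = (mean N (\<lambda>k. cos (u k)))\<^sup>2 + (mean N (\<lambda>k. sin (u k)))\<^sup>2"
proof -
  have *: "exp (\<i> * of_real (u j)) = Complex (cos (u j)) (sin (u j))" for j
    by (simp add: cis_conv_exp[symmetric] cis.ctr)
  have "(1 / of_nat N) * (\<Sum>j = 1..N. exp (\<i> * of_real (u j)))
      = Complex (mean N (\<lambda>k. cos (u k))) (mean N (\<lambda>k. sin (u k)))"
    unfolding mean_def * by (simp add: complex_eq_iff Re_divide Im_divide Re_sum Im_sum power2_eq_square)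
  then show ?thesis unfolding order_parameter_def by (simp add: cmod_power2)
qed

lemma order_parameter_nonneg: "order_parameter N u \<ge> 0"
  by (simp add: order_parameter_def)

lemma order_parameter_le_1:
  assumes "N \<ge> 1" shows "order_parameter N u \<le> 1"
proof -
  have "(order_parameter N u)\<^sup>2 \<le> mean N (\<lambda>k. (cos (u k))\<^sup>2) + mean N (\<lambda>k. (sin (u k))\<^sup>2)"
    unfolding order_parameter_sq using mean_square_le[OF assms] by (intro add_mono)
  also have "\<dots> = 1" by (simp add: mean_add[symmetric] mean_const[OF assms])
  finally show ?thesis by (simp add: power2_le_imp_le[of _ 1])
qed

lemma polar_phase:
  obtains \<phi> where "\<And>c. alignment N u c = order_parameter N u * cos (c - \<phi>)"
    "\<And>i. coupling N u i = order_parameter N u * sin (u i - \<phi>)"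
proof -
  let ?z = "Complex (mean N (\<lambda>k. cos (u k))) (mean N (\<lambda>k. sin (u k)))"
  have "cmod ?z = order_parameter N u"
    by (rule power2_eq_imp_eq) (simp_all add: cmod_power2 order_parameter_sq order_parameter_nonneg)
  then have *: "mean N (\<lambda>k. cos (u k)) = order_parameter N u * cos (Arg ?z)"
     "mean N (\<lambda>k. sin (u k)) = order_parameter N u * sin (Arg ?z)"
    using rcis_cmod_Arg[of ?z] by (auto simp: complex_eq_iff rcis_def)
  show ?thesis
  proof (rule that[of "Arg ?z"])
    show "alignment N u c = order_parameter N u * cos (c - Arg ?z)" for c
      unfolding alignment_eq by (subst (1) *(1), subst *(2)) (simp add: cos_diff algebra_simps)
    show "coupling N u i = order_parameter N u * sin (u i - Arg ?z)" for i
      unfolding coupling_eq by (subst (1) *(1), subst *(2)) (simp add: sin_diff algebra_simps)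
  qed
qed

text \<open>
The two oscillators of a pair attract each other at a rate given by the alignment of the whole
ensemble with their midpoint. The dynamics of clusters rests on this identity.
\<close>
lemma coupling_diff:
  "coupling N u i - coupling N u j = 2 * sin ((u i - u j) / 2) * alignment N u ((u i + u j) / 2)"
proof -
  have "coupling N u i - coupling N u j = mean N (\<lambda>k. 2 * sin ((u i - u j) / 2) * cos (u k - (u i + u j) / 2))"
    unfolding coupling_def mean_diff[symmetric]
  proof (rule mean_cong)
    fix k
    have "sin (u i - u k) - sin (u j - u k) = 2 * sin ((u i - u j) / 2) * cos ((u i + u j) / 2 - u k)"
      using sin_diff_sin[of "u i - u k" "u j - u k"] by (simp add: field_simps)
    then show "sin (u i - u k) - sin (u j - u k) = 2 * sin ((u i - u j) / 2) * cos (u k - (u i + u j) / 2)"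
      by (metis cos_minus minus_diff_eq)
  qed
  then show ?thesis by (simp add: alignment_def mean_cmult)
qed

lemma abs_coupling_le: "\<bar>coupling N u i\<bar> \<le> order_parameter N u"
proof -
  obtain \<phi> where "coupling N u i = order_parameter N u * sin (u i - \<phi>)" using polar_phase by blast
  then show ?thesis
    using order_parameter_nonneg[of N u] by (simp add: abs_mult mult_left_le)
qed

lemma alignment_le: "alignment N u c \<le> order_parameter N u"
proof -
  obtain \<phi> where "alignment N u c = order_parameter N u * cos (c - \<phi>)" using polar_phase by blast
  then show ?thesis
    using order_parameter_nonneg[of N u] by (simp add: mult_left_le)
qed

lemma sin_shift: "sin (x - 2 * of_int n * pi) = sin (x::real)"
  and cos_shift: "cos (x - 2 * of_int n * pi) = cos (x::real)"
proof -
  have "2 * of_int n * pi = 2 * pi * of_int n" by simp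
  then show "sin (x - 2 * of_int n * pi) = sin x" "cos (x - 2 * of_int n * pi) = cos x"
    by (simp_all only: sin_diff cos_diff sin_int_2pin cos_int_2pin mult_0_right mult_1_right diff_0_right add_0_right)
qed

text \<open>
If a proportion \<open>l\<close> of the oscillators lies in an arc of half-width \<open>b\<close>, then in the worst case the
others sit at the antipode of its centre, and the alignment with the centre is at least
\<open>l * cos b - (1 - l)\<close>. By \<open>coupling_diff\<close>, twice this gain bounds from below the difference of the
couplings at the two ends of the arc.
\<close>
definition cluster_gain :: "real \<Rightarrow> real \<Rightarrow> real" where
  "cluster_gain l b = sin b * (l * (1 + cos b) - 1)"

text \<open>
On \<open>{0..pi/3}\<close> the gain is a concave function of the half-width as soon as \<open>l \<ge> 1/2\<close>, so it stays
above a level that it exceeds at both ends of an interval.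
\<close>
lemma cluster_gain_ge_between:
  assumes "l \<ge> 1/2" "0 \<le> a" "a \<le> u" "u \<le> b" "b \<le> pi / 3"
    and "cluster_gain l a > g" "cluster_gain l b > g"
  shows "cluster_gain l u > g"
proof (cases "a = b")
  case True then show ?thesis using assms by force
next
  case False
  then have ab: "a < b" using assms by simp
  have conv: "convex_on {a..b} (\<lambda>u. - cluster_gain l u)"
  proof (rule f''_ge0_imp_convex)
    fix u assume "u \<in> {a..b}"
    then have u: "0 \<le> u" "u \<le> pi / 3" using assms by auto
    show "((\<lambda>u. - cluster_gain l u) has_real_derivative
       - (cos u * (l * (1 + cos u) - 1) - sin u * (l * sin u))) (at u)"
      unfolding cluster_gain_def by (auto intro!: derivative_eq_intros simp: algebra_simps)
    show "((\<lambda>u. - (cos u * (l * (1 + cos u) - 1) - sin u * (l * sin u))) has_real_derivative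
       sin u * (4 * l * cos u + l - 1)) (at u)"
      by (auto intro!: derivative_eq_intros simp: algebra_simps)
    have "cos u \<ge> 1 / 2" using cos_monotone_0_pi_le[of u "pi/3"] u by (simp add: cos_60)
    then have "4 * l * cos u \<ge> 4 * l * (1/2)" using assms(1) by (intro mult_left_mono) auto
    then have "4 * l * cos u + l - 1 \<ge> 0" using assms(1) by linarith
    then show "sin u * (4 * l * cos u + l - 1) \<ge> 0"
      using u sin_ge_zero[of u] by simp
  qed simp
  define s where "s = (u - a) / (b - a)"
  have s: "0 \<le> s" "s \<le> 1" using ab assms by (auto simp: s_def field_simps)
  have "s * (b - a) = u - a" using ab by (simp add: s_def)
  then have "(1 - s) *\<^sub>R a + s *\<^sub>R b = u" unfolding real_scaleR_def left_diff_distrib right_diff_distrib by linarith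
  with convex_onD[OF conv s, of a b] ab
  have "- cluster_gain l u \<le> (1 - s) * (- cluster_gain l a) + s * (- cluster_gain l b)" by simp
  also have "\<dots> < (1 - s) * (- g) + s * (- g)"
  proof (cases "s = 0")
    case True then show ?thesis using assms by simp
  next
    case False
    then have "s * (- cluster_gain l b) < s * (- g)" using s assms by (intro mult_strict_left_mono) auto
    moreover have "(1 - s) * (- cluster_gain l a) \<le> (1 - s) * (- g)"
      using s assms by (intro mult_left_mono) auto
    ultimately show ?thesis by linarith
  qed
  also have "\<dots> = - g" by (simp add: algebra_simps)
  finally show ?thesis by simp
qed

lemma alignment_ge_of_cluster:
  assumes "N \<ge> 1" "A \<subseteq> {1..N}" "b \<le> pi"
    and near: "\<And>k. k \<in> A \<Longrightarrow> \<bar>u k - 2 * of_int (n k) * pi - c\<bar> \<le> b"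
  shows "alignment N u c \<ge> real (card A) / real N * (1 + cos b) - 1"
proof -
  have fin: "finite A" using assms(2) finite_subset by blast
  have "(\<Sum>k\<in>{1..N}. (if k \<in> A then 1 + cos b else 0) - 1) \<le> (\<Sum>k\<in>{1..N}. cos (u k - c))"
  proof (rule sum_mono)
    fix k
    show "(if k \<in> A then 1 + cos b else 0) - 1 \<le> cos (u k - c)"
    proof (cases "k \<in> A")
      case True
      have "cos (u k - c) = cos ((u k - c) - 2 * of_int (n k) * pi)" by (simp only: cos_shift)
      also have "\<dots> = cos \<bar>u k - 2 * of_int (n k) * pi - c\<bar>"
        unfolding cos_abs_real by (rule arg_cong[of _ _ cos]) (simp add: algebra_simps)
      also have "\<dots> \<ge> cos b"
        using near[OF True] assms(3) by (intro cos_monotone_0_pi_le) auto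
      finally show ?thesis using True by simp
    qed auto
  qed
  also have "(\<Sum>k\<in>{1..N}. (if k \<in> A then 1 + cos b else 0) - 1) = real (card A) * (1 + cos b) - real N"
    using assms(2) by (simp add: sum_subtractf sum.If_cases Int_absorb1)
  finally have "(real (card A) * (1 + cos b) - real N) / real N \<le> (\<Sum>k\<in>{1..N}. cos (u k - c)) / real N"
    by (rule divide_right_mono) simp
  then show ?thesis using assms(1) by (simp add: alignment_def mean_def diff_divide_distrib)
qed

lemma near_of_cos_ge:
  assumes "cos v \<ge> q" "-1 \<le> q" "q \<le> 1"
  shows "\<exists>n::int. \<bar>v - 2 * of_int n * pi\<bar> \<le> arccos q"
proof -
  define n where "n = \<lfloor>(v + pi) / (2 * pi)\<rfloor>"
  define w where "w = v - 2 * of_int n * pi"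
  have "of_int n \<le> (v + pi) / (2 * pi)" "(v + pi) / (2 * pi) < of_int n + 1"
    unfolding n_def by linarith+
  then have "- pi \<le> w" "w \<le> pi" using pi_gt_zero by (auto simp: w_def field_simps)
  then have "\<bar>w\<bar> \<le> pi" by (simp add: abs_le_iff)
  moreover have "cos w = cos v" unfolding w_def by (rule cos_shift)
  ultimately have "\<bar>w\<bar> = arccos (cos v)"
    using arccos_cos[of "\<bar>w\<bar>"] by simp
  also have "\<dots> \<le> arccos q" using assms by (subst arccos_le_mono) auto
  finally show ?thesis unfolding w_def by blast
qed

text \<open>
Here \<open>r\<close> is the order parameter and \<open>v\<close> the mean of \<open>(sin (u i - \<phi>))\<^sup>2\<close>. The first bound on \<open>v\<close> will
hold at the time given by \<open>bipolar_time\<close>, and \<open>v \<le> 1 - r\<^sup>2\<close> always holds. The number \<open>l\<close> is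
the proportion of oscillators with \<open>cos (u i - \<phi>) \<ge> q\<close>; the bound on it is shown in \<open>majority_cluster\<close>.
The two conclusions say that the gain of the cluster is at least \<open>r\<^sup>2 / 3.068\<close> at its half-width \<open>arccos q\<close>
and, if that is more than \<open>pi / 6\<close>, also at \<open>pi / 6\<close>.

The two bounds on \<open>v\<close> cross at \<open>r\<close> about \<open>0.95077\<close>. This is the critical case, where \<open>q\<close> about \<open>0.606\<close> is
optimal and the inequality holds with a margin of a few times \<open>10^-4\<close>; hence the constant \<open>3.068\<close>. For
smaller \<open>r\<close> the choice \<open>1 - q\<close> proportional to \<open>r\<close> gives the right scaling, since
both \<open>l - 1/2\<close> and the square of the half-width are then of order \<open>r\<close>.
\<close>
lemma majority_numerics:
  fixes r v :: real
  assumes r: "0 < r" "r \<le> 1" and v: "v \<le> (r / 3.068)\<^sup>2" "v \<le> 1 - r\<^sup>2"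
  obtains q where "1/2 \<le> q" "q < 1"
    "\<And>l. l \<ge> (1 + r) / 2 - v / (2 * (1 - q)) \<Longrightarrow>
      r\<^sup>2 / 3.068 \<le> sqrt (1 - q\<^sup>2) * (l * (1 + q) - 1) \<and>
      (q \<ge> sqrt 3 / 2 \<or> r\<^sup>2 / 3.068 \<le> (l * (1 + sqrt 3 / 2) - 1) / 2)"
proof -
  have s3: "sqrt 3 / 2 \<ge> 0.866" "sqrt 3 / 2 \<le> 0.8661"
  proof -
    have "1.732 \<le> sqrt 3" by (rule real_le_rsqrt) (simp add: power2_eq_square)
    moreover have "sqrt 3 \<le> 1.7322" by (rule real_le_lsqrt) (simp_all add: power2_eq_square)
    ultimately show "sqrt 3 / 2 \<ge> 0.866" "sqrt 3 / 2 \<le> 0.8661" by simp_all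
  qed
  show ?thesis
  proof (cases "r \<le> 0.9508")
    case True
    \<comment> \<open>The optimal slope at the critical order parameter is about \<open>(1 - 0.606) / 0.9508\<close>.\<close>
    define q where "q = 1 - 0.415 * r"
    show ?thesis
    proof (rule that[of q])
      show "1/2 \<le> q" "q < 1" using r by (auto simp: q_def)
      fix l assume l: "l \<ge> (1 + r) / 2 - v / (2 * (1 - q))"
      have "v / (2 * (1 - q)) \<le> (r / 3.068)\<^sup>2 / (2 * (1 - q))"
        using v r by (intro divide_right_mono) (auto simp: q_def)
      also have "\<dots> \<le> 0.12801 * r" using r by (simp add: q_def field_simps power2_eq_square)
      finally have l1: "l \<ge> 0.5 + 0.37199 * r" using l by (simp add: add_divide_distrib)
      then have l2: "(0.5 + 0.37199 * r) * (1 + p) \<le> l * (1 + p)" if "p \<ge> 0" for p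
        using that by (intro mult_right_mono) auto
      define B where "B = 0.53648 - 0.15438 * r"
      have B: "B \<ge> 0.38969" using True by (simp add: B_def)
      have "r * B \<le> (0.5 + 0.37199 * r) * (1 + q) - 1"
        using r by (simp add: q_def B_def algebra_simps)
      also have "\<dots> \<le> l * (1 + q) - 1" using l2[of q] \<open>1/2 \<le> q\<close> by simp
      finally have rB: "r * B \<le> l * (1 + q) - 1" .
      have "B\<^sup>2 \<ge> 0.38969\<^sup>2" using B by (intro power_mono) auto
      then have "0.38969\<^sup>2 * 1.605418 \<le> B\<^sup>2 * (2 - 0.415 * r)"
        using True by (intro mult_mono) auto
      then have "r \<le> 3.068\<^sup>2 * 0.415 * (B\<^sup>2 * (2 - 0.415 * r))"
        using True by (simp add: power2_eq_square)
      then have "r * r \<le> r * (3.068\<^sup>2 * 0.415 * (B\<^sup>2 * (2 - 0.415 * r)))"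
        using r by (intro mult_left_mono) auto
      then have "r\<^sup>2 \<le> (1 - q\<^sup>2) * (3.068 * B)\<^sup>2"
        by (simp add: q_def power2_eq_square algebra_simps)
      then have "sqrt (r\<^sup>2) \<le> sqrt ((1 - q\<^sup>2) * (3.068 * B)\<^sup>2)" by (rule real_sqrt_le_mono)
      then have "r \<le> sqrt (1 - q\<^sup>2) * (3.068 * B)"
        using r B by (simp add: real_sqrt_mult)
      then have "r\<^sup>2 / 3.068 \<le> sqrt (1 - q\<^sup>2) * (r * B)"
        using r by (simp add: power2_eq_square field_simps)
      also have "\<dots> \<le> sqrt (1 - q\<^sup>2) * (l * (1 + q) - 1)"
        using rB \<open>q < 1\<close> \<open>1/2 \<le> q\<close> by (intro mult_left_mono) (auto simp: abs_square_le_1 intro: power_le_one)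
      finally have 1: "r\<^sup>2 / 3.068 \<le> sqrt (1 - q\<^sup>2) * (l * (1 + q) - 1)" .
      have 2: "r\<^sup>2 / 3.068 \<le> (l * (1 + sqrt 3 / 2) - 1) / 2" if "q < sqrt 3 / 2"
      proof -
        have "r \<ge> 0.3226" using that s3 by (simp add: q_def)
        then have "(r - 0.3226) * (0.9508 - r) \<ge> 0" using True by simp
        then have "r\<^sup>2 \<le> 1.2734 * r - 0.3067" by (simp add: power2_eq_square algebra_simps)
        moreover have "(0.5 + 0.37199 * r) * 1.866 \<le> l * (1 + sqrt 3 / 2)"
          using l1 s3 r by (intro mult_mono) auto
        ultimately show ?thesis using True by (simp add: algebra_simps)
      qed
      show "r\<^sup>2 / 3.068 \<le> sqrt (1 - q\<^sup>2) * (l * (1 + q) - 1) \<and>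
        (q \<ge> sqrt 3 / 2 \<or> r\<^sup>2 / 3.068 \<le> (l * (1 + sqrt 3 / 2) - 1) / 2)"
        using 1 2 by linarith
    qed
  next
    case False
    have r2: "r\<^sup>2 \<ge> 0.9508\<^sup>2" using False by (intro power_mono) auto
    \<comment> \<open>The value of \<open>1 - 0.415 * r\<close> at \<open>r = 0.9508\<close>; from there on everything is monotone in \<open>r\<close>.\<close>
    define q :: real where "q = 0.605418"
    show ?thesis
    proof (rule that[of q])
      show "1/2 \<le> q" "q < 1" by (auto simp: q_def)
      fix l assume l: "l \<ge> (1 + r) / 2 - v / (2 * (1 - q))"
      have "v / (2 * (1 - q)) \<le> (1 - r\<^sup>2) / (2 * (1 - q))"
        using v by (intro divide_right_mono) (auto simp: q_def)
      also have "\<dots> \<le> (1 - r\<^sup>2) * 1.26717"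
        using r by (simp add: q_def field_simps abs_square_le_1 power_le_one)
      finally have "v / (2 * (1 - q)) \<le> (1 - r\<^sup>2) * 1.26717" .
      moreover define X where "X = v / (2 * (1 - q))"
      ultimately have l1: "l \<ge> 0.5 + 0.5 * r - 1.26717 + 1.26717 * r\<^sup>2"
        using l unfolding X_def[symmetric] by (simp add: add_divide_distrib diff_divide_distrib algebra_simps)
      with r2 False have l0: "l \<ge> 0.85377"
        by (simp add: power2_eq_square add_divide_distrib diff_divide_distrib)
      have "sqrt (1 - q\<^sup>2) \<ge> 0.7959"
        by (rule real_le_rsqrt) (simp add: q_def power2_eq_square)
      then have "0.7959 * (l * (1 + q) - 1) \<le> sqrt (1 - q\<^sup>2) * (l * (1 + q) - 1)"
        using l0 by (intro mult_right_mono) (auto simp: q_def)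
      moreover have "r\<^sup>2 / 3.068 \<le> 0.7959 * (l * (1 + q) - 1)"
        using l1 r2 False by (simp add: q_def power2_eq_square)
      ultimately have 1: "r\<^sup>2 / 3.068 \<le> sqrt (1 - q\<^sup>2) * (l * (1 + q) - 1)" by (rule order_trans[rotated])
      have "r\<^sup>2 / 3.068 \<le> (l * 1.866 - 1) / 2"
        using l1 r2 False by (simp add: power2_eq_square)
      also have "\<dots> \<le> (l * (1 + sqrt 3 / 2) - 1) / 2"
        using l0 s3 by (intro divide_right_mono diff_right_mono mult_left_mono) auto
      finally show "r\<^sup>2 / 3.068 \<le> sqrt (1 - q\<^sup>2) * (l * (1 + q) - 1) \<and>
        (q \<ge> sqrt 3 / 2 \<or> r\<^sup>2 / 3.068 \<le> (l * (1 + sqrt 3 / 2) - 1) / 2)"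
        using 1 by blast
    qed
  qed
qed

text \<open>
If the couplings \<open>r * sin (u i - \<phi>)\<close> are small in quadratic mean, most phases are close to \<open>\<phi>\<close> or to
its antipode, and the mean of the cosines, which is \<open>r\<close>, forces more than half of them to be close to
\<open>\<phi>\<close>. The proportion is estimated by comparing the indicator of the cluster pointwise with a combination
of \<open>cos\<close> and \<open>sin\<^sup>2\<close> whose mean is known.
\<close>
lemma majority_cluster:
  assumes N: "N \<ge> 1" and r: "r = order_parameter N u" "r > 0"
    and V: "mean N (\<lambda>i. (coupling N u i)\<^sup>2) \<le> (r\<^sup>2 / 3.068)\<^sup>2"
  obtains A b n c where "A \<subseteq> {1..N}" "0 < b" "b \<le> pi / 3"
    "real (card A) / real N > 1 / 2"
    "\<And>k. k \<in> A \<Longrightarrow> \<bar>u k - 2 * of_int (n k) * pi - c\<bar> \<le> b"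
    "cluster_gain (real (card A) / real N) b \<ge> r\<^sup>2 / 3.068"
    "b \<le> pi / 6 \<or> cluster_gain (real (card A) / real N) (pi / 6) \<ge> r\<^sup>2 / 3.068"
proof -
  obtain \<phi> where pol: "\<And>c. alignment N u c = r * cos (c - \<phi>)"
      "\<And>i. coupling N u i = r * sin (u i - \<phi>)"
    using polar_phase[of N u] r(1) by metis
  define v where "v = mean N (\<lambda>i. (sin (u i - \<phi>))\<^sup>2)"
  have r1: "r \<le> 1" using order_parameter_le_1[OF N] r by simp
  have "mean N (\<lambda>i. (coupling N u i)\<^sup>2) = r\<^sup>2 * v"
    by (simp add: pol(2) v_def power_mult_distrib mean_cmult)
  with V have "r\<^sup>2 * v \<le> r\<^sup>2 * (r / 3.068)\<^sup>2" by (simp add: power2_eq_square)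
  then have v1: "v \<le> (r / 3.068)\<^sup>2" using r(2) by simp
  have ral: "r = mean N (\<lambda>i. cos (u i - \<phi>))" using pol(1)[of \<phi>] by (simp add: alignment_def)
  have "r\<^sup>2 \<le> mean N (\<lambda>i. (cos (u i - \<phi>))\<^sup>2)"
    by (subst ral) (rule mean_square_le[OF N])
  also have "\<dots> = mean N (\<lambda>i. 1 - (sin (u i - \<phi>))\<^sup>2)" by (simp add: cos_squared_eq)
  also have "\<dots> = 1 - v" by (simp add: mean_diff mean_const[OF N] v_def)
  finally have v2: "v \<le> 1 - r\<^sup>2" by simp
  from majority_numerics[OF r(2) r1 v1 v2] obtain q where q: "1/2 \<le> q" "q < 1" and
    num: "\<And>l. l \<ge> (1 + r) / 2 - v / (2 * (1 - q)) \<Longrightarrow>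
      r\<^sup>2 / 3.068 \<le> sqrt (1 - q\<^sup>2) * (l * (1 + q) - 1) \<and>
      (q \<ge> sqrt 3 / 2 \<or> r\<^sup>2 / 3.068 \<le> (l * (1 + sqrt 3 / 2) - 1) / 2)" by blast
  define A where "A = {i \<in> {1..N}. cos (u i - \<phi>) \<ge> q}"
  define l where "l = real (card A) / real N"
  \<comment> \<open>The weights make both sides agree at \<open>cos = -1\<close>, at \<open>cos = 1\<close> and, from the left, at \<open>cos = q\<close>.\<close>
  have "mean N (\<lambda>i. (1/2 + (1/2) * cos (u i - \<phi>)) - (1 / (2 * (1 - q))) * (sin (u i - \<phi>))\<^sup>2)
      \<le> mean N (\<lambda>i. if i \<in> A then 1 else 0)"
  proof (rule mean_mono)
    fix i assume i: "i \<in> {1..N}"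
    let ?c = "cos (u i - \<phi>)"
    show "(1/2 + (1/2) * ?c) - (1 / (2 * (1 - q))) * (sin (u i - \<phi>))\<^sup>2 \<le> (if i \<in> A then 1 else 0)"
    proof (cases "i \<in> A")
      case True
      have "(1 / (2 * (1 - q))) * (sin (u i - \<phi>))\<^sup>2 \<ge> 0" using q by simp
      then have "(1/2 + (1/2) * ?c) - (1 / (2 * (1 - q))) * (sin (u i - \<phi>))\<^sup>2 \<le> 1"
        using cos_le_one[of "u i - \<phi>"] by linarith
      then show ?thesis using True by simp
    next
      case False
      then have "?c \<le> q" using i by (simp add: A_def)
      then have "(1 + ?c) * (?c - q) \<le> 0"
        using cos_ge_minus_one[of "u i - \<phi>"] by (intro mult_nonneg_nonpos) linarith+
      then have "(1 + ?c) * (1 - q) \<le> 1 - ?c\<^sup>2" by (simp add: algebra_simps power2_eq_square)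
      then have "(1 + ?c) * (1 - q) \<le> (sin (u i - \<phi>))\<^sup>2" by (simp add: sin_squared_eq)
      then show ?thesis using False q by (simp add: field_simps)
    qed
  qed
  also have "\<dots> = l"
    unfolding mean_def l_def by (simp add: sum.If_cases A_def Int_def conj_commute)
  finally have "l \<ge> (1 + r) / 2 - v / (2 * (1 - q))"
    unfolding mean_diff mean_add mean_cmult mean_const[OF N] ral[symmetric] v_def[symmetric]
    by (simp add: add_divide_distrib)
  note num = num[OF this]
  define b where "b = arccos q"
  have cb: "cos b = q" "sin b = sqrt (1 - q\<^sup>2)" using q by (simp_all add: b_def cos_arccos sin_arccos)
  have near: "\<exists>n::int. \<bar>u k - \<phi> - 2 * of_int n * pi\<bar> \<le> b" if "k \<in> A" for k
    using near_of_cos_ge[of q "u k - \<phi>"] that q by (auto simp: A_def b_def)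
  define n where "n k = (SOME n::int. \<bar>u k - \<phi> - 2 * of_int n * pi\<bar> \<le> b)" for k
  have "0 < r\<^sup>2 / 3.068" using r by simp
  also have "\<dots> \<le> sqrt (1 - q\<^sup>2) * (l * (1 + q) - 1)" using num by simp
  finally have "l * (1 + q) - 1 > 0"
    using q power_le_one[of q 2] by (auto simp: zero_less_mult_iff)
  then have "l * (1 + q) > 1" by simp
  moreover have "l * (1 + q) \<le> l * 2" using q by (intro mult_left_mono) (auto simp: l_def)
  ultimately have l: "l > 1 / 2" by simp
  have gain: "cluster_gain l b \<ge> r\<^sup>2 / 3.068" using num by (simp add: cluster_gain_def cb)
  show ?thesis
  proof (rule that[of A b n \<phi>])
    show "0 < b" using q arccos_lt_bounded[of q] by (simp add: b_def)
    show "b \<le> pi / 3"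
    proof -
      have "arccos q \<le> arccos (1/2)" using q by (subst arccos_le_mono) auto
      also have "arccos (1/2) = pi / 3" using arccos_cos[of "pi/3"] by (simp add: cos_60)
      finally show ?thesis by (simp add: b_def)
    qed
    show "\<bar>u k - 2 * of_int (n k) * pi - \<phi>\<bar> \<le> b" if "k \<in> A" for k
      using someI_ex[OF near[OF that]] unfolding n_def[symmetric] by (simp add: algebra_simps)
    show "b \<le> pi / 6 \<or> cluster_gain (real (card A) / real N) (pi / 6) \<ge> r\<^sup>2 / 3.068"
    proof (cases "q \<ge> sqrt 3 / 2")
      case True
      then have "arccos q \<le> arccos (sqrt 3 / 2)" using q by (subst arccos_le_mono) (auto intro: order_trans)
      also have "arccos (sqrt 3 / 2) = pi / 6" using arccos_cos[of "pi/6"] by (simp add: cos_30)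
      finally show ?thesis by (simp add: b_def)
    next
      case False
      with num show ?thesis
        by (simp add: cluster_gain_def sin_30 cos_30 l_def[symmetric])
    qed
  qed (use l gain in \<open>auto simp: A_def l_def\<close>)
qed

section \<open>Cluster formation under perturbed first-order dynamics\<close>

lemma DERIV_coupling:
  assumes "\<And>k. k \<in> {1..N} \<Longrightarrow> ((\<theta> k) has_real_derivative \<omega> k) (at t)" "i \<in> {1..N}"
  shows "((\<lambda>t. coupling N (\<lambda>k. \<theta> k t) i) has_real_derivative
    mean N (\<lambda>k. cos (\<theta> i t - \<theta> k t) * (\<omega> i - \<omega> k))) (at t)"
  unfolding coupling_def
  by (rule DERIV_mean) (use assms in \<open>auto intro!: derivative_eq_intros\<close>)

lemma DERIV_order_parameter_sq:
  assumes "\<And>k. k \<in> {1..N} \<Longrightarrow> ((\<theta> k) has_real_derivative \<omega> k) (at t)"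
  shows "((\<lambda>t. (order_parameter N (\<lambda>k. \<theta> k t))\<^sup>2) has_real_derivative
    - 2 * mean N (\<lambda>i. \<omega> i * coupling N (\<lambda>k. \<theta> k t) i)) (at t)"
proof -
  let ?c = "\<lambda>t. mean N (\<lambda>k. cos (\<theta> k t))" and ?s = "\<lambda>t. mean N (\<lambda>k. sin (\<theta> k t))"
  have c: "(?c has_real_derivative mean N (\<lambda>k. - sin (\<theta> k t) * \<omega> k)) (at t)"
    by (rule DERIV_mean) (use assms in \<open>auto intro!: derivative_eq_intros\<close>)
  have s: "(?s has_real_derivative mean N (\<lambda>k. cos (\<theta> k t) * \<omega> k)) (at t)"
    by (rule DERIV_mean) (use assms in \<open>auto intro!: derivative_eq_intros\<close>)
  have "mean N (\<lambda>i. \<omega> i * coupling N (\<lambda>k. \<theta> k t) i)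
      = mean N (\<lambda>i. (sin (\<theta> i t) * \<omega> i) * ?c t - (cos (\<theta> i t) * \<omega> i) * ?s t)"
    unfolding coupling_eq by (intro mean_cong) (simp add: algebra_simps)
  also have "\<dots> = mean N (\<lambda>i. sin (\<theta> i t) * \<omega> i) * ?c t - mean N (\<lambda>i. cos (\<theta> i t) * \<omega> i) * ?s t"
    by (simp only: mean_diff mean_cmult_right)
  finally have eq: "mean N (\<lambda>i. \<omega> i * coupling N (\<lambda>k. \<theta> k t) i) = \<dots>" .
  show ?thesis
    unfolding order_parameter_sq eq
    by (rule DERIV_cong[OF DERIV_add[OF DERIV_power[OF c, of 2] DERIV_power[OF s, of 2]]])
       (simp add: mean_minus algebra_simps)
qed

text \<open>
Since \<open>F\<close> has mean zero, a constant may be subtracted from \<open>P\<close>; the midpoint of the range of \<open>P\<close> halves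
the spread.
\<close>
lemma abs_mean_mult_le_of_spread:
  assumes N: "N \<ge> 1" and F: "mean N F = 0"
    and P: "\<And>i j. i \<in> {1..N} \<Longrightarrow> j \<in> {1..N} \<Longrightarrow> \<bar>P i - P j\<bar> \<le> 2 * p"
  shows "\<bar>mean N (\<lambda>i. P i * F i)\<bar> \<le> p * mean N (\<lambda>i. \<bar>F i\<bar>)"
proof -
  let ?M = "Max (P ` {1..N})" and ?m = "Min (P ` {1..N})"
  define c where "c = (?M + ?m) / 2"
  have ne: "finite (P ` {1..N})" "P ` {1..N} \<noteq> {}" using N by auto
  obtain a b where ab: "a \<in> {1..N}" "?M = P a" "b \<in> {1..N}" "?m = P b"
    using Max_in[OF ne] Min_in[OF ne] by auto
  have c: "\<bar>P i - c\<bar> \<le> p" if "i \<in> {1..N}" for i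
  proof -
    have "P i \<le> ?M" "?m \<le> P i" using ne(1) that by auto
    moreover have "?M - ?m \<le> 2 * p" using P[OF ab(1,3)] ab by simp
    ultimately show ?thesis unfolding c_def abs_le_iff by (simp add: field_simps)
  qed
  have "mean N (\<lambda>i. P i * F i) = mean N (\<lambda>i. P i * F i) - c * mean N F" using F by simp
  also have "\<dots> = mean N (\<lambda>i. (P i - c) * F i)" by (simp add: mean_cmult[symmetric] mean_diff[symmetric] algebra_simps)
  also have "\<bar>\<dots>\<bar> \<le> mean N (\<lambda>i. \<bar>(P i - c) * F i\<bar>)" by (rule abs_mean_le)
  also have "\<dots> \<le> mean N (\<lambda>i. p * \<bar>F i\<bar>)"
    by (rule mean_mono) (auto simp: abs_mult intro!: mult_right_mono c)
  finally show ?thesis by (simp add: mean_cmult)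
qed

lemma mean_abs_le_sqrt_mean_square:
  assumes "N \<ge> 1" shows "mean N (\<lambda>i. \<bar>F i\<bar>) \<le> sqrt (mean N (\<lambda>i. (F i)\<^sup>2))"
  by (rule real_le_rsqrt) (use mean_square_le[OF assms, of "\<lambda>i. \<bar>F i\<bar>"] in simp)

lemma coupling_shift: "coupling N (\<lambda>k. u k - 2 * of_int (n k) * pi) i = coupling N u i"
proof -
  have "sin ((u i - 2 * of_int (n i) * pi) - (u k - 2 * of_int (n k) * pi)) = sin (u i - u k)" for k
  proof -
    have "(u i - 2 * of_int (n i) * pi) - (u k - 2 * of_int (n k) * pi)
       = (u i - u k) - 2 * of_int (n i - n k) * pi" by (simp add: algebra_simps)
    then show ?thesis by (simp only: sin_shift)
  qed
  then show ?thesis by (simp add: coupling_def)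
qed

lemma coupling_diff_ge_of_cluster:
  assumes "N \<ge> 1" "A \<subseteq> {1..N}" "0 \<le> b" "b \<le> pi" and v: "\<And>k. v k = u k - 2 * of_int (n k) * pi"
    and ij: "v i - v j = 2 * b" and A: "\<And>k. k \<in> A \<Longrightarrow> v k \<le> v j + 2 * b \<and> v i - 2 * b \<le> v k"
  shows "coupling N u i - coupling N u j \<ge> 2 * cluster_gain (real (card A) / real N) b"
proof -
  let ?c = "(v i + v j) / 2"
  have v': "v = (\<lambda>k. u k - 2 * of_int (n k) * pi)" using v by auto
  have "coupling N u i - coupling N u j = coupling N v i - coupling N v j"
    unfolding v' coupling_shift ..
  also have "\<dots> = 2 * sin b * alignment N v ?c" unfolding coupling_diff ij by simp
  finally have eq: "coupling N u i - coupling N u j = 2 * sin b * alignment N v ?c" .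
  have "alignment N v ?c \<ge> real (card A) / real N * (1 + cos b) - 1"
  proof (rule alignment_ge_of_cluster[where n = "\<lambda>_. 0"])
    show "\<bar>v k - 2 * of_int 0 * pi - ?c\<bar> \<le> b" if "k \<in> A" for k
      using A[OF that] ij unfolding abs_le_iff by (simp add: field_simps)
  qed (use assms in auto)
  then have "2 * sin b * (real (card A) / real N * (1 + cos b) - 1) \<le> 2 * sin b * alignment N v ?c"
    using assms(3,4) by (intro mult_left_mono) (auto intro: sin_ge_zero)
  then show ?thesis unfolding eq cluster_gain_def by (simp add: mult.assoc)
qed

text \<open>
The first-order form of the dynamics. The weight \<open>w\<close> will be \<open>1 - exp (- t / m)\<close>, and \<open>P i\<close> collects
the natural frequency, the remains of the initial velocity and the memory of the coupling. Only
differences of the \<open>P i\<close> matter: a common forcing moves all phases together. In the first-order Kuramoto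
model, \<open>g\<close> would be half the spread of the natural frequencies divided by the coupling strength.
\<close>
locale perturbed_kuramoto =
  fixes N :: nat and \<kappa> :: real and \<theta> \<omega> P :: "nat \<Rightarrow> real \<Rightarrow> real" and w :: "real \<Rightarrow> real" and T g w0 :: real
  assumes N: "N \<ge> 1" and \<kappa>: "\<kappa> > 0" and g: "g > 0" and w0: "w0 > 0"
    and deriv: "\<And>i t. i \<in> {1..N} \<Longrightarrow> t \<ge> T \<Longrightarrow> (\<theta> i has_real_derivative \<omega> i t) (at t)"
    and velocity: "\<And>i t. i \<in> {1..N} \<Longrightarrow> t \<ge> T \<Longrightarrow> \<omega> i t = \<kappa> * (P i t - w t * coupling N (\<lambda>k. \<theta> k t) i)"
    and forcing: "\<And>i j t. i \<in> {1..N} \<Longrightarrow> j \<in> {1..N} \<Longrightarrow> t \<ge> T \<Longrightarrow> \<bar>P i t - P j t\<bar> \<le> 2 * (g * w t)"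
    and w: "\<And>t. t \<ge> T \<Longrightarrow> w0 \<le> w t"
begin

abbreviation "R t \<equiv> order_parameter N (\<lambda>k. \<theta> k t)"
abbreviation "F i t \<equiv> coupling N (\<lambda>k. \<theta> k t) i"
abbreviation "V t \<equiv> mean N (\<lambda>i. (F i t)\<^sup>2)"

lemma reflected: "perturbed_kuramoto N \<kappa> (\<lambda>i t. - \<theta> i t) (\<lambda>i t. - \<omega> i t) (\<lambda>i t. - P i t) w T g w0"
proof -
  have c: "coupling N (\<lambda>k. - \<theta> k t) i = - coupling N (\<lambda>k. \<theta> k t) i" for i t
  proof -
    have "sin (- \<theta> i t - - \<theta> k t) = - sin (\<theta> i t - \<theta> k t)" for k
      using sin_minus[of "\<theta> i t - \<theta> k t"] by simp
    then show ?thesis unfolding coupling_def by (simp only: mean_minus)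
  qed
  show ?thesis
  proof
    show "((\<lambda>t. - \<theta> i t) has_real_derivative - \<omega> i t) (at t)" if "i \<in> {1..N}" "T \<le> t" for i t
      using deriv[OF that] by (rule DERIV_minus)
    show "- \<omega> i t = \<kappa> * (- P i t - w t * coupling N (\<lambda>k. - \<theta> k t) i)" if "i \<in> {1..N}" "T \<le> t" for i t
      unfolding c velocity[OF that] by (simp add: algebra_simps)
    show "\<bar>- P i t - - P j t\<bar> \<le> 2 * (g * w t)" if "i \<in> {1..N}" "j \<in> {1..N}" "T \<le> t" for i j t
      using forcing[OF that] by simp
  qed (fact N \<kappa> g w0 w)+
qed

lemma V_nonneg: "0 \<le> V t"
  unfolding mean_def by (intro mult_nonneg_nonneg sum_nonneg) auto

lemma order_parameter_sq_growth:
  assumes "t \<ge> T"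
  shows "\<exists>D. ((\<lambda>t. (R t)\<^sup>2) has_real_derivative D) (at t) \<and>
    D \<ge> 2 * \<kappa> * w t * (sqrt (V t) * (sqrt (V t) - g))"
proof (intro exI conjI)
  show "((\<lambda>t. (R t)\<^sup>2) has_real_derivative - 2 * mean N (\<lambda>i. \<omega> i t * F i t)) (at t)"
    by (rule DERIV_order_parameter_sq) (rule deriv[OF _ assms])
  have "mean N (\<lambda>i. \<omega> i t * F i t) = mean N (\<lambda>i. \<kappa> * (P i t * F i t) - \<kappa> * w t * (F i t)\<^sup>2)"
    by (rule mean_cong) (simp add: velocity[OF _ assms] algebra_simps power2_eq_square)
  also have "\<dots> = \<kappa> * mean N (\<lambda>i. P i t * F i t) - \<kappa> * w t * V t"
    by (simp only: mean_diff mean_cmult)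
  also have "\<bar>mean N (\<lambda>i. P i t * F i t)\<bar> \<le> (g * w t) * mean N (\<lambda>i. \<bar>F i t\<bar>)"
    by (rule abs_mean_mult_le_of_spread[OF N mean_coupling]) (rule forcing[OF _ _ assms])
  then have "\<kappa> * mean N (\<lambda>i. P i t * F i t) \<le> \<kappa> * ((g * w t) * sqrt (V t))"
    using mean_abs_le_sqrt_mean_square[OF N, of "\<lambda>i. F i t"] \<kappa> g w[OF assms] w0
    by (intro mult_left_mono) (auto intro: order_trans[OF abs_ge_self] order_trans[OF _ mult_left_mono])
  finally have "mean N (\<lambda>i. \<omega> i t * F i t) \<le> \<kappa> * ((g * w t) * sqrt (V t)) - \<kappa> * w t * V t" by simp
  moreover have "V t = sqrt (V t) * sqrt (V t)" using V_nonneg[of t] by simp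
  ultimately show "2 * \<kappa> * w t * (sqrt (V t) * (sqrt (V t) - g)) \<le> - 2 * mean N (\<lambda>i. \<omega> i t * F i t)"
    by (simp add: algebra_simps)
qed

lemma growth_lower_bound:
  assumes "t \<ge> T" "V t > q\<^sup>2" "q > g"
  shows "2 * \<kappa> * w t * (sqrt (V t) * (sqrt (V t) - g)) \<ge> 2 * \<kappa> * w0 * (q * (q - g))"
proof -
  have "sqrt (q\<^sup>2) \<le> sqrt (V t)" using assms(2) by (intro real_sqrt_le_mono) simp
  then have "q \<le> sqrt (V t)" using assms(3) g by simp
  then show ?thesis using assms g \<kappa> w0 w[OF assms(1)] V_nonneg[of t] by (intro mult_mono) auto
qed

text \<open>
The square of the order parameter is increasing as long as the couplings are larger than \<open>g\<close> in
quadratic mean. If they stayed larger than \<open>R\<^sup>2 / 3.068 > g\<close> forever, it would grow at a fixed rate, but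
it is at most \<open>1\<close>.
\<close>
lemma bipolar_time:
  assumes init: "(R T)\<^sup>2 / 3.068 > g"
  shows "\<exists>t1\<ge>T. (R t1)\<^sup>2 \<ge> (R T)\<^sup>2 \<and> V t1 \<le> ((R t1)\<^sup>2 / 3.068)\<^sup>2"
proof (rule ccontr)
  assume "\<not> ?thesis"
  then have no: "V t > ((R t)\<^sup>2 / 3.068)\<^sup>2" if "t \<ge> T" "(R t)\<^sup>2 \<ge> (R T)\<^sup>2" for t
    using that by (meson not_le)
  let ?q = "(R T)\<^sup>2 / 3.068"
  define d where "d = 2 * \<kappa> * w0 * (?q * (?q - g))"
  have d: "d > 0" unfolding d_def using \<kappa> w0 init g by (intro mult_pos_pos) auto
  have big: "V t > ?q\<^sup>2" if "t \<ge> T" "(R t)\<^sup>2 \<ge> (R T)\<^sup>2" for t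
  proof -
    have "?q\<^sup>2 \<le> ((R t)\<^sup>2 / 3.068)\<^sup>2" using that by (intro power_mono[of "_ / 3.068" "_ / 3.068"] divide_right_mono) auto
    then show ?thesis using no[OF that] by linarith
  qed
  from order_parameter_sq_growth obtain D where D:
    "\<And>t. t \<ge> T \<Longrightarrow> ((\<lambda>t. (R t)\<^sup>2) has_real_derivative D t) (at t)"
    "\<And>t. t \<ge> T \<Longrightarrow> D t \<ge> 2 * \<kappa> * w t * (sqrt (V t) * (sqrt (V t) - g))" by metis
  have Dd: "D t \<ge> d" if "t \<ge> T" "(R t)\<^sup>2 \<ge> (R T)\<^sup>2" for t
    using D(2)[OF that(1)] growth_lower_bound[OF that(1) big[OF that] init] unfolding d_def by linarith
  \<comment> \<open>The growth estimate applies only while \<open>R\<close> is at least \<open>R T\<close>; the barrier at that level closes the circle.\<close>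
  have mono: "(R t)\<^sup>2 \<ge> (R T)\<^sup>2" if "t \<ge> T" for t
  proof -
    have "- (R t)\<^sup>2 \<le> - (R T)\<^sup>2"
    proof (rule barrier_invariance[where I = "{()}" and f = "\<lambda>_ t. - (R t)\<^sup>2" and f' = "\<lambda>_ t. - D t" and ?t0.0 = T])
      show "((\<lambda>t. - (R t)\<^sup>2) has_real_derivative - D s) (at s)" if "s \<ge> T" for s
        using D(1)[OF that] by (rule DERIV_minus)
      show "- D s < 0" if "s \<ge> T" "- (R s)\<^sup>2 = - (R T)\<^sup>2" for s
        using Dd[of s] d that by simp
    qed (use that in auto)
    then show ?thesis by simp
  qed
  have grow: "d * (t - T) \<le> (R t)\<^sup>2 - (R T)\<^sup>2" if "t \<ge> T" for t
  proof -
    have "d * t - d * T \<le> (R t)\<^sup>2 - (R T)\<^sup>2"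
    proof (rule increment_le_of_deriv_le[OF that])
      show "continuous_on {T..t} (\<lambda>t. (R t)\<^sup>2)"
        by (rule DERIV_atLeastAtMost_imp_continuous_on) (use D(1) in blast)
      show "((\<lambda>t. d * t) has_real_derivative d) (at s)" for s by (auto intro!: derivative_eq_intros)
      show "((\<lambda>t. (R t)\<^sup>2) has_real_derivative D s) (at s)" if "T < s" for s using D(1) that by simp
      show "d \<le> D s" if "T < s" for s using Dd mono that by simp
    qed (auto intro: continuous_intros)
    then show ?thesis by (simp add: algebra_simps)
  qed
  have "2 \<le> (R (T + 2 / d))\<^sup>2 - (R T)\<^sup>2" using grow[of "T + 2 / d"] d by simp
  moreover have "(R (T + 2 / d))\<^sup>2 \<le> 1"
    using order_parameter_le_1[OF N] order_parameter_nonneg by (simp add: power_le_one)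
  ultimately show False using zero_le_power2[of "R T"] by linarith
qed

lemma inward_velocity:
  assumes "t \<ge> T" "i \<in> {1..N}" "j \<in> {1..N}"
    and "F i t - F j t \<ge> 2 * h" "h > g"
  shows "\<omega> i t - \<omega> j t < 0"
proof -
  have wt: "w t > 0" using w[OF assms(1)] w0 by simp
  have "P i t - P j t \<le> 2 * (g * w t)" using forcing[OF assms(2,3,1)] by simp
  moreover have "w t * (2 * h) \<le> w t * (F i t - F j t)" using assms wt by (intro mult_left_mono) auto
  moreover have "w t * g < w t * h" using wt assms by simp
  ultimately have "P i t - P j t - w t * (F i t - F j t) < 0" by (simp add: algebra_simps)
  then have "\<kappa> * (P i t - P j t - w t * (F i t - F j t)) < 0" using \<kappa> by (simp add: mult_pos_neg)
  then show ?thesis using assms by (simp add: velocity algebra_simps)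
qed

text \<open>
When the two extreme members of the cluster are at the maximal distance \<open>2 * b\<close>, their midpoint is the
centre of an arc of half-width \<open>b\<close> containing the cluster, and the gain, being larger than \<open>g\<close>, makes
them approach each other in spite of the forcing.
\<close>
lemma cluster_trapped:
  assumes "t1 \<ge> T" "A \<subseteq> {1..N}" "0 < b" "b \<le> pi"
    and init: "\<And>k. k \<in> A \<Longrightarrow> \<bar>\<theta> k t1 - c\<bar> \<le> b"
    and gain: "cluster_gain (real (card A) / real N) b > g"
    and "t \<ge> t1" "i \<in> A" "j \<in> A"
  shows "\<theta> i t - \<theta> j t \<le> 2 * b"
proof -
  have fin: "finite A" using assms(2) finite_subset by blast
  define f where "f p t = \<theta> (fst p) t - \<theta> (snd p) t" for p t
  have "f (i, j) t \<le> 2 * b"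
  proof (rule barrier_invariance[where I = "A \<times> A" and ?t0.0 = t1 and f = f
        and f' = "\<lambda>p t. \<omega> (fst p) t - \<omega> (snd p) t"])
    fix p s assume p: "p \<in> A \<times> A" and s: "s \<ge> t1"
    show "(f p has_real_derivative \<omega> (fst p) s - \<omega> (snd p) s) (at s)"
      unfolding f_def using p s assms by (intro DERIV_diff deriv) auto
    assume all: "\<And>q. q \<in> A \<times> A \<Longrightarrow> f q s \<le> 2 * b" and eq: "f p s = 2 * b"
    have le: "\<theta> k s - \<theta> l s \<le> 2 * b" if "k \<in> A" "l \<in> A" for k l
      using all[of "(k, l)"] that by (simp add: f_def)
    have "2 * cluster_gain (real (card A) / real N) b \<le> F (fst p) s - F (snd p) s"
    proof (rule coupling_diff_ge_of_cluster[where n = "\<lambda>_. 0" and v = "\<lambda>k. \<theta> k s", OF N assms(2)])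
      show "\<theta> k s \<le> \<theta> (snd p) s + 2 * b \<and> \<theta> (fst p) s - 2 * b \<le> \<theta> k s" if "k \<in> A" for k
        using le[OF that, of "snd p"] le[OF _ that, of "fst p"] p by auto
    qed (use assms eq in \<open>auto simp: f_def\<close>)
    moreover have "fst p \<in> {1..N}" "snd p \<in> {1..N}" using p assms(2) by auto
    ultimately show "\<omega> (fst p) s - \<omega> (snd p) s < 0"
      using inward_velocity gain s assms(1) order_trans by blast
  next
    fix p assume "p \<in> A \<times> A"
    then show "f p t1 \<le> 2 * b"
      using init[of "fst p"] init[of "snd p"] unfolding abs_le_iff f_def by auto
  qed (use assms fin in auto)
  then show ?thesis by (simp add: f_def)
qed

text \<open>
An oscillator outside the cluster cannot overtake it: if it is ahead of the last member of
the cluster by exactly \<open>2 * b\<close>, up to full turns, then it is an end of an arc of half-width \<open>b\<close>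
containing the cluster, so the argument for the members of the cluster applies to it too.
\<close>
lemma outsider_bounded_above:
  assumes "t1 \<ge> T" "A \<subseteq> {1..N}" "0 < b" "b \<le> pi"
    and init: "\<And>k. k \<in> A \<Longrightarrow> \<bar>\<theta> k t1 - c\<bar> \<le> b"
    and gain: "cluster_gain (real (card A) / real N) b > g"
    and i: "i \<in> {1..N}" "i \<notin> A"
  shows "\<exists>K. \<forall>t\<ge>t1. \<forall>j\<in>A. \<theta> i t - \<theta> j t \<le> K"
proof -
  have fin: "finite A" using assms(2) finite_subset by blast
  have trap: "\<theta> k s - \<theta> j s \<le> 2 * b" if "s \<ge> t1" "k \<in> A" "j \<in> A" for s k j
    by (rule cluster_trapped[of t1 A b c]) (use assms that in auto)
  \<comment> \<open>So many full turns back, the oscillator is initially not ahead of the centre of the cluster.\<close>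
  define M :: int where "M = \<lceil>(\<theta> i t1 - c) / (2 * pi)\<rceil>"
  have "(\<theta> i t1 - c) / (2 * pi) \<le> of_int M" unfolding M_def by linarith
  then have M: "\<theta> i t1 - c \<le> 2 * of_int M * pi" using pi_gt_zero by (simp add: field_simps)
  have "\<theta> i t - 2 * of_int M * pi - \<theta> j t \<le> 2 * b" if "t \<ge> t1" "j \<in> A" for t j
  proof (rule barrier_invariance[where I = A and ?t0.0 = t1 and f = "\<lambda>j t. \<theta> i t - 2 * of_int M * pi - \<theta> j t"
        and f' = "\<lambda>j t. \<omega> i t - \<omega> j t"])
    fix j s assume j: "j \<in> A" and s: "s \<ge> t1"
    show "((\<lambda>t. \<theta> i t - 2 * of_int M * pi - \<theta> j t) has_real_derivative \<omega> i s - \<omega> j s) (at s)"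
    proof -
      have "j \<in> {1..N}" "s \<ge> T" using j s assms by auto
      then show ?thesis
        using DERIV_diff[OF DERIV_diff[OF deriv[of i s] DERIV_const] deriv[of j s]] i by simp
    qed
    assume all: "\<And>k. k \<in> A \<Longrightarrow> \<theta> i s - 2 * of_int M * pi - \<theta> k s \<le> 2 * b"
      and eq: "\<theta> i s - 2 * of_int M * pi - \<theta> j s = 2 * b"
    have "2 * cluster_gain (real (card A) / real N) b \<le> F i s - F j s"
    proof (rule coupling_diff_ge_of_cluster[where n = "\<lambda>k. if k = i then M else 0"
           and v = "\<lambda>k. if k = i then \<theta> i s - 2 * of_int M * pi else \<theta> k s", OF N assms(2)])
      fix k assume k: "k \<in> A"
      then show "(if k = i then \<theta> i s - 2 * of_int M * pi else \<theta> k s)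
          \<le> (if j = i then \<theta> i s - 2 * of_int M * pi else \<theta> j s) + 2 * b \<and>
        (if i = i then \<theta> i s - 2 * of_int M * pi else \<theta> i s) - 2 * b
          \<le> (if k = i then \<theta> i s - 2 * of_int M * pi else \<theta> k s)"
        using trap[OF s k j] all[OF k] i j by auto
    qed (use assms eq j in auto)
    moreover have "j \<in> {1..N}" using j assms(2) by auto
    ultimately show "\<omega> i s - \<omega> j s < 0"
      using inward_velocity gain s assms(1) i(1) order_trans by blast
  next
    fix k assume "k \<in> A"
    then show "\<theta> i t1 - 2 * of_int M * pi - \<theta> k t1 \<le> 2 * b"
      using init[of k] M \<open>0 < b\<close> unfolding abs_le_iff by auto
  qed (use that fin in auto)
  then show ?thesis
    by (intro exI[of _ "2 * b + 2 * of_int M * pi"]) (auto simp: algebra_simps)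
qed

lemma outsider_bounded:
  assumes "t1 \<ge> T" "A \<subseteq> {1..N}" "0 < b" "b \<le> pi"
    and init: "\<And>k. k \<in> A \<Longrightarrow> \<bar>\<theta> k t1 - c\<bar> \<le> b"
    and gain: "cluster_gain (real (card A) / real N) b > g"
    and i: "i \<in> {1..N}"
  shows "\<exists>K. \<forall>t\<ge>t1. \<forall>j\<in>A. \<bar>\<theta> i t - \<theta> j t\<bar> \<le> K"
proof (cases "i \<in> A")
  case True
  have trap: "\<theta> k s - \<theta> j s \<le> 2 * b" if "s \<ge> t1" "k \<in> A" "j \<in> A" for s k j
    by (rule cluster_trapped[of t1 A b c]) (use assms that in auto)
  have "\<bar>\<theta> i t - \<theta> j t\<bar> \<le> 2 * b" if "t \<ge> t1" "j \<in> A" for t j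
    using trap[OF that(1) True that(2)] trap[OF that True] by linarith
  then show ?thesis by blast
next
  case False
  interpret r: perturbed_kuramoto N \<kappa> "\<lambda>i t. - \<theta> i t" "\<lambda>i t. - \<omega> i t" "\<lambda>i t. - P i t" w T g w0
    by (rule reflected)
  obtain K1 where K1: "\<forall>t\<ge>t1. \<forall>j\<in>A. \<theta> i t - \<theta> j t \<le> K1"
    using outsider_bounded_above[OF assms False] by blast
  have init': "\<bar>- \<theta> k t1 - - c\<bar> \<le> b" if "k \<in> A" for k using init[OF that] by simp
  obtain K2 where K2: "\<forall>t\<ge>t1. \<forall>j\<in>A. - \<theta> i t - - \<theta> j t \<le> K2"
    using r.outsider_bounded_above[OF assms(1-4) init' gain i False] by blast
  have "\<bar>\<theta> i t - \<theta> j t\<bar> \<le> max K1 K2" if "t \<ge> t1" "j \<in> A" for t j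
    using K1[rule_format, OF that] K2[rule_format, OF that] by linarith
  then show ?thesis by blast
qed

lemma shifted: "perturbed_kuramoto N \<kappa> (\<lambda>i t. \<theta> i t - 2 * of_int (n i) * pi) \<omega> P w T g w0"
proof
  show "((\<lambda>t. \<theta> i t - 2 * of_int (n i) * pi) has_real_derivative \<omega> i t) (at t)"
    if "i \<in> {1..N}" "T \<le> t" for i t
    using DERIV_diff[OF deriv[OF that] DERIV_const] by simp
  show "\<omega> i t = \<kappa> * (P i t - w t * coupling N (\<lambda>k. \<theta> k t - 2 * of_int (n k) * pi) i)"
    if "i \<in> {1..N}" "T \<le> t" for i t
    unfolding coupling_shift by (rule velocity[OF that])
qed (fact N \<kappa> g w0 w forcing)+

lemma cluster_formation:
  assumes init: "(R T)\<^sup>2 / 3.068 > g"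
  obtains t1 A b n where "t1 \<ge> T" "A \<subseteq> {1..N}" "0 < b" "b \<le> pi / 3"
    "real (card A) / real N > 1 / 2"
    "cluster_gain (real (card A) / real N) b > g"
    "b \<le> pi / 6 \<or> cluster_gain (real (card A) / real N) (pi / 6) > g"
    "\<And>i j t. i \<in> A \<Longrightarrow> j \<in> A \<Longrightarrow> t \<ge> t1 \<Longrightarrow>
      (\<theta> i t - 2 * of_int (n i) * pi) - (\<theta> j t - 2 * of_int (n j) * pi) \<le> 2 * b"
    "\<And>i j. i \<in> {1..N} \<Longrightarrow> j \<in> {1..N} \<Longrightarrow> \<exists>K. \<forall>t\<ge>t1. \<bar>\<theta> i t - \<theta> j t\<bar> \<le> K"
proof -
  obtain t1 where t1: "t1 \<ge> T" "(R t1)\<^sup>2 \<ge> (R T)\<^sup>2" "V t1 \<le> ((R t1)\<^sup>2 / 3.068)\<^sup>2"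
    using bipolar_time[OF init] by blast
  have "(R T)\<^sup>2 / 3.068 \<le> (R t1)\<^sup>2 / 3.068" using t1(2) by (rule divide_right_mono) simp
  with init have Rg: "(R t1)\<^sup>2 / 3.068 > g" by linarith
  then have "R t1 \<noteq> 0" using g by auto
  then have "R t1 > 0" using order_parameter_nonneg[of N "\<lambda>k. \<theta> k t1"] by linarith
  from this t1(3) obtain A b n c where
    A: "A \<subseteq> {1..N}" "0 < b" "b \<le> pi / 3" "real (card A) / real N > 1 / 2" and
    near: "\<And>k. k \<in> A \<Longrightarrow> \<bar>\<theta> k t1 - 2 * of_int (n k) * pi - c\<bar> \<le> b" and
    gain: "cluster_gain (real (card A) / real N) b \<ge> (R t1)\<^sup>2 / 3.068"
      "b \<le> pi / 6 \<or> cluster_gain (real (card A) / real N) (pi / 6) \<ge> (R t1)\<^sup>2 / 3.068"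
    by (rule majority_cluster[OF N refl]) (rule that)
  interpret s: perturbed_kuramoto N \<kappa> "\<lambda>i t. \<theta> i t - 2 * of_int (n i) * pi" \<omega> P w T g w0 by (rule shifted)
  have gain': "cluster_gain (real (card A) / real N) b > g" using gain Rg by linarith
  have bpi: "b \<le> pi" using A(3) pi_gt_zero by linarith
  obtain a where a: "a \<in> A" using A(4) by (cases "A = {}") auto
  show ?thesis
  proof (rule that[of t1 A b n])
    show "(\<theta> i t - 2 * of_int (n i) * pi) - (\<theta> j t - 2 * of_int (n j) * pi) \<le> 2 * b"
      if "i \<in> A" "j \<in> A" "t \<ge> t1" for i j t
      by (rule s.cluster_trapped[of t1 A b c]) (use t1(1) A(1,2) bpi near gain' that in auto)
    fix i j assume ij: "i \<in> {1..N}" "j \<in> {1..N}"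
    from s.outsider_bounded[OF t1(1) A(1,2) bpi near gain' ij(1)] a obtain K1 where
      K1: "\<forall>t\<ge>t1. \<bar>(\<theta> i t - 2 * of_int (n i) * pi) - (\<theta> a t - 2 * of_int (n a) * pi)\<bar> \<le> K1" by blast
    from s.outsider_bounded[OF t1(1) A(1,2) bpi near gain' ij(2)] a obtain K2 where
      K2: "\<forall>t\<ge>t1. \<bar>(\<theta> j t - 2 * of_int (n j) * pi) - (\<theta> a t - 2 * of_int (n a) * pi)\<bar> \<le> K2" by blast
    have "\<bar>\<theta> i t - \<theta> j t\<bar> \<le> K1 + K2 + \<bar>2 * of_int (n i) * pi - 2 * of_int (n j) * pi\<bar>" if "t \<ge> t1" for t
      using K1[rule_format, OF that] K2[rule_format, OF that] by linarith
    then show "\<exists>K. \<forall>t\<ge>t1. \<bar>\<theta> i t - \<theta> j t\<bar> \<le> K" by blast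
  next
    show "b \<le> pi / 6 \<or> cluster_gain (real (card A) / real N) (pi / 6) > g"
      using gain(2) Rg by linarith
  qed (fact t1(1) A gain')+
qed

end

section \<open>Reduction of the inertial model to first order\<close>

lemma one_minus_exp_neg_le: "1 - exp (- s) \<le> (s::real)"
  using exp_ge_add_one_self[of "- s"] by simp

lemma mult_exp_neg_le: "(s::real) * exp (- s) \<le> 1 - exp (- s)"
proof -
  have "(1 + s) * exp (- s) \<le> exp s * exp (- s)"
    by (intro mult_right_mono) (auto simp: exp_ge_add_one_self)
  also have "exp s * exp (- s) = 1" by (simp add: exp_minus)
  finally show ?thesis by (simp add: algebra_simps)
qed

text \<open>
With \<open>w = 1 - exp (- s)\<close> this is \<open>w + w\<^sup>2 / 2 \<le> - ln (1 - w)\<close>, the start of the logarithmic series.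
\<close>
lemma quadratic_lower_bound_of_neg_ln:
  assumes "(s::real) \<ge> 0" shows "(1 - exp (- s)) + (1 - exp (- s))\<^sup>2 / 2 \<le> s"
proof -
  let ?f = "\<lambda>s::real. (1 - exp (- s)) + (1 - exp (- s))\<^sup>2 / 2"
  have "?f s - ?f 0 \<le> s - 0"
  proof (rule increment_le_of_deriv_le[OF assms])
    show "(?f has_real_derivative exp (- t) + (1 - exp (- t)) * exp (- t)) (at t)" for t
      by (auto intro!: derivative_eq_intros)
    show "((\<lambda>s. s) has_real_derivative 1) (at t)" for t :: real by (rule DERIV_ident)
    show "exp (- t) + (1 - exp (- t)) * exp (- t) \<le> 1" for t :: real
      using zero_le_power2[of "1 - exp (- t)"] by (simp add: power2_eq_square algebra_simps)
  qed (auto intro!: continuous_intros)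
  then show ?thesis by simp
qed

text \<open>
The left-hand side is the weight of the initial velocities in the part of \<open>loss\<close> with factor \<open>m * \<kappa>\<close>.
\<close>
lemma velocity_loss_bound:
  assumes "(s::real) \<ge> 0"
  shows "1/2 - s * exp (- s) - (exp (- s))\<^sup>2 / 2 \<le> 3/4 * (1 - exp (- s)) ^ 3"
proof -
  define u where "u = 1 - exp (- s)"
  have u: "0 \<le> u" "u \<le> 1" using assms by (auto simp: u_def)
  have e: "exp (- s) = 1 - u" by (simp add: u_def)
  have "(u + u\<^sup>2 / 2) * (1 - u) \<le> s * (1 - u)"
    using quadratic_lower_bound_of_neg_ln[OF assms] u by (intro mult_right_mono) (auto simp: u_def)
  then have "1/2 - s * (1 - u) - (1 - u)\<^sup>2 / 2 \<le> 1/2 - (u + u\<^sup>2 / 2) * (1 - u) - (1 - u)\<^sup>2 / 2" by simp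
  also have "\<dots> = 1/2 * u ^ 3" by (simp add: field_simps power2_eq_square power3_eq_cube)
  also have "\<dots> \<le> 3/4 * u ^ 3" using u by (intro mult_right_mono) auto
  finally show ?thesis by (simp add: e)
qed

text \<open>
The left-hand side is the weight of the frequencies and of the coupling in the part of
\<open>loss\<close> with factor \<open>m * \<kappa>\<close>.
\<close>
lemma coupling_loss_bound:
  assumes "(s::real) \<ge> 0"
  shows "s - 1/2 + (exp (- s))\<^sup>2 / 2 - 2 * (1 - exp (- s) - s * exp (- s)) \<le> s * (1 - exp (- s)) ^ 3"
proof -
  let ?f = "\<lambda>s::real. s - 1/2 + (exp (- s))\<^sup>2 / 2 - 2 * (1 - exp (- s) - s * exp (- s))"
  let ?g = "\<lambda>s::real. s * (1 - exp (- s)) ^ 3"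
  let ?f' = "\<lambda>s::real. 1 - (exp (- s))\<^sup>2 - 2 * (s * exp (- s))"
  let ?g' = "\<lambda>s::real. (1 - exp (- s)) ^ 3 + 3 * s * (1 - exp (- s))\<^sup>2 * exp (- s)"
  have "?f s - ?f 0 \<le> ?g s - ?g 0"
  proof (rule increment_le_of_deriv_le[OF assms])
    show "(?f has_real_derivative ?f' t) (at t)" for t
      by (auto intro!: derivative_eq_intros simp: power2_eq_square algebra_simps)
    show "(?g has_real_derivative ?g' t) (at t)" for t
      by (auto intro!: derivative_eq_intros simp: power2_eq_square power3_eq_cube algebra_simps)
    show "?f' t \<le> ?g' t" if "0 < t" for t
    proof -
      define u where "u = 1 - exp (- t)"
      have u: "0 \<le> u" "u \<le> 1" using that by (auto simp: u_def)
      have e: "exp (- t) = 1 - u" by (simp add: u_def)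
      have q: "u + u\<^sup>2 / 2 \<le> t" using quadratic_lower_bound_of_neg_ln[of t] that by (simp add: u_def)
      moreover have "0 \<le> t * u\<^sup>2" using that by simp
      ultimately have "0 \<le> 2 * t - 2 * u - u\<^sup>2 + 3 * (t * u\<^sup>2)" by linarith
      then have "0 \<le> (1 - u) * (2 * t - 2 * u - u\<^sup>2 + 3 * (t * u\<^sup>2))"
        using u by (intro mult_nonneg_nonneg) auto
      then show ?thesis unfolding e by (simp add: power2_eq_square power3_eq_cube algebra_simps)
    qed
  qed (auto intro!: continuous_intros)
  then show ?thesis by simp
qed

lemma mult_exp_neg_le_max:
  assumes "(\<eta>::real) \<le> s" "s \<ge> 0"
  shows "s * exp (- s) \<le> max 1 \<eta> * exp (- max 1 \<eta>)"
proof -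
  define M where "M = max 1 \<eta>"
  have M: "M \<ge> 1" by (simp add: M_def)
  have "s \<le> M * (1 + (s - M))"
  proof (cases "s \<ge> M")
    case True
    then have "(M - 1) * (s - M) \<ge> 0" using M by simp
    then show ?thesis by (simp add: algebra_simps)
  next
    case False
    then have "M = 1" using assms by (auto simp: M_def max_def split: if_splits)
    then show ?thesis by simp
  qed
  also have "\<dots> \<le> M * exp (s - M)" using M exp_ge_add_one_self[of "s - M"] by (intro mult_left_mono) auto
  finally have "s * exp (- s) \<le> M * exp (s - M) * exp (- s)" by (intro mult_right_mono) auto
  also have "\<dots> = M * exp (- M)" by (simp add: mult_exp_exp)
  finally show ?thesis by (simp add: M_def)
qed

text \<open>
The velocities are a separate function \<open>\<omega>\<close>, so that continuity at the initial time can be stated for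
them although the equations hold for positive times only.
\<close>
locale inertial_kuramoto =
  fixes N :: nat and m \<kappa> :: real and \<nu> :: "nat \<Rightarrow> real" and \<theta> \<omega> :: "nat \<Rightarrow> real \<Rightarrow> real"
  assumes N: "N \<ge> 1" and m: "m > 0" and \<kappa>: "\<kappa> > 0"
    and cont_\<theta>: "\<And>i. i \<in> {1..N} \<Longrightarrow> continuous_on {0..} (\<theta> i)"
    and cont_\<omega>: "\<And>i. i \<in> {1..N} \<Longrightarrow> continuous_on {0..} (\<omega> i)"
    and deriv_\<theta>: "\<And>i t. i \<in> {1..N} \<Longrightarrow> t > 0 \<Longrightarrow> (\<theta> i has_real_derivative \<omega> i t) (at t)"
    and deriv_\<omega>: "\<And>i t. i \<in> {1..N} \<Longrightarrow> t > 0 \<Longrightarrow>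
      (\<omega> i has_real_derivative (\<nu> i - \<omega> i t - \<kappa> * coupling N (\<lambda>k. \<theta> k t) i) / m) (at t)"
begin

abbreviation "F i t \<equiv> coupling N (\<lambda>k. \<theta> k t) i"
abbreviation "R t \<equiv> order_parameter N (\<lambda>k. \<theta> k t)"

lemma cont_F: "i \<in> {1..N} \<Longrightarrow> continuous_on {0..} (F i)"
  unfolding coupling_def by (intro continuous_on_mean continuous_intros cont_\<theta>)

lemma DERIV_exp_scaled: "((\<lambda>t. exp (t / m)) has_real_derivative exp (t / m) / m) (at t)"
  using m by (auto intro!: derivative_eq_intros)

text \<open>
Variation of constants: \<open>exp (t / m) * v t\<close> has derivative \<open>exp (t / m) * f t / m\<close>. Comparing derivatives takes
the place of integrating.
\<close>
lemma relaxation_bound: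
  fixes v f :: "real \<Rightarrow> real"
  assumes t: "t \<ge> 0" and cont: "continuous_on {0..} v"
    and v: "\<And>s. s > 0 \<Longrightarrow> (v has_real_derivative (f s - v s) / m) (at s)"
    and f: "\<And>s. s > 0 \<Longrightarrow> \<bar>f s\<bar> \<le> B"
  shows "\<bar>v t\<bar> \<le> exp (- (t / m)) * \<bar>v 0\<bar> + (1 - exp (- (t / m))) * B"
proof -
  let ?f = "\<lambda>t. exp (t / m) * v t" and ?g = "\<lambda>t. B * exp (t / m)"
  have "\<bar>?f t - ?f 0\<bar> \<le> ?g t - ?g 0"
  proof (rule abs_increment_le_of_abs_deriv_le[OF t])
    have "continuous_on {0..t} v" by (rule continuous_on_subset[OF cont]) auto
    then show "continuous_on {0..t} ?f" by (intro continuous_intros) (use m in auto)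
    show "continuous_on {0..t} ?g" by (intro continuous_intros) (use m in auto)
    show "(?f has_real_derivative exp (s / m) / m * f s) (at s)" if "0 < s" for s
      by (rule DERIV_cong[OF DERIV_mult[OF DERIV_exp_scaled v[OF that]]]) (use m in \<open>simp add: field_simps\<close>)
    show "(?g has_real_derivative exp (s / m) / m * B) (at s)" for s
      by (rule DERIV_cong[OF DERIV_cmult[OF DERIV_exp_scaled]]) simp
    show "\<bar>exp (s / m) / m * f s\<bar> \<le> exp (s / m) / m * B" if "0 < s" for s
      unfolding abs_mult using m f[OF that] by (intro mult_mono) auto
  qed
  then have "\<bar>?f t\<bar> \<le> \<bar>v 0\<bar> + B * (exp (t / m) - 1)" by (simp add: algebra_simps)
  then have "exp (- (t / m)) * \<bar>?f t\<bar> \<le> exp (- (t / m)) * (\<bar>v 0\<bar> + B * (exp (t / m) - 1))"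
    by (intro mult_left_mono) auto
  moreover have "exp (- (t / m)) * \<bar>?f t\<bar> = \<bar>v t\<bar>"
    by (simp add: abs_mult mult.assoc[symmetric] mult_exp_exp)
  moreover have "exp (- (t / m)) * (\<bar>v 0\<bar> + B * (exp (t / m) - 1))
     = exp (- (t / m)) * \<bar>v 0\<bar> + (exp (- (t / m)) * exp (t / m) - exp (- (t / m))) * B"
    by (simp add: algebra_simps)
  moreover have "exp (- (t / m)) * exp (t / m) = 1" by (simp add: mult_exp_exp)
  ultimately show ?thesis by simp
qed

lemma abs_F_le: "\<bar>F i t\<bar> \<le> 1"
  using abs_coupling_le[of N "\<lambda>k. \<theta> k t" i] order_parameter_le_1[OF N, of "\<lambda>k. \<theta> k t"] by linarith

end

locale inertial_kuramoto_spread = inertial_kuramoto +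
  fixes X Z :: real
  assumes X: "X \<ge> 0" and Z: "Z \<ge> 0"
    and \<nu>_spread: "\<And>i j. i \<in> {1..N} \<Longrightarrow> j \<in> {1..N} \<Longrightarrow> \<bar>\<nu> i - \<nu> j\<bar> \<le> \<kappa> * X"
    and \<omega>_spread: "\<And>i j. i \<in> {1..N} \<Longrightarrow> j \<in> {1..N} \<Longrightarrow> \<bar>\<omega> i 0 - \<omega> j 0\<bar> \<le> \<kappa> * Z"
begin

lemma velocity_spread:
  assumes i: "i \<in> {1..N}" and j: "j \<in> {1..N}" and t: "t \<ge> 0"
  shows "\<bar>\<omega> i t - \<omega> j t\<bar> \<le> \<kappa> * (exp (- (t / m)) * Z + (1 - exp (- (t / m))) * (X + 2))"
proof -
  have "\<bar>\<omega> i t - \<omega> j t\<bar> \<le> exp (- (t / m)) * \<bar>\<omega> i 0 - \<omega> j 0\<bar> + (1 - exp (- (t / m))) * (\<kappa> * (X + 2))"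
  proof (rule relaxation_bound[OF t, where f = "\<lambda>s. \<nu> i - \<nu> j - \<kappa> * (F i s - F j s)"])
    show "continuous_on {0..} (\<lambda>s. \<omega> i s - \<omega> j s)" by (intro continuous_intros cont_\<omega> i j)
    show "((\<lambda>s. \<omega> i s - \<omega> j s) has_real_derivative (\<nu> i - \<nu> j - \<kappa> * (F i s - F j s) - (\<omega> i s - \<omega> j s)) / m) (at s)"
      if "0 < s" for s
      by (rule DERIV_cong[OF DERIV_diff[OF deriv_\<omega>[OF i that] deriv_\<omega>[OF j that]]])
         (use m in \<open>simp add: field_simps\<close>)
    show "\<bar>\<nu> i - \<nu> j - \<kappa> * (F i s - F j s)\<bar> \<le> \<kappa> * (X + 2)" for s
    proof -
      have "\<bar>F i s - F j s\<bar> \<le> 2" using abs_F_le[of s i] abs_F_le[of s j] by linarith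
      then have "\<bar>\<kappa> * (F i s - F j s)\<bar> \<le> \<kappa> * 2" using \<kappa> by (simp add: abs_mult)
      then show ?thesis using \<nu>_spread[OF i j] by (simp add: algebra_simps)
    qed
  qed
  also have "\<dots> \<le> exp (- (t / m)) * (\<kappa> * Z) + (1 - exp (- (t / m))) * (\<kappa> * (X + 2))"
    by (intro add_right_mono mult_left_mono \<omega>_spread[OF i j]) simp
  finally show ?thesis by (simp add: algebra_simps)
qed

text \<open>
Variation of constants followed by an integration by parts: this is the error committed when the
coupling is frozen at its value at time \<open>t\<close>. Its derivative is \<open>(exp (t / m) - 1) * \<kappa>\<close> times the derivative
of the coupling, and the latter is controlled by \<open>velocity_spread\<close>.
\<close>
definition "defect i t = exp (t / m) * \<omega> i t - \<omega> i 0 - (exp (t / m) - 1) * (\<nu> i - \<kappa> * F i t)"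

lemma abs_defect_le:
  assumes i: "i \<in> {1..N}" and t: "t \<ge> 0"
  shows "\<bar>defect i t\<bar> \<le> \<kappa> * (m * \<kappa>) *
    (Z * (t / m - 1 + exp (- (t / m))) + (X + 2) * (exp (t / m) - exp (- (t / m)) - 2 * (t / m)))"
proof -
  let ?g = "\<lambda>t. \<kappa> * (m * \<kappa>) *
    (Z * (t / m - 1 + exp (- (t / m))) + (X + 2) * (exp (t / m) - exp (- (t / m)) - 2 * (t / m)))"
  let ?F' = "\<lambda>s. mean N (\<lambda>k. cos (\<theta> i s - \<theta> k s) * (\<omega> i s - \<omega> k s))"
  have "\<bar>defect i t - defect i 0\<bar> \<le> ?g t - ?g 0"
  proof (rule abs_increment_le_of_abs_deriv_le[OF t])
    have "continuous_on {0..t} (\<omega> i)" "continuous_on {0..t} (F i)"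
      by (rule continuous_on_subset[OF cont_\<omega>] continuous_on_subset[OF cont_F]; use i in auto)+
    then show "continuous_on {0..t} (defect i)"
      unfolding defect_def[abs_def] by (intro continuous_intros) (use m in auto)
    show "continuous_on {0..t} ?g" by (intro continuous_intros) (use m in auto)
    show "(defect i has_real_derivative (exp (s / m) - 1) * \<kappa> * ?F' s) (at s)" if "0 < s" for s
    proof -
      have dF: "(F i has_real_derivative ?F' s) (at s)"
        by (rule DERIV_coupling) (use deriv_\<theta> that i in auto)
      show ?thesis unfolding defect_def[abs_def]
        by (rule DERIV_cong[OF DERIV_diff[OF DERIV_diff[OF
              DERIV_mult[OF DERIV_exp_scaled deriv_\<omega>[OF i that]] DERIV_const]
              DERIV_mult[OF DERIV_diff[OF DERIV_exp_scaled DERIV_const]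
                DERIV_diff[OF DERIV_const DERIV_cmult[OF dF]]]]])
           (use m in \<open>simp add: field_simps\<close>)
    qed
    show "(?g has_real_derivative (exp (s / m) - 1) * \<kappa> * (\<kappa> * (exp (- (s / m)) * Z + (1 - exp (- (s / m))) * (X + 2)))) (at s)" for s
    proof -
      have e: "exp (s / m) * exp (- (s / m)) = 1" by (simp add: mult_exp_exp)
      have "(exp (s / m) - 1) * \<kappa> * (\<kappa> * (exp (- (s / m)) * Z + (1 - exp (- (s / m))) * (X + 2)))
        = \<kappa> * \<kappa> * (Z * (exp (s / m) * exp (- (s / m)) - exp (- (s / m)))
          + (X + 2) * (exp (s / m) - 1 - exp (s / m) * exp (- (s / m)) + exp (- (s / m))))"
        by (simp only: algebra_simps)
      also have "\<dots> = \<kappa> * \<kappa> * (Z * (1 - exp (- (s / m))) + (X + 2) * (exp (s / m) + exp (- (s / m)) - 2))"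
        unfolding e by simp
      finally have eq: "(exp (s / m) - 1) * \<kappa> * (\<kappa> * (exp (- (s / m)) * Z + (1 - exp (- (s / m))) * (X + 2)))
        = \<kappa> * \<kappa> * (Z * (1 - exp (- (s / m))) + (X + 2) * (exp (s / m) + exp (- (s / m)) - 2))" .
      have 1: "((\<lambda>t. t / m) has_real_derivative 1 / m) (at s)" by (rule DERIV_cdivide[OF DERIV_ident])
      have 2: "((\<lambda>t. exp (- (t / m))) has_real_derivative - (exp (- (s / m)) / m)) (at s)"
        using m by (auto intro!: derivative_eq_intros)
      show ?thesis unfolding eq
        by (rule DERIV_cong[OF DERIV_cmult[OF DERIV_add[OF
              DERIV_cmult[OF DERIV_add[OF DERIV_diff[OF 1 DERIV_const] 2]]
              DERIV_cmult[OF DERIV_diff[OF DERIV_diff[OF DERIV_exp_scaled 2] DERIV_cmult[OF 1]]]]]])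
           (use m in \<open>simp add: field_simps\<close>)
    qed
    show "\<bar>(exp (s / m) - 1) * \<kappa> * ?F' s\<bar>
      \<le> (exp (s / m) - 1) * \<kappa> * (\<kappa> * (exp (- (s / m)) * Z + (1 - exp (- (s / m))) * (X + 2)))"
      if "0 < s" for s
    proof -
      have "\<bar>?F' s\<bar> \<le> \<kappa> * (exp (- (s / m)) * Z + (1 - exp (- (s / m))) * (X + 2))"
      proof (rule abs_mean_le_bound[OF N])
        fix k assume k: "k \<in> {1..N}"
        have "\<bar>cos (\<theta> i s - \<theta> k s) * (\<omega> i s - \<omega> k s)\<bar> \<le> 1 * \<bar>\<omega> i s - \<omega> k s\<bar>"
          unfolding abs_mult by (intro mult_right_mono) auto
        then show "\<bar>cos (\<theta> i s - \<theta> k s) * (\<omega> i s - \<omega> k s)\<bar>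
          \<le> \<kappa> * (exp (- (s / m)) * Z + (1 - exp (- (s / m))) * (X + 2))"
          using velocity_spread[OF i k, of s] that by simp
      qed
      then show ?thesis using that m \<kappa> unfolding abs_mult by (intro mult_mono) auto
    qed
  qed
  then show ?thesis by (simp add: defect_def)
qed

definition "forcing i t =
  (exp (- (t / m)) * \<omega> i 0 + (1 - exp (- (t / m))) * \<nu> i + exp (- (t / m)) * defect i t) / \<kappa>"

definition "forcing_bound s = exp (- s) * Z / 2 + (1 - exp (- s)) * X / 2
   + m * \<kappa> * (Z * (s * exp (- s) - exp (- s) + (exp (- s))\<^sup>2)
     + (X + 2) * (1 - (exp (- s))\<^sup>2 - 2 * (s * exp (- s))))"

lemma velocity_eq:
  "\<omega> i t = \<kappa> * (forcing i t - (1 - exp (- (t / m))) * F i t)"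
proof -
  have "exp (- (t / m)) * exp (t / m) = 1" by (simp add: mult_exp_exp)
  then have "exp (- (t / m)) * defect i t
    = \<omega> i t - exp (- (t / m)) * \<omega> i 0 - (1 - exp (- (t / m))) * (\<nu> i - \<kappa> * F i t)"
    unfolding defect_def right_diff_distrib left_diff_distrib mult.assoc[symmetric] by simp
  then show ?thesis unfolding forcing_def using \<kappa> by (simp add: field_simps)
qed

lemma forcing_spread:
  assumes i: "i \<in> {1..N}" and j: "j \<in> {1..N}" and t: "t \<ge> 0"
  shows "\<bar>forcing i t - forcing j t\<bar> \<le> 2 * forcing_bound (t / m)"
proof -
  define \<tau> where "\<tau> = t / m"
  define e where "e = exp (- \<tau>)"
  have e: "0 < e" "e \<le> 1" "e * exp \<tau> = 1" using t m by (auto simp: e_def \<tau>_def mult_exp_exp)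
  define B where "B = \<kappa> * (m * \<kappa>) * (Z * (\<tau> - 1 + e) + (X + 2) * (exp \<tau> - e - 2 * \<tau>))"
  have B: "\<bar>defect i t\<bar> \<le> B" "\<bar>defect j t\<bar> \<le> B"
    using abs_defect_le[OF i t] abs_defect_le[OF j t] by (simp_all add: B_def e_def \<tau>_def)
  have "\<bar>(e * \<omega> i 0 + (1 - e) * \<nu> i + e * defect i t) - (e * \<omega> j 0 + (1 - e) * \<nu> j + e * defect j t)\<bar>
    = \<bar>e * (\<omega> i 0 - \<omega> j 0) + (1 - e) * (\<nu> i - \<nu> j) + e * (defect i t - defect j t)\<bar>"
    by (simp add: algebra_simps)
  also have "\<dots> \<le> \<bar>e * (\<omega> i 0 - \<omega> j 0)\<bar> + \<bar>(1 - e) * (\<nu> i - \<nu> j)\<bar> + \<bar>e * (defect i t - defect j t)\<bar>"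
    by linarith
  also have "\<dots> \<le> e * (\<kappa> * Z) + (1 - e) * (\<kappa> * X) + e * (2 * B)"
    unfolding abs_mult using e \<nu>_spread[OF i j] \<omega>_spread[OF i j] B
    by (intro add_mono mult_mono) auto
  also have "e * (2 * B) = 2 * (\<kappa> * (m * \<kappa>) * (Z * (\<tau> * e - e + e\<^sup>2)
      + (X + 2) * (e * exp \<tau> - e\<^sup>2 - 2 * (\<tau> * e))))"
    unfolding B_def power2_eq_square by (simp only: algebra_simps)
  also have "e * (\<kappa> * Z) + (1 - e) * (\<kappa> * X) + \<dots> = \<kappa> * (2 * forcing_bound \<tau>)"
    unfolding forcing_bound_def e_def[symmetric] e(3) by (simp add: field_simps)
  finally have "\<bar>(e * \<omega> i 0 + (1 - e) * \<nu> i + e * defect i t) - (e * \<omega> j 0 + (1 - e) * \<nu> j + e * defect j t)\<bar>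
    \<le> \<kappa> * (2 * forcing_bound \<tau>)" .
  then show ?thesis
    unfolding forcing_def \<tau>_def[symmetric] e_def[symmetric] diff_divide_distrib[symmetric] using \<kappa>
    by (simp add: pos_divide_le_eq abs_divide mult.commute)
qed

lemma forcing_bound_nonneg: "t \<ge> 0 \<Longrightarrow> forcing_bound (t / m) \<ge> 0"
  using forcing_spread[of 1 1 t] N by simp

text \<open>
The memory of the coupling costs a term of the size of \<open>m * \<kappa>\<close> relative to the weight
\<open>1 - exp (- s)\<close>, uniformly in \<open>s \<ge> \<eta>\<close>; the initial velocity is divided by that weight, which is why a positive
waiting time \<open>\<eta>\<close> is needed.
\<close>
lemma forcing_bound_le:
  assumes "\<eta> > 0" "s \<ge> \<eta>"
  shows "forcing_bound s \<le> (X / 2 + exp (- \<eta>) / (1 - exp (- \<eta>)) * (Z / 2)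
    + m * \<kappa> * (max 1 \<eta> * exp (- max 1 \<eta>) * Z + (X + 2))) * (1 - exp (- s))"
proof -
  define e where "e = exp (- s)"
  have s: "s > 0" using assms by simp
  have e: "0 < e" "e < 1" using s by (auto simp: e_def)
  have e\<eta>: "e \<le> exp (- \<eta>)" "exp (- \<eta>) < 1" using assms by (auto simp: e_def)
  have "e \<le> exp (- \<eta>) / (1 - exp (- \<eta>)) * (1 - e)"
    using e e\<eta> by (simp add: field_simps)
  then have 1: "Z / 2 * e \<le> Z / 2 * (exp (- \<eta>) / (1 - exp (- \<eta>)) * (1 - e))"
    using Z by (intro mult_left_mono) auto
  have "s * e - e + e\<^sup>2 \<le> s * e * (1 - e)"
  proof -
    have "e * (s * e) \<le> e * (1 - e)" using mult_exp_neg_le[of s] e by (intro mult_left_mono) (auto simp: e_def)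
    then show ?thesis by (simp add: algebra_simps power2_eq_square)
  qed
  also have "\<dots> \<le> max 1 \<eta> * exp (- max 1 \<eta>) * (1 - e)"
    using mult_exp_neg_le_max[of \<eta> s] s assms e unfolding e_def[symmetric] by (intro mult_right_mono) auto
  finally have 2: "m * \<kappa> * (Z * (s * e - e + e\<^sup>2)) \<le> m * \<kappa> * (Z * (max 1 \<eta> * exp (- max 1 \<eta>) * (1 - e)))"
    using Z m \<kappa> by (intro mult_left_mono) auto
  have "e * 1 \<le> e * (e + 2 * s)"
    using one_minus_exp_neg_le[of s] e s by (intro mult_left_mono) (auto simp: e_def)
  then have "1 - e\<^sup>2 - 2 * (s * e) \<le> 1 - e" by (simp add: algebra_simps power2_eq_square)
  then have 3: "m * \<kappa> * ((X + 2) * (1 - e\<^sup>2 - 2 * (s * e))) \<le> m * \<kappa> * ((X + 2) * (1 - e))"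
    using X m \<kappa> by (intro mult_left_mono) auto
  have "forcing_bound s = Z / 2 * e + (1 - e) * (X / 2) + m * \<kappa> * (Z * (s * e - e + e\<^sup>2))
    + m * \<kappa> * ((X + 2) * (1 - e\<^sup>2 - 2 * (s * e)))"
    unfolding forcing_bound_def e_def[symmetric] by (simp add: distrib_left)
  also have "\<dots> \<le> Z / 2 * (exp (- \<eta>) / (1 - exp (- \<eta>)) * (1 - e)) + (1 - e) * (X / 2)
     + m * \<kappa> * (Z * (max 1 \<eta> * exp (- max 1 \<eta>) * (1 - e))) + m * \<kappa> * ((X + 2) * (1 - e))"
    using 1 2 3 by linarith
  also have "\<dots> = (X / 2 + exp (- \<eta>) / (1 - exp (- \<eta>)) * (Z / 2)
    + m * \<kappa> * (max 1 \<eta> * exp (- max 1 \<eta>) * Z + (X + 2))) * (1 - e)"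
    by (simp only: algebra_simps)
  finally show ?thesis by (simp add: e_def)
qed

text \<open>
The antiderivative of \<open>forcing_bound\<close> that vanishes at \<open>0\<close>. In the rescaled time \<open>s = t / m\<close> the order
parameter decreases at most at the rate \<open>m * \<kappa> * forcing_bound s\<close>.
\<close>
definition "loss s = Z / 2 * (1 - exp (- s)) + X / 2 * (s - 1 + exp (- s))
   + m * \<kappa> * (Z * (1/2 - s * exp (- s) - (exp (- s))\<^sup>2 / 2)
     + (X + 2) * (s - 1/2 + (exp (- s))\<^sup>2 / 2 - 2 * (1 - exp (- s) - s * exp (- s))))"

lemma DERIV_loss: "(loss has_real_derivative forcing_bound s) (at s)"
proof -
  have 1: "((\<lambda>s. exp (- s)) has_real_derivative - exp (- s)) (at s)"
    by (auto intro!: derivative_eq_intros)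
  have 2: "((\<lambda>s. (exp (- s))\<^sup>2) has_real_derivative - 2 * (exp (- s))\<^sup>2) (at s)"
    by (rule DERIV_cong[OF DERIV_power[OF 1, of 2]]) (simp add: power2_eq_square)
  have 3: "((\<lambda>s. s * exp (- s)) has_real_derivative exp (- s) - s * exp (- s)) (at s)"
    by (rule DERIV_cong[OF DERIV_mult[OF DERIV_ident 1]]) simp
  show ?thesis
    unfolding loss_def[abs_def] forcing_bound_def
    by (rule DERIV_cong, (rule 1 2 3 DERIV_const DERIV_ident DERIV_add DERIV_diff DERIV_cdivide DERIV_cmult)+)
       (simp add: diff_divide_distrib, simp only: mult.commute)
qed

text \<open>
The coupling contributes \<open>- \<kappa> * (1 - exp (- t / m))\<close> times the mean of the squared couplings, which has a
favourable sign, so that only the forcing remains.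
\<close>
lemma mean_velocity_coupling_le:
  assumes t: "t > 0"
  shows "mean N (\<lambda>i. \<omega> i t * F i t) \<le> \<kappa> * (forcing_bound (t / m) * R t)"
proof -
  let ?w = "1 - exp (- (t / m))"
  have "mean N (\<lambda>i. \<omega> i t * F i t) = mean N (\<lambda>i. \<kappa> * (forcing i t * F i t) - \<kappa> * ?w * (F i t)\<^sup>2)"
    by (rule mean_cong, subst velocity_eq) (simp add: algebra_simps power2_eq_square)
  also have "\<dots> = \<kappa> * mean N (\<lambda>i. forcing i t * F i t) - \<kappa> * ?w * mean N (\<lambda>i. (F i t)\<^sup>2)"
    by (simp only: mean_diff mean_cmult)
  also have "\<kappa> * ?w * mean N (\<lambda>i. (F i t)\<^sup>2) \<ge> 0"
    unfolding mean_def using \<kappa> t m by (intro mult_nonneg_nonneg sum_nonneg) auto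
  then have "\<kappa> * mean N (\<lambda>i. forcing i t * F i t) - \<kappa> * ?w * mean N (\<lambda>i. (F i t)\<^sup>2)
     \<le> \<kappa> * mean N (\<lambda>i. forcing i t * F i t)" by simp
  also have "mean N (\<lambda>i. forcing i t * F i t) \<le> forcing_bound (t / m) * mean N (\<lambda>i. \<bar>F i t\<bar>)"
    using abs_mean_mult_le_of_spread[OF N mean_coupling[of N "\<lambda>k. \<theta> k t"] forcing_spread] t
    by (meson abs_le_D1 less_imp_le)
  also have "mean N (\<lambda>i. \<bar>F i t\<bar>) \<le> R t"
    using abs_mean_le_bound[OF N, of "\<lambda>i. \<bar>F i t\<bar>" "R t"] abs_coupling_le[of N "\<lambda>k. \<theta> k t"] by simp
  finally show ?thesis
    using \<kappa> t forcing_bound_nonneg[of t] by (simp add: mult_left_mono)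
qed

text \<open>
The square root is regularised by \<open>e\<^sup>2\<close> because the order parameter is not differentiable where it
vanishes, and that it does not vanish is only a consequence of this estimate.
\<close>
lemma order_parameter_loss:
  assumes T: "T \<ge> 0"
  shows "R T \<ge> R 0 - m * \<kappa> * loss (T / m)"
proof (rule field_le_epsilon)
  fix e :: real assume e: "e > 0"
  let ?h = "\<lambda>t. sqrt ((R t)\<^sup>2 + e\<^sup>2)"
  define D where "D t = - 2 * mean N (\<lambda>i. \<omega> i t * F i t)" for t
  have D: "((\<lambda>t. (R t)\<^sup>2) has_real_derivative D t) (at t)"
    "D t \<ge> - 2 * \<kappa> * forcing_bound (t / m) * R t" if "t > 0" for t
  proof -
    show "((\<lambda>t. (R t)\<^sup>2) has_real_derivative D t) (at t)"
      unfolding D_def by (rule DERIV_order_parameter_sq) (rule deriv_\<theta>[OF _ that])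
    show "D t \<ge> - 2 * \<kappa> * forcing_bound (t / m) * R t"
      unfolding D_def using mean_velocity_coupling_le[OF that] by simp
  qed
  have contR: "continuous_on {0..T} (\<lambda>t. (R t)\<^sup>2)"
  proof -
    have "continuous_on {0..T} (\<theta> i)" if "i \<in> {1..N}" for i
      by (rule continuous_on_subset[OF cont_\<theta>[OF that]]) auto
    then show ?thesis unfolding order_parameter_sq by (intro continuous_intros continuous_on_mean) auto
  qed
  have "(- (m * \<kappa>) * loss (T / m)) - (- (m * \<kappa>) * loss (0 / m)) \<le> ?h T - ?h 0"
  proof (rule increment_le_of_deriv_le[OF T])
    show "continuous_on {0..T} ?h" by (intro continuous_intros contR)
    have dl: "((\<lambda>t. - (m * \<kappa>) * loss (t / m)) has_real_derivative - \<kappa> * forcing_bound (t / m)) (at t)" for t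
    proof -
      have "((\<lambda>t. loss (t / m)) has_real_derivative forcing_bound (t / m) * (1 / m)) (at t)"
        by (rule DERIV_chain2[OF DERIV_loss]) (use m in \<open>auto intro!: derivative_eq_intros\<close>)
      from DERIV_cmult[OF this, of "- (m * \<kappa>)"] show ?thesis using m by simp
    qed
    then show "((\<lambda>t. - (m * \<kappa>) * loss (t / m)) has_real_derivative - \<kappa> * forcing_bound (t / m)) (at t)" for t .
    show "continuous_on {0..T} (\<lambda>t. - (m * \<kappa>) * loss (t / m))"
      by (rule DERIV_atLeastAtMost_imp_continuous_on) (use dl in blast)
    show "(?h has_real_derivative D t / (2 * ?h t)) (at t)" if "0 < t" for t
    proof -
      have "(R t)\<^sup>2 + e\<^sup>2 > 0" using e by (simp add: add_nonneg_pos)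
      from DERIV_chain2[OF DERIV_real_sqrt[OF this] DERIV_add[OF D(1)[OF that] DERIV_const]]
      show ?thesis by (simp add: field_simps)
    qed
    show "- \<kappa> * forcing_bound (t / m) \<le> D t / (2 * ?h t)" if "0 < t" for t
    proof -
      have "R t \<le> ?h t" by (rule real_le_rsqrt) simp
      then have "\<kappa> * forcing_bound (t / m) * R t \<le> \<kappa> * forcing_bound (t / m) * ?h t"
        using \<kappa> forcing_bound_nonneg[of t] that by (intro mult_left_mono) auto
      then have "- \<kappa> * forcing_bound (t / m) * (2 * ?h t) \<le> D t" using D(2)[OF that] by simp
      moreover have "?h t > 0" using e by (simp add: add_nonneg_pos)
      ultimately show ?thesis by (simp add: pos_le_divide_eq)
    qed
  qed
  moreover have "R 0 \<le> ?h 0" by (rule real_le_rsqrt) simp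
  moreover have "?h T \<le> R T + e"
    by (rule real_le_lsqrt) (use e order_parameter_nonneg[of N "\<lambda>k. \<theta> k T"] in \<open>auto simp: power2_sum\<close>)
  moreover have "loss (0 / m) = 0" by (simp add: loss_def)
  ultimately show "R 0 - m * \<kappa> * loss (T / m) \<le> R T + e" by (simp only: mult_zero_right diff_zero mult_minus_left)
qed

lemma loss_le:
  assumes "s \<ge> 0"
  shows "loss s \<le> (1 - exp (- s)) * (1/2 * (Z + s * X)
    + (1 - exp (- s))\<^sup>2 * (m * \<kappa>) * (3/4 * Z + s * (X + 2)))"
proof -
  let ?w = "1 - exp (- s)"
  have "s - 1 + exp (- s) \<le> s * ?w" using mult_exp_neg_le[of s] by (simp add: algebra_simps)
  then have 1: "X / 2 * (s - 1 + exp (- s)) \<le> X / 2 * (s * ?w)" using X by (intro mult_left_mono) auto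
  have 2: "m * \<kappa> * (Z * (1/2 - s * exp (- s) - (exp (- s))\<^sup>2 / 2)
     + (X + 2) * (s - 1/2 + (exp (- s))\<^sup>2 / 2 - 2 * (1 - exp (- s) - s * exp (- s))))
    \<le> m * \<kappa> * (Z * (3/4 * ?w ^ 3) + (X + 2) * (s * ?w ^ 3))"
    using velocity_loss_bound[OF assms] coupling_loss_bound[OF assms] X Z m \<kappa>
    by (intro mult_left_mono add_mono) auto
  have "loss s \<le> Z / 2 * ?w + X / 2 * (s * ?w) + m * \<kappa> * (Z * (3/4 * ?w ^ 3) + (X + 2) * (s * ?w ^ 3))"
    unfolding loss_def by (intro add_mono 1 2) auto
  also have "\<dots> = ?w * (1/2 * (Z + s * X) + ?w\<^sup>2 * (m * \<kappa>) * (3/4 * Z + s * (X + 2)))"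
  proof -
    define w where "w = ?w"
    show ?thesis unfolding w_def[symmetric] by (simp add: power2_eq_square power3_eq_cube field_simps)
  qed
  finally show ?thesis .
qed

lemma perturbed:
  assumes "\<eta> > 0" "g > 0"
    and "X / 2 + exp (- \<eta>) / (1 - exp (- \<eta>)) * (Z / 2)
      + m * \<kappa> * (max 1 \<eta> * exp (- max 1 \<eta>) * Z + (X + 2)) \<le> g"
  shows "perturbed_kuramoto N \<kappa> \<theta> \<omega> forcing (\<lambda>t. 1 - exp (- (t / m))) (\<eta> * m) g (1 - exp (- \<eta>))"
proof
  have pos: "\<eta> * m > 0" using assms m by simp
  have late: "t > 0" "t / m \<ge> \<eta>" if "\<eta> * m \<le> t" for t
  proof -
    show "t > 0" using pos that by linarith
    show "t / m \<ge> \<eta>" using that m by (simp add: pos_le_divide_eq)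
  qed
  show "(\<theta> i has_real_derivative \<omega> i t) (at t)" if "i \<in> {1..N}" "\<eta> * m \<le> t" for i t
    by (rule deriv_\<theta>[OF that(1) late(1)[OF that(2)]])
  show "\<omega> i t = \<kappa> * (forcing i t - (1 - exp (- (t / m))) * F i t)" for i t by (rule velocity_eq)
  show "\<bar>forcing i t - forcing j t\<bar> \<le> 2 * (g * (1 - exp (- (t / m))))"
    if "i \<in> {1..N}" "j \<in> {1..N}" "\<eta> * m \<le> t" for i j t
  proof -
    note t = late[OF that(3)]
    have w: "1 - exp (- (t / m)) \<ge> 0" using t m by simp
    note forcing_bound_le[OF assms(1) t(2)]
    also note mult_right_mono[OF assms(3) w]
    finally have "2 * forcing_bound (t / m) \<le> 2 * (g * (1 - exp (- (t / m))))" by simp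
    with forcing_spread[OF that(1,2) less_imp_le[OF t(1)]] show ?thesis by (rule order_trans)
  qed
  show "1 - exp (- \<eta>) \<le> 1 - exp (- (t / m))" if "\<eta> * m \<le> t" for t
    using late(2)[OF that] by simp
  show "1 - exp (- \<eta>) > 0" using assms(1) by simp
qed (fact N \<kappa> assms(2))+

end

section \<open>Equilibria\<close>

lemma countable_real_zeros:
  fixes f :: "complex \<Rightarrow> complex"
  assumes "f holomorphic_on S" "open S" "connected S" "a \<in> S" "b \<in> S" "f a \<noteq> f b"
  shows "countable {x::real. of_real x \<in> S \<and> f (of_real x) = 0}"
proof -
  have "\<not> f constant_on S" using assms(4-6) unfolding constant_on_def by metis
  then have fin: "finite {z \<in> K. f z = 0}" if "compact K" "K \<subseteq> S" for K
    using holomorphic_compact_finite_zeros[OF assms(1-3) that] by blast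
  obtain C :: "nat \<Rightarrow> complex set" where C: "\<And>n. compact (C n)" "\<And>n. C n \<subseteq> S" "\<Union> (range C) = S"
    using open_Union_compact_subsets[OF assms(2)] by metis
  have "{z \<in> S. f z = 0} = (\<Union>n. {z \<in> C n. f z = 0})" using C(3) by auto
  then have "countable {z \<in> S. f z = 0}" using fin C by (simp add: countable_finite)
  moreover have "of_real ` {x::real. of_real x \<in> S \<and> f (of_real x) = 0} \<subseteq> {z \<in> S. f z = 0}" by auto
  ultimately have "countable (complex_of_real ` {x::real. of_real x \<in> S \<and> f (of_real x) = 0})"
    using countable_subset by blast
  then show ?thesis by (rule countable_image_inj_on) (auto simp: inj_on_def)
qed

lemma countable_sin_eq: "countable {x::real. sin x = c}"
proof -
  have "countable {x::real. complex_of_real x \<in> UNIV \<and> sin (complex_of_real x) - of_real c = 0}"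
  proof (rule countable_real_zeros)
    show "(\<lambda>z. sin z - complex_of_real c) holomorphic_on UNIV" by (intro holomorphic_intros)
    have "sin (complex_of_real (pi / 2)) = 1" unfolding sin_of_real by simp
    then show "sin (0::complex) - of_real c \<noteq> sin (complex_of_real (pi / 2)) - of_real c" by simp
  qed auto
  moreover have "sin (complex_of_real x) - of_real c = 0 \<longleftrightarrow> sin x = c" for x
    unfolding sin_of_real by (metis eq_iff_diff_eq_0 of_real_eq_iff)
  ultimately show ?thesis by simp
qed

text \<open>
The equation is analytic in \<open>r\<close> on the half-plane \<open>Re r > M\<close>, where the radicands have positive real part. It
is not an identity there, because the right-hand side stays bounded.
\<close>
lemma countable_self_consistent_radii:
  assumes N: "N \<ge> 1" and M: "\<And>i. i \<in> {1..N} \<Longrightarrow> \<bar>a i\<bar> \<le> M" and M0: "M \<ge> 0"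
    and s: "\<And>i. i \<in> {1..N} \<Longrightarrow> \<bar>s i\<bar> \<le> (1::real)"
  shows "countable {r. r > M \<and> r = mean N (\<lambda>i. s i * sqrt (1 - (a i / r)\<^sup>2))}"
proof -
  let ?S = "{z. Re z > M}"
  let ?e = "\<lambda>z. 1 / of_nat N * (\<Sum>i\<in>{1..N}. of_real (s i) * csqrt (1 - (of_real (a i) / z)\<^sup>2))"
  let ?h = "\<lambda>z::complex. z - ?e z"
  have small: "cmod ((of_real (a i) / z)\<^sup>2) < 1" if "z \<in> ?S" "i \<in> {1..N}" for z i
  proof -
    have "\<bar>a i\<bar> < cmod z" using M[OF that(2)] that(1) complex_Re_le_cmod[of z] by auto
    then have "cmod (of_real (a i) / z) < 1" by (simp add: norm_divide divide_less_eq)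
    then show ?thesis unfolding norm_power by (simp add: power_less_one_iff abs_square_less_1)
  qed
  have hol: "?h holomorphic_on ?S"
  proof -
    have "z \<noteq> 0" if "z \<in> ?S" for z using that M0 by auto
    moreover have "1 - (of_real (a i) / z)\<^sup>2 \<notin> \<real>\<^sub>\<le>\<^sub>0" if "z \<in> ?S" "i \<in> {1..N}" for z i
    proof -
      have "Re ((of_real (a i) / z)\<^sup>2) < 1" using small[OF that] complex_Re_le_cmod order_le_less_trans by blast
      then have "Re (1 - (of_real (a i) / z)\<^sup>2) > 0" by simp
      then show ?thesis by (simp add: complex_nonpos_Reals_iff)
    qed
    ultimately show ?thesis by (intro holomorphic_intros) auto
  qed
  have e: "cmod (?e z) \<le> 2" if "z \<in> ?S" for z
  proof -
    have "cmod (of_real (s i) * csqrt (1 - (of_real (a i) / z)\<^sup>2)) \<le> 2" if i: "i \<in> {1..N}" for i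
    proof -
      have "cmod (1 - (of_real (a i) / z)\<^sup>2) \<le> 1 + cmod ((of_real (a i) / z)\<^sup>2)"
        using norm_triangle_ineq4[of 1 "(of_real (a i) / z)\<^sup>2"] by simp
      also have "\<dots> \<le> 4" using small[OF \<open>z \<in> ?S\<close> i] by simp
      finally have "sqrt (cmod (1 - (of_real (a i) / z)\<^sup>2)) \<le> sqrt 4" by (rule real_sqrt_le_mono)
      then have "cmod (csqrt (1 - (of_real (a i) / z)\<^sup>2)) \<le> 2" by simp
      then have "\<bar>s i\<bar> * cmod (csqrt (1 - (of_real (a i) / z)\<^sup>2)) \<le> 1 * 2"
        using s[OF i] by (intro mult_mono) auto
      then show ?thesis by (simp add: norm_mult)
    qed
    then have "cmod (\<Sum>i\<in>{1..N}. of_real (s i) * csqrt (1 - (of_real (a i) / z)\<^sup>2)) \<le> of_nat (card {1..N}) * 2"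
      by (rule sum_norm_bound)
    then show ?thesis using N by (simp add: norm_mult norm_divide field_simps)
  qed
  \<comment> \<open>The correction \<open>?e\<close> has modulus at most \<open>2\<close>, so it cannot compensate a displacement of \<open>9\<close>.\<close>
  have ne: "?h (of_real (M + 1)) \<noteq> ?h (of_real (M + 10))"
  proof
    assume eq: "?h (of_real (M + 1)) = ?h (of_real (M + 10))"
    have "complex_of_real (M + 10) - of_real (M + 1) = ?e (of_real (M + 10)) - ?e (of_real (M + 1))"
      using eq by (simp add: algebra_simps)
    then have "complex_of_real 9 = ?e (of_real (M + 10)) - ?e (of_real (M + 1))" by simp
    then have "9 = cmod (?e (of_real (M + 10)) - ?e (of_real (M + 1)))"
      by (metis abs_numeral norm_of_real)
    also have "\<dots> \<le> cmod (?e (of_real (M + 10))) + cmod (?e (of_real (M + 1)))" by (rule norm_triangle_ineq4)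
    also have "\<dots> \<le> 2 + 2" by (intro add_mono e) auto
    finally show False by simp
  qed
  have "countable {r::real. of_real r \<in> ?S \<and> ?h (of_real r) = 0}"
    by (rule countable_real_zeros[OF hol open_halfspace_Re_gt convex_connected[OF convex_halfspace_Re_gt] _ _ ne]) auto
  moreover have "{r. r > M \<and> r = mean N (\<lambda>i. s i * sqrt (1 - (a i / r)\<^sup>2))}
      \<subseteq> {r::real. of_real r \<in> ?S \<and> ?h (of_real r) = 0}"
  proof clarify
    fix r assume r: "r > M" "r = mean N (\<lambda>i. s i * sqrt (1 - (a i / r)\<^sup>2))"
    have "csqrt (1 - (of_real (a i) / of_real r)\<^sup>2) = of_real (sqrt (1 - (a i / r)\<^sup>2))"
      if "i \<in> {1..N}" for i
    proof -
      have "\<bar>a i / r\<bar> \<le> 1" using M[OF that] r(1) M0 by (simp add: abs_divide)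
      then have "(a i / r)\<^sup>2 \<le> 1" by (simp add: abs_square_le_1)
      then have "csqrt (of_real (1 - (a i / r)\<^sup>2)) = of_real (sqrt (1 - (a i / r)\<^sup>2))"
        by (intro csqrt_of_real) simp
      then show ?thesis by simp
    qed
    then have "?e (of_real r) = of_real (mean N (\<lambda>i. s i * sqrt (1 - (a i / r)\<^sup>2)))"
      unfolding mean_def by simp
    with r show "of_real r \<in> ?S \<and> ?h (of_real r) = 0" by simp
  qed
  ultimately show ?thesis using countable_subset by blast
qed

text \<open>
At an equilibrium \<open>sin (u i - \<phi>) = a i / r\<close>, so \<open>r\<close>, which is the mean of \<open>cos (u i - \<phi>)\<close>, solves the
self-consistency equation for one of finitely many choices of signs of the cosines, unless \<open>r\<close> is the
branch point \<open>M\<close>.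
\<close>
lemma countable_equilibrium_radii:
  assumes N: "N \<ge> 1"
  shows "countable {r. \<exists>u. r = order_parameter N u \<and> r > 0 \<and> (\<forall>i\<in>{1..N}. coupling N u i = a i)}"
proof -
  define M where "M = Max ((\<lambda>i. \<bar>a i\<bar>) ` {1..N})"
  have M: "\<bar>a i\<bar> \<le> M" if "i \<in> {1..N}" for i unfolding M_def using that by (intro Max_ge) auto
  have M0: "M \<ge> 0" using M[of 1] N by auto
  define Sg where "Sg = PiE {1..N} (\<lambda>_. {-1, 1::real})"
  define Z where "Z s = {r. r > M \<and> r = mean N (\<lambda>i. s i * sqrt (1 - (a i / r)\<^sup>2))}" for s :: "nat \<Rightarrow> real"
  have "countable (Z s)" if "s \<in> Sg" for s
  proof -
    have "s i \<in> {-1, 1}" if "i \<in> {1..N}" for i using PiE_mem[OF \<open>s \<in> Sg\<close>[unfolded Sg_def] that] .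
    then have "\<bar>s i\<bar> \<le> 1" if "i \<in> {1..N}" for i using that by fastforce
    then show ?thesis unfolding Z_def by (intro countable_self_consistent_radii[OF N M M0])
  qed
  moreover have "finite Sg" unfolding Sg_def by (intro finite_PiE) auto
  ultimately have "countable (insert M (\<Union>s\<in>Sg. Z s))" by (simp add: countable_finite)
  moreover have "{r. \<exists>u. r = order_parameter N u \<and> r > 0 \<and> (\<forall>i\<in>{1..N}. coupling N u i = a i)}
      \<subseteq> insert M (\<Union>s\<in>Sg. Z s)"
  proof clarify
    fix u assume r0: "order_parameter N u > 0" and eq: "\<forall>i\<in>{1..N}. coupling N u i = a i"
      and no: "order_parameter N u \<notin> (\<Union>s\<in>Sg. Z s)"
    define r where "r = order_parameter N u"
    obtain \<phi> where pol: "\<And>c. alignment N u c = r * cos (c - \<phi>)"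
       "\<And>i. coupling N u i = r * sin (u i - \<phi>)"
      unfolding r_def using polar_phase by blast
    have sin: "sin (u i - \<phi>) = a i / r" if "i \<in> {1..N}" for i
      using eq pol(2)[of i] r0 that by (simp add: r_def field_simps)
    have le: "M \<le> r" unfolding M_def
    proof (subst Max_le_iff)
      show "\<forall>x\<in>(\<lambda>i. \<bar>a i\<bar>) ` {1..N}. x \<le> r"
      proof clarify
        fix i assume "i \<in> {1..N}"
        then have "a i = coupling N u i" using eq by simp
        then show "\<bar>a i\<bar> \<le> r" using abs_coupling_le[of N u i] by (simp add: r_def)
      qed
    qed (use N in auto)
    define s where "s = restrict (\<lambda>i. if cos (u i - \<phi>) \<ge> 0 then 1 else -1 :: real) {1..N}"
    have "s \<in> Sg" by (auto simp: s_def Sg_def)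
    moreover have "r = mean N (\<lambda>i. s i * sqrt (1 - (a i / r)\<^sup>2))"
    proof -
      have "r = mean N (\<lambda>i. cos (u i - \<phi>))" using pol(1)[of \<phi>] by (simp add: alignment_def)
      also have "\<dots> = mean N (\<lambda>i. s i * sqrt (1 - (a i / r)\<^sup>2))"
      proof (rule mean_cong)
        fix i assume i: "i \<in> {1..N}"
        have "sqrt (1 - (a i / r)\<^sup>2) = \<bar>cos (u i - \<phi>)\<bar>"
          unfolding sin[OF i, symmetric] cos_squared_eq[symmetric] by simp
        then show "cos (u i - \<phi>) = s i * sqrt (1 - (a i / r)\<^sup>2)" using i by (auto simp: s_def)
      qed
      finally show ?thesis .
    qed
    ultimately have "\<not> r > M" using no by (auto simp: Z_def r_def)
    with le show "order_parameter N u = M" by (simp add: r_def)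
  qed
  ultimately show ?thesis using countable_subset by blast
qed

lemma countable_equilibrium_differences:
  assumes N: "N \<ge> 1" and ij: "i \<in> {1..N}" "j \<in> {1..N}"
  shows "countable {u i - u j | u. order_parameter N u > 0 \<and> (\<forall>k\<in>{1..N}. coupling N u k = a k)}"
proof -
  define Z where "Z = {r. \<exists>u. r = order_parameter N u \<and> r > 0 \<and> (\<forall>i\<in>{1..N}. coupling N u i = a i)}"
  define B where "B k = (\<Union>r\<in>Z. {x. sin x = a k / r})" for k
  have "countable Z" unfolding Z_def by (rule countable_equilibrium_radii[OF N])
  then have "countable (B i \<times> B j)" unfolding B_def by (intro countable_SIGMA countable_UN countable_sin_eq)
  then have "countable ((\<lambda>(x, y). x - y) ` (B i \<times> B j))" by (rule countable_image)
  moreover have "{u i - u j | u. order_parameter N u > 0 \<and> (\<forall>k\<in>{1..N}. coupling N u k = a k)}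
    \<subseteq> (\<lambda>(x, y). x - y) ` (B i \<times> B j)"
  proof clarify
    fix u assume u: "order_parameter N u > 0" "\<forall>k\<in>{1..N}. coupling N u k = a k"
    obtain \<phi> where pol: "\<And>i. coupling N u i = order_parameter N u * sin (u i - \<phi>)"
      using polar_phase by blast
    have "u k - \<phi> \<in> B k" if "k \<in> {1..N}" for k
      using u pol[of k] that unfolding B_def Z_def by (force simp: field_simps)
    with ij show "u i - u j \<in> (\<lambda>(x, y). x - y) ` (B i \<times> B j)"
      by (intro image_eqI[of _ _ "(u i - \<phi>, u j - \<phi>)"]) auto
  qed
  ultimately show ?thesis using countable_subset by blast
qed

lemma half_le_sin:
  assumes "0 \<le> y" "y \<le> pi / 3" shows "y / 2 \<le> sin y"
proof -
  have "y / 2 - 0 / 2 \<le> sin y - sin 0"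
  proof (rule increment_le_of_deriv_le[OF assms(1)])
    show "((\<lambda>y. y / 2) has_real_derivative 1 / 2) (at t)" for t :: real
      by (rule DERIV_cdivide[OF DERIV_ident])
    show "1 / 2 \<le> cos t" if "0 < t" "t < y" for t
      using cos_monotone_0_pi_le[of t "pi / 3"] that assms by (simp add: cos_60)
  qed (auto intro!: DERIV_sin continuous_intros)
  then show ?thesis by simp
qed

lemma abs_le_of_mean_zero:
  assumes "N \<ge> 1" "mean N a = 0" "i \<in> {1..N}" and "\<And>j. j \<in> {1..N} \<Longrightarrow> \<bar>a i - a j\<bar> \<le> X"
  shows "\<bar>a i\<bar> \<le> X"
proof -
  have "\<bar>mean N (\<lambda>j. a i - a j)\<bar> \<le> X" by (rule abs_mean_le_bound) (use assms in auto)
  then show ?thesis using assms by (simp add: mean_diff mean_const)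
qed

text \<open>
Let \<open>h\<close> be half the diameter of the cluster and \<open>M\<close> the alignment with its centre. At equilibrium
\<open>2 * sin h * M\<close> is the difference of two of the \<open>a i\<close>, hence \<open>cluster_gain l h \<le> sin h * M \<le> X / 2 \<le> g\<close>. As the gain
exceeds \<open>g\<close> on the whole interval from \<open>min b (pi / 6)\<close> to \<open>b\<close>, the cluster has shrunk to \<open>h < pi / 6\<close>, and \<open>M > 2 * g\<close>. The
component of the order parameter orthogonal to the centre is determined by the sum of the same two
\<open>a i\<close> and hence at most \<open>2 * g / cos h\<close>. This keeps the mean phase away from being orthogonal
to any point of the arc of the cluster: the alignment is at least \<open>g / 2\<close> there, which gives the monotone
dependence of the phases on the \<open>a i\<close> and the upper bound on their differences.
\<close>
lemma cluster_equilibrium: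
  assumes N: "N \<ge> 1" and A: "A \<subseteq> {1..N}" "A \<noteq> {}" and l: "l = real (card A) / real N" "l > 1 / 2"
    and b: "0 < b" "b \<le> pi / 3" and gain: "cluster_gain l b > g" "b \<le> pi / 6 \<or> cluster_gain l (pi / 6) > g"
    and near: "\<And>i j. i \<in> A \<Longrightarrow> j \<in> A \<Longrightarrow> u i - u j \<le> 2 * b"
    and eq: "\<And>i. i \<in> {1..N} \<Longrightarrow> coupling N u i = a i"
    and X: "X > 0" "X / 2 \<le> g" "\<And>i j. i \<in> {1..N} \<Longrightarrow> j \<in> {1..N} \<Longrightarrow> \<bar>a i - a j\<bar> \<le> X"
    and ij: "i \<in> A" "j \<in> A"
  shows "u i - u j \<le> pi / 3" "a i \<ge> a j \<Longrightarrow> a i - a j \<le> u i - u j \<and> u i - u j \<le> 8 / X * (a i - a j)"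
proof -
  have g: "g > 0" using X by linarith
  have fin: "finite A" using A(1) finite_subset by blast
  obtain p where p: "p \<in> A" "\<And>k. k \<in> A \<Longrightarrow> u k \<le> u p"
  proof -
    have "Max (u ` A) \<in> u ` A" using fin A(2) by (intro Max_in) auto
    then obtain p where "p \<in> A" "Max (u ` A) = u p" by blast
    then show thesis using that[of p] Max_ge[of "u ` A"] fin by simp
  qed
  obtain q where q: "q \<in> A" "\<And>k. k \<in> A \<Longrightarrow> u q \<le> u k"
  proof -
    have "Min (u ` A) \<in> u ` A" using fin A(2) by (intro Min_in) auto
    then obtain q where "q \<in> A" "Min (u ` A) = u q" by blast
    then show thesis using that[of q] Min_le[of "u ` A"] fin by simp
  qed
  have pq: "p \<in> {1..N}" "q \<in> {1..N}" using p(1) q(1) A(1) by auto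
  define h where "h = (u p - u q) / 2"
  define c where "c = (u p + u q) / 2"
  define M where "M = alignment N u c"
  have h: "0 \<le> h" "h \<le> b" using p(2)[OF q(1)] near[OF p(1) q(1)] by (auto simp: h_def)
  have inA: "\<bar>u k - c\<bar> \<le> h" if "k \<in> A" for k
    using p(2)[OF that] q(2)[OF that] unfolding h_def c_def abs_le_iff by (simp add: field_simps)
  have M: "M \<ge> l * (1 + cos h) - 1" unfolding M_def l
    by (rule alignment_ge_of_cluster[where n = "\<lambda>_. 0", OF N A(1)]) (use h b pi_gt_zero inA in auto)
  have apq: "a p - a q = 2 * sin h * M"
    using coupling_diff[of N u p q] eq pq by (simp add: h_def c_def M_def)
  have sh: "sin h \<ge> 0" using h b pi_gt_zero by (intro sin_ge_zero) auto
  have sM: "sin h * M \<le> X / 2" using apq X(3)[OF pq] by simp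
  define h1 where "h1 = min b (pi / 6)"
  have h1: "0 < h1" "h1 \<le> b" "h1 \<le> pi / 6" "cluster_gain l h1 > g"
    using b gain pi_gt_zero by (auto simp: h1_def min_def)
  have "h < h1"
  proof (rule ccontr)
    assume "\<not> h < h1"
    then have "cluster_gain l h > g"
      using cluster_gain_ge_between[of l h1 h b g] h h1 b gain l by auto
    moreover have "cluster_gain l h \<le> sin h * M"
      unfolding cluster_gain_def using M sh by (rule mult_left_mono)
    ultimately show False using sM X by linarith
  qed
  have s1: "sin h1 > 0" "sin h1 \<le> 1 / 2"
  proof -
    show "sin h1 > 0" using h1 pi_gt_zero by (intro sin_gt_zero) auto
    show "sin h1 \<le> 1 / 2" using sin_monotone_2pi_le[of h1 "pi / 6"] h1 pi_gt_zero by (simp add: sin_30)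
  qed
  have "cos h1 \<le> cos h" using \<open>h < h1\<close> h h1 pi_gt_zero by (intro cos_monotone_0_pi_le) auto
  then have "l * (1 + cos h1) \<le> l * (1 + cos h)" using l by (intro mult_left_mono) auto
  define m1 where "m1 = l * (1 + cos h1) - 1"
  have M1: "m1 \<le> M" using M \<open>l * (1 + cos h1) \<le> l * (1 + cos h)\<close> unfolding m1_def by linarith
  have gl: "g < sin h1 * m1" using h1(4) by (simp add: cluster_gain_def m1_def)
  have "m1 > 0"
    by (rule ccontr) (use gl g s1 mult_nonneg_nonpos[of "sin h1" m1] in linarith)
  then have "sin h1 * m1 \<le> 1 / 2 * m1"
    using s1 by (intro mult_right_mono) auto
  with gl M1 have M2: "M > 2 * g" by linarith
  have h6: "h \<le> pi / 6" using \<open>h < h1\<close> h1 by simp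
  have sh2: "sin h \<le> 1 / 2" using sin_monotone_2pi_le[of h "pi / 6"] h h6 pi_gt_zero by (simp add: sin_30)
  have ch: "cos h \<ge> sqrt 3 / 2" using cos_monotone_0_pi_le[of h "pi / 6"] h h6 pi_gt_zero by (simp add: cos_30)
  have "sqrt 3 / 2 > 0" by simp
  with ch have ch0: "cos h > 0" by linarith
  have ch2: "(cos h)\<^sup>2 \<ge> 3 / 4"
  proof -
    have "(sin h)\<^sup>2 \<le> (1 / 2)\<^sup>2" using sh2 sh by (intro power_mono) auto
    then show ?thesis unfolding cos_squared_eq by (simp add: power_divide)
  qed
  obtain \<phi> where pol: "\<And>c. alignment N u c = order_parameter N u * cos (c - \<phi>)"
     "\<And>i. coupling N u i = order_parameter N u * sin (u i - \<phi>)" using polar_phase by blast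
  \<comment> \<open>The component of the order parameter orthogonal to the direction \<open>c\<close>.\<close>
  define Im where "Im = order_parameter N u * sin (c - \<phi>)"
  have M': "M = order_parameter N u * cos (c - \<phi>)" by (simp add: M_def pol(1))
  have "mean N a = 0"
    using mean_coupling[of N u] mean_cong[of N "coupling N u" a] eq by simp
  then have absa: "\<bar>a k\<bar> \<le> 2 * g" if "k \<in> {1..N}" for k
    using abs_le_of_mean_zero[OF N _ that, of a X] X that by fastforce
  have "a p = Im * cos h + M * sin h" "a q = Im * cos h - M * sin h"
  proof -
    have "u p - \<phi> = (c - \<phi>) + h" "u q - \<phi> = (c - \<phi>) - h" by (simp_all add: h_def c_def field_simps)
    then have s: "sin (u p - \<phi>) = sin (c - \<phi>) * cos h + cos (c - \<phi>) * sin h"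
        "sin (u q - \<phi>) = sin (c - \<phi>) * cos h - cos (c - \<phi>) * sin h"
      by (simp_all only: sin_add sin_diff)
    have "a p = order_parameter N u * sin (u p - \<phi>)" "a q = order_parameter N u * sin (u q - \<phi>)"
      using eq[OF pq(1)] eq[OF pq(2)] pol(2)[of p] pol(2)[of q] by simp_all
    then show "a p = Im * cos h + M * sin h" "a q = Im * cos h - M * sin h"
      unfolding s Im_def M' by (simp_all add: algebra_simps)
  qed
  then have "Im * cos h = (a p + a q) / 2" by simp
  then have "\<bar>Im * cos h\<bar> = \<bar>a p + a q\<bar> / 2" by simp
  then have "\<bar>Im * cos h\<bar> \<le> 2 * g"
    using absa[OF pq(1)] absa[OF pq(2)] abs_triangle_ineq[of "a p" "a q"] by simp
  then have Imc: "\<bar>Im\<bar> * cos h \<le> 2 * g" using ch0 by (simp add: abs_mult)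
  have al: "alignment N u (c + d) \<ge> g / 2" if d: "\<bar>d\<bar> \<le> h" for d
  proof -
    have "alignment N u (c + d) = order_parameter N u * cos ((c - \<phi>) + d)"
      unfolding pol(1) by (simp add: algebra_simps)
    also have "\<dots> = M * cos d - Im * sin d" unfolding cos_add by (simp add: M' Im_def algebra_simps)
    finally have eq1: "alignment N u (c + d) = M * cos d - Im * sin d" .
    have "cos h \<le> cos \<bar>d\<bar>" using d h b pi_gt_zero by (intro cos_monotone_0_pi_le) auto
    then have "M * cos h \<le> M * cos d" using M2 g by (intro mult_left_mono) auto
    moreover have "Im * sin d \<le> \<bar>Im\<bar> * sin h"
    proof -
      have "\<bar>sin d\<bar> = sin \<bar>d\<bar>" 
        using sin_ge_zero[of d] sin_ge_zero[of "- d"] d h6 pi_gt_zero by (cases "d \<ge> 0") auto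
      also have "\<dots> \<le> sin h" using d h6 h pi_gt_zero by (intro sin_monotone_2pi_le) auto
      finally have "\<bar>Im\<bar> * \<bar>sin d\<bar> \<le> \<bar>Im\<bar> * sin h" by (intro mult_left_mono) auto
      then show ?thesis using abs_ge_self[of "Im * sin d"] by (simp add: abs_mult)
    qed
    ultimately have 1: "M * cos h - \<bar>Im\<bar> * sin h \<le> alignment N u (c + d)" unfolding eq1 by linarith
    have "2 * g * (3 / 4) \<le> M * (cos h)\<^sup>2" using M2 g ch2 by (intro mult_mono) auto
    moreover have "(\<bar>Im\<bar> * cos h) * sin h \<le> (2 * g) * (1 / 2)" by (rule mult_mono[OF Imc sh2]) (use sh g in auto)
    ultimately have 2: "g / 2 \<le> (M * cos h - \<bar>Im\<bar> * sin h) * cos h"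
      by (simp add: power2_eq_square algebra_simps)
    then have "0 < (M * cos h - \<bar>Im\<bar> * sin h) * cos h" using g by linarith
    then have "0 < M * cos h - \<bar>Im\<bar> * sin h" using ch0 by (simp add: zero_less_mult_iff)
    then have "(M * cos h - \<bar>Im\<bar> * sin h) * cos h \<le> M * cos h - \<bar>Im\<bar> * sin h"
      using cos_le_one[of h] by (simp add: mult_left_le)
    with 1 2 show ?thesis by linarith
  qed
  have "u i - u j \<le> 2 * h" using p(2)[OF ij(1)] q(2)[OF ij(2)] by (simp add: h_def)
  then show le3: "u i - u j \<le> pi / 3" using h6 by linarith
  assume aij: "a i \<ge> a j"
  let ?L = "u i - u j"
  define al where "al = alignment N u ((u i + u j) / 2)"
  have "alignment N u (c + ((u i + u j) / 2 - c)) \<ge> g / 2"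
    by (rule al) (use inA[OF ij(1)] inA[OF ij(2)] in \<open>auto simp: abs_le_iff field_simps\<close>)
  then have al1: "al \<ge> g / 2" by (simp add: al_def)
  have al2: "al \<le> 1" using alignment_le[of N u] order_parameter_le_1[OF N, of u] order_trans unfolding al_def by blast
  have d: "a i - a j = 2 * sin (?L / 2) * al"
  proof -
    have "coupling N u i = a i" "coupling N u j = a j" using eq ij A(1) by blast+
    then show ?thesis using coupling_diff[of N u i j] by (simp add: al_def)
  qed
  have "- ?L \<le> 2 * h" using p(2)[OF ij(2)] q(2)[OF ij(1)] by (simp add: h_def)
  have L0: "?L \<ge> 0"
  proof (rule ccontr)
    assume "\<not> ?L \<ge> 0"
    then have "0 < - (?L / 2)" by simp
    moreover have "- (?L / 2) \<le> h" using \<open>- ?L \<le> 2 * h\<close> by (simp add: field_simps)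
    then have "- (?L / 2) < pi" by (rule le_less_trans) (use h6 pi_gt_zero in linarith)
    ultimately have "sin (- (?L / 2)) > 0" by (rule sin_gt_zero)
    then have "sin (?L / 2) < 0" by simp
    then have "sin (?L / 2) * al < 0" using al1 g by (intro mult_neg_pos) auto
    then show False using d aij by simp
  qed
  \<comment> \<open>The constant \<open>8\<close> comes from this bound together with \<open>al \<ge> g / 2 \<ge> X / 4\<close>.\<close>
  have sL: "?L / 2 / 2 \<le> sin (?L / 2)" by (rule half_le_sin) (use L0 le3 in auto)
  have "sin (?L / 2) * al \<le> ?L / 2 * 1"
    using sin_x_le_x[of "?L / 2"] L0 al1 al2 g by (intro mult_mono) auto
  then have 1: "a i - a j \<le> ?L" using d by simp
  have "?L / 4 * (X / 4) \<le> sin (?L / 2) * al"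
    using sL L0 al1 X by (intro mult_mono) auto
  then have "?L * X \<le> 8 * (a i - a j)" using d by simp
  then have "?L \<le> 8 / X * (a i - a j)" using X(1) by (simp add: field_simps)
  with 1 show "a i - a j \<le> ?L \<and> ?L \<le> 8 / X * (a i - a j)" by blast
qed

section \<open>Convergence to equilibrium\<close>

lemma order_parameter_translate: "order_parameter N (\<lambda>k. u k - c) = order_parameter N u"
proof (rule power2_eq_imp_eq)
  have C: "mean N (\<lambda>k. cos (u k - c)) = mean N (\<lambda>k. cos (u k)) * cos c + mean N (\<lambda>k. sin (u k)) * sin c"
    by (simp add: cos_diff mean_add mean_cmult_right)
  have S: "mean N (\<lambda>k. sin (u k - c)) = mean N (\<lambda>k. sin (u k)) * cos c - mean N (\<lambda>k. cos (u k)) * sin c"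
    by (simp add: sin_diff mean_diff mean_cmult_right)
  have rot: "(p * cos c + q * sin c)\<^sup>2 + (q * cos c - p * sin c)\<^sup>2 = p\<^sup>2 + q\<^sup>2" for p q :: real
    using sin_cos_squared_add[of c] by algebra
  show "(order_parameter N (\<lambda>k. u k - c))\<^sup>2 = (order_parameter N u)\<^sup>2"
    unfolding order_parameter_sq C S by (rule rot)
qed (simp_all add: order_parameter_nonneg)

lemma coupling_translate: "coupling N (\<lambda>k. u k - c) i = coupling N u i"
  by (simp add: coupling_def)

lemma order_parameter_shift:
  "order_parameter N (\<lambda>k. u k - 2 * of_int (n k) * pi) = order_parameter N u"
  by (rule power2_eq_imp_eq) (simp_all add: order_parameter_sq cos_shift sin_shift order_parameter_nonneg)

lemma order_parameter_ge_of_cluster: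
  assumes N: "N \<ge> 1" and A: "A \<subseteq> {1..N}" "A \<noteq> {}" and b: "0 \<le> b" "b \<le> pi"
    and near: "\<And>i j. i \<in> A \<Longrightarrow> j \<in> A \<Longrightarrow> u i - u j \<le> 2 * b"
  shows "order_parameter N u \<ge> real (card A) / real N * (1 + cos b) - 1"
proof -
  have fin: "finite A" using A(1) finite_subset by blast
  have "Max (u ` A) \<in> u ` A" "Min (u ` A) \<in> u ` A" using fin A(2) by (auto intro!: Max_in Min_in)
  then obtain p q where pq: "p \<in> A" "Max (u ` A) = u p" "q \<in> A" "Min (u ` A) = u q" by auto
  have le: "u k \<le> u p" "u q \<le> u k" if "k \<in> A" for k
    using Max_ge[of "u ` A" "u k"] Min_le[of "u ` A" "u k"] that fin pq by auto
  have "alignment N u ((u p + u q) / 2) \<ge> real (card A) / real N * (1 + cos b) - 1"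
  proof (rule alignment_ge_of_cluster[where n = "\<lambda>_. 0", OF N A(1) b(2)])
    fix k assume "k \<in> A"
    then show "\<bar>u k - 2 * of_int 0 * pi - (u p + u q) / 2\<bar> \<le> b"
      using le[of k] near[OF pq(1,3)] unfolding abs_le_iff by (simp add: field_simps)
  qed
  then show ?thesis using alignment_le[of N u "(u p + u q) / 2"] by linarith
qed

text \<open>
Every limit point of a phase difference is a phase difference of an equilibrium, obtained along a
subsequence on which all phase differences converge. Only relative phases are compact, which is why
the first phase is subtracted from all others.
\<close>
lemma phases_converge_of_coupling_converge:
  fixes \<theta> :: "nat \<Rightarrow> real \<Rightarrow> real"
  assumes N: "N \<ge> 1" and cont: "\<And>i. i \<in> {1..N} \<Longrightarrow> continuous_on {t1..} (\<theta> i)"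
    and bd: "\<And>i j. i \<in> {1..N} \<Longrightarrow> j \<in> {1..N} \<Longrightarrow> \<exists>K. \<forall>t\<ge>t1. \<bar>\<theta> i t - \<theta> j t\<bar> \<le> K"
    and \<rho>: "\<rho> > 0" "\<And>t. t \<ge> t1 \<Longrightarrow> order_parameter N (\<lambda>k. \<theta> k t) \<ge> \<rho>"
    and lim: "\<And>i. i \<in> {1..N} \<Longrightarrow> ((\<lambda>t. coupling N (\<lambda>k. \<theta> k t) i) \<longlongrightarrow> a i) at_top"
    and ij: "i \<in> {1..N}" "j \<in> {1..N}"
  shows "\<exists>L. ((\<lambda>t. \<theta> i t - \<theta> j t) \<longlongrightarrow> L) at_top"
proof -
  let ?C = "{u i - u j | u. order_parameter N u > 0 \<and> (\<forall>k\<in>{1..N}. coupling N u k = a k)}"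
  obtain K where K: "\<And>t. t \<ge> t1 \<Longrightarrow> \<bar>\<theta> i t - \<theta> j t\<bar> \<le> K" using bd[OF ij] by blast
  show ?thesis
  proof (rule convergent_if_limit_points_countable[of t1 _ ?C K])
    show "continuous_on {t1..} (\<lambda>t. \<theta> i t - \<theta> j t)" by (intro continuous_intros cont ij)
    show "countable ?C" by (rule countable_equilibrium_differences[OF N ij])
    show "\<bar>\<theta> i t - \<theta> j t\<bar> \<le> K" if "t1 \<le> t" for t by (rule K[OF that])
    fix s L assume s: "filterlim s at_top sequentially" and L: "(\<lambda>n. \<theta> i (s n) - \<theta> j (s n)) \<longlonglongrightarrow> L"
    have "\<forall>\<^sub>F n in sequentially. s n \<ge> t1" using s by (simp add: filterlim_at_top)
    then obtain n0 where n0: "\<And>n. n \<ge> n0 \<Longrightarrow> s n \<ge> t1" by (auto simp: eventually_sequentially)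
    let ?f = "\<lambda>k n. \<theta> k (s (n + n0)) - \<theta> 1 (s (n + n0))"
    have "Bseq (?f k)" if k: "k \<in> {1..N}" for k
    proof -
      obtain B where "\<And>t. t \<ge> t1 \<Longrightarrow> \<bar>\<theta> k t - \<theta> 1 t\<bar> \<le> B" using bd[OF k, of 1] N by auto
      then show ?thesis using n0 by (intro BseqI'[of _ B]) auto
    qed
    then obtain r where r: "strict_mono (r :: nat \<Rightarrow> nat)" "\<And>k. k \<in> {1..N} \<Longrightarrow> convergent (\<lambda>n. ?f k (r n))"
      using simultaneous_convergent_subsequence[of "{1..N}" ?f] by auto
    define u where "u k = lim (\<lambda>n. ?f k (r n))" for k
    have u: "(\<lambda>n. ?f k (r n)) \<longlonglongrightarrow> u k" if "k \<in> {1..N}" for k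
      unfolding u_def using r(2)[OF that] by (simp add: convergent_LIMSEQ_iff)
    define q where "q n = s (r n + n0)" for n
    have sub: "filterlim (\<lambda>n. r n + n0) at_top sequentially"
      using filterlim_subseq[OF r(1)] by (rule filterlim_at_top_mono) auto
    have q: "filterlim q at_top sequentially"
      unfolding q_def by (rule filterlim_compose[OF s sub])
    have qt: "q n \<ge> t1" for n using n0 by (simp add: q_def)
    have "coupling N u k = a k" if k: "k \<in> {1..N}" for k
    proof (rule LIMSEQ_unique)
      show "(\<lambda>n. coupling N (\<lambda>l. \<theta> l (q n)) k) \<longlonglongrightarrow> a k"
        by (rule filterlim_compose[OF lim[OF k] q])
      have "(\<lambda>n. coupling N (\<lambda>l. \<theta> l (q n) - \<theta> 1 (q n)) k) \<longlonglongrightarrow> coupling N u k"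
        unfolding coupling_def by (intro tendsto_mean tendsto_intros u[folded q_def] k)
      then show "(\<lambda>n. coupling N (\<lambda>l. \<theta> l (q n)) k) \<longlonglongrightarrow> coupling N u k"
        unfolding coupling_translate .
    qed
    moreover have "order_parameter N u > 0"
    proof -
      have "(\<lambda>n. (order_parameter N (\<lambda>l. \<theta> l (q n) - \<theta> 1 (q n)))\<^sup>2) \<longlonglongrightarrow> (order_parameter N u)\<^sup>2"
        unfolding order_parameter_sq by (intro tendsto_intros tendsto_mean u[folded q_def])
      moreover have "(order_parameter N (\<lambda>l. \<theta> l (q n) - \<theta> 1 (q n)))\<^sup>2 \<ge> \<rho>\<^sup>2" for n
        unfolding order_parameter_translate using \<rho>(2)[OF qt] \<rho>(1) by (intro power_mono) auto
      ultimately have "\<rho>\<^sup>2 \<le> (order_parameter N u)\<^sup>2" by (intro LIMSEQ_le_const) auto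
      then show ?thesis using \<rho>(1) order_parameter_nonneg[of N u] by (metis le_less_trans not_less power_mono_iff power2_le_imp_le less_le zero_less_power2)
    qed
    moreover have "L = u i - u j"
    proof (rule LIMSEQ_unique)
      show "(\<lambda>n. \<theta> i (q n) - \<theta> j (q n)) \<longlonglongrightarrow> L"
        unfolding q_def by (rule filterlim_compose[OF L sub])
      have "(\<lambda>n. (\<theta> i (q n) - \<theta> 1 (q n)) - (\<theta> j (q n) - \<theta> 1 (q n))) \<longlonglongrightarrow> u i - u j"
        by (intro tendsto_diff u[folded q_def] ij)
      then show "(\<lambda>n. \<theta> i (q n) - \<theta> j (q n)) \<longlonglongrightarrow> u i - u j" by simp
    qed
    ultimately show "L \<in> ?C" by blast
  qed
qed

context inertial_kuramoto
begin

definition "\<nu>c = mean N \<nu>"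
definition "acc i t = (\<nu> i - \<omega> i t - \<kappa> * F i t) / m"

lemma deriv_\<omega>': "i \<in> {1..N} \<Longrightarrow> t > 0 \<Longrightarrow> (\<omega> i has_real_derivative acc i t) (at t)"
  unfolding acc_def by (rule deriv_\<omega>)

lemma velocity_bounded:
  assumes i: "i \<in> {1..N}" and t: "t \<ge> 0"
  shows "\<bar>\<omega> i t\<bar> \<le> \<bar>\<omega> i 0\<bar> + (\<bar>\<nu> i\<bar> + \<kappa>)"
proof -
  have "\<bar>\<omega> i t\<bar> \<le> exp (- (t / m)) * \<bar>\<omega> i 0\<bar> + (1 - exp (- (t / m))) * (\<bar>\<nu> i\<bar> + \<kappa>)"
  proof (rule relaxation_bound[OF t cont_\<omega>[OF i], where f = "\<lambda>s. \<nu> i - \<kappa> * F i s"])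
    show "(\<omega> i has_real_derivative (\<nu> i - \<kappa> * F i s - \<omega> i s) / m) (at s)" if "0 < s" for s
      by (rule DERIV_cong[OF deriv_\<omega>[OF i that]]) simp
    show "\<bar>\<nu> i - \<kappa> * F i s\<bar> \<le> \<bar>\<nu> i\<bar> + \<kappa>" for s
    proof -
      have "\<bar>\<kappa> * F i s\<bar> \<le> \<kappa> * 1" unfolding abs_mult using \<kappa> abs_F_le[of s i] by (intro mult_mono) auto
      then show ?thesis by linarith
    qed
  qed
  also have "\<dots> \<le> 1 * \<bar>\<omega> i 0\<bar> + 1 * (\<bar>\<nu> i\<bar> + \<kappa>)"
    using t m \<kappa> by (intro add_mono mult_right_mono) auto
  finally show ?thesis by simp
qed

lemma velocity_bound_uniform: "\<exists>C. \<forall>i\<in>{1..N}. \<forall>t\<ge>0. \<bar>\<omega> i t\<bar> \<le> C"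
proof -
  let ?b = "\<lambda>i. \<bar>\<omega> i 0\<bar> + (\<bar>\<nu> i\<bar> + \<kappa>)"
  have "\<bar>\<omega> i t\<bar> \<le> (\<Sum>i\<in>{1..N}. ?b i)" if "i \<in> {1..N}" "t \<ge> 0" for i t
  proof -
    have "?b i \<le> (\<Sum>i\<in>{1..N}. ?b i)" using \<kappa> that(1) by (intro member_le_sum) auto
    then show ?thesis using velocity_bounded[OF that] by linarith
  qed
  then show ?thesis by blast
qed

lemma acc_bound_uniform: "\<exists>C. \<forall>i\<in>{1..N}. \<forall>t\<ge>0. \<bar>acc i t\<bar> \<le> C"
proof -
  obtain C where C: "\<And>i t. i \<in> {1..N} \<Longrightarrow> t \<ge> 0 \<Longrightarrow> \<bar>\<omega> i t\<bar> \<le> C" using velocity_bound_uniform by blast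
  let ?b = "\<lambda>i. (\<bar>\<nu> i\<bar> + \<bar>C\<bar> + \<kappa>) / m"
  have "\<bar>acc i t\<bar> \<le> (\<Sum>i\<in>{1..N}. ?b i)" if "i \<in> {1..N}" "t \<ge> 0" for i t
  proof -
    have "\<bar>\<kappa> * F i t\<bar> \<le> \<kappa> * 1" unfolding abs_mult using \<kappa> abs_F_le[of t i] by (intro mult_mono) auto
    then have "\<bar>\<nu> i - \<omega> i t - \<kappa> * F i t\<bar> \<le> \<bar>\<nu> i\<bar> + \<bar>C\<bar> + \<kappa>" using C[OF that] by linarith
    then have "\<bar>acc i t\<bar> \<le> ?b i" unfolding acc_def abs_divide using m by (simp add: divide_right_mono)
    also have "?b i \<le> (\<Sum>i\<in>{1..N}. ?b i)" using \<kappa> m that(1) by (intro member_le_sum) auto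
    finally show ?thesis .
  qed
  then show ?thesis by blast
qed

text \<open>
In the frame rotating with \<open>\<nu>c\<close>: kinetic energy, work of the detunings, and the interaction energy, which is
\<open>- \<kappa> / 2 * (R t)\<^sup>2\<close> because \<open>(R t)\<^sup>2\<close> is the mean of \<open>cos (\<theta> i t - \<theta> j t)\<close> over all pairs.
\<close>
definition "energy t = m / 2 * mean N (\<lambda>i. (\<omega> i t - \<nu>c)\<^sup>2) - mean N (\<lambda>i. (\<nu> i - \<nu>c) * \<theta> i t) - \<kappa> / 2 * (R t)\<^sup>2"

lemma mean_detuning: "mean N (\<lambda>i. \<nu> i - \<nu>c) = 0"
  by (simp add: mean_diff mean_const[OF N] \<nu>c_def)

lemma DERIV_energy:
  assumes t: "t > 0"
  shows "(energy has_real_derivative - mean N (\<lambda>i. (\<omega> i t - \<nu>c)\<^sup>2)) (at t)"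
proof -
  have 1: "((\<lambda>t. mean N (\<lambda>i. (\<omega> i t - \<nu>c)\<^sup>2)) has_real_derivative mean N (\<lambda>i. 2 * (\<omega> i t - \<nu>c) * acc i t)) (at t)"
  proof (rule DERIV_mean)
    fix i assume i: "i \<in> {1..N}"
    show "((\<lambda>t. (\<omega> i t - \<nu>c)\<^sup>2) has_real_derivative 2 * (\<omega> i t - \<nu>c) * acc i t) (at t)"
      by (rule DERIV_cong[OF DERIV_power[OF DERIV_diff[OF deriv_\<omega>'[OF i t] DERIV_const], where n = 2]]) simp
  qed
  have 2: "((\<lambda>t. mean N (\<lambda>i. (\<nu> i - \<nu>c) * \<theta> i t)) has_real_derivative mean N (\<lambda>i. (\<nu> i - \<nu>c) * \<omega> i t)) (at t)"
    by (rule DERIV_mean) (rule DERIV_cmult, rule deriv_\<theta>[OF _ t])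
  have 3: "((\<lambda>t. (R t)\<^sup>2) has_real_derivative - 2 * mean N (\<lambda>i. \<omega> i t * F i t)) (at t)"
    by (rule DERIV_order_parameter_sq) (rule deriv_\<theta>[OF _ t])
  have "m / 2 * mean N (\<lambda>i. 2 * (\<omega> i t - \<nu>c) * acc i t) = mean N (\<lambda>i. m / 2 * (2 * (\<omega> i t - \<nu>c) * acc i t))"
    by (simp only: mean_cmult)
  also have "\<dots> = mean N (\<lambda>i. ((\<nu> i - \<nu>c) * \<omega> i t - \<kappa> * (\<omega> i t * F i t) - (\<omega> i t - \<nu>c)\<^sup>2)
      - (\<nu>c * (\<nu> i - \<nu>c) - \<nu>c * \<kappa> * F i t))"
    by (rule mean_cong) (use m in \<open>simp add: acc_def power2_eq_square field_simps\<close>)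
  also have "\<dots> = mean N (\<lambda>i. (\<nu> i - \<nu>c) * \<omega> i t) - \<kappa> * mean N (\<lambda>i. \<omega> i t * F i t)
      - mean N (\<lambda>i. (\<omega> i t - \<nu>c)\<^sup>2)"
    using mean_detuning mean_coupling[of N "\<lambda>k. \<theta> k t"] by (simp only: mean_diff mean_cmult)
  finally have eq: "m / 2 * mean N (\<lambda>i. 2 * (\<omega> i t - \<nu>c) * acc i t) = \<dots>" .
  show ?thesis
    unfolding energy_def[abs_def]
    by (rule DERIV_cong[OF DERIV_diff[OF DERIV_diff[OF DERIV_cmult[OF 1] 2] DERIV_cmult[OF 3]]]) (subst eq, simp)
qed

text \<open>
Boundedness of the phase differences makes the energy bounded from below, because the detunings sum
to zero. The lemma of Barbalat then applies twice: to the energy, whose derivative is minus the mean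
squared velocity, and to each velocity.
\<close>
lemma velocity_and_acceleration_limits:
  assumes bd: "\<And>i j. i \<in> {1..N} \<Longrightarrow> j \<in> {1..N} \<Longrightarrow> \<exists>K. \<forall>t\<ge>t1. \<bar>\<theta> i t - \<theta> j t\<bar> \<le> K"
    and t1: "t1 > 0" and i: "i \<in> {1..N}"
  shows "(\<omega> i \<longlongrightarrow> \<nu>c) at_top" and "(acc i \<longlongrightarrow> 0) at_top"
proof -
  let ?v = "\<lambda>t. mean N (\<lambda>i. (\<omega> i t - \<nu>c)\<^sup>2)"
  obtain C where C: "\<And>i t. i \<in> {1..N} \<Longrightarrow> t \<ge> 0 \<Longrightarrow> \<bar>\<omega> i t\<bar> \<le> C" using velocity_bound_uniform by blast
  obtain D where D: "\<And>i t. i \<in> {1..N} \<Longrightarrow> t \<ge> 0 \<Longrightarrow> \<bar>acc i t\<bar> \<le> D" using acc_bound_uniform by blast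
  have one: "1 \<in> {1..N}" using N by simp
  have CD: "C \<ge> 0" "D \<ge> 0" using C[OF one, of 0] D[OF one, of 0] by auto
  have v0: "?v t \<ge> 0" for t unfolding mean_def by (intro mult_nonneg_nonneg sum_nonneg) auto
  from bd[OF _ one] have "\<forall>j\<in>{1..N}. \<exists>K. \<forall>t\<ge>t1. \<bar>\<theta> j t - \<theta> 1 t\<bar> \<le> K" by blast
  then obtain K where K: "\<And>j t. j \<in> {1..N} \<Longrightarrow> t \<ge> t1 \<Longrightarrow> \<bar>\<theta> j t - \<theta> 1 t\<bar> \<le> K j"
    unfolding bchoice_iff by blast
  have "\<exists>l. (energy \<longlongrightarrow> l) at_top"
  proof (rule decreasing_bounded_below_tendsto[of t1])
    fix s t assume st: "t1 \<le> s" "s \<le> t"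
    have "energy t - energy s \<le> 0 - 0"
    proof (rule increment_le_of_deriv_le[OF st(2)])
      show "continuous_on {s..t} energy"
      proof (rule DERIV_atLeastAtMost_imp_continuous_on)
        fix r assume "s \<le> r" "r \<le> t"
        then have "r > 0" using st t1 by linarith
        then show "\<exists>y. (energy has_real_derivative y) (at r)" using DERIV_energy by blast
      qed
      show "(energy has_real_derivative - ?v r) (at r)" if "s < r" for r
        using DERIV_energy st t1 that by auto
      show "((\<lambda>_. 0) has_real_derivative 0) (at r)" for r :: real by (rule DERIV_const)
      show "- ?v r \<le> 0" for r using v0[of r] by simp
    qed auto
    then show "energy t \<le> energy s" by simp
  next
    fix t assume t: "t1 \<le> t"
    have "mean N (\<lambda>i. (\<nu> i - \<nu>c) * \<theta> i t) = mean N (\<lambda>i. (\<nu> i - \<nu>c) * (\<theta> i t - \<theta> 1 t) + (\<nu> i - \<nu>c) * \<theta> 1 t)"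
      by (rule mean_cong) (simp add: algebra_simps)
    also have "\<dots> = mean N (\<lambda>i. (\<nu> i - \<nu>c) * (\<theta> i t - \<theta> 1 t))"
      unfolding mean_add mean_cmult_right mean_detuning by simp
    also have "\<dots> \<le> mean N (\<lambda>i. \<bar>\<nu> i - \<nu>c\<bar> * K i)"
    proof (rule mean_mono)
      fix i assume "i \<in> {1..N}"
      then have "\<bar>\<nu> i - \<nu>c\<bar> * \<bar>\<theta> i t - \<theta> 1 t\<bar> \<le> \<bar>\<nu> i - \<nu>c\<bar> * K i" using K t by (intro mult_left_mono) auto
      then show "(\<nu> i - \<nu>c) * (\<theta> i t - \<theta> 1 t) \<le> \<bar>\<nu> i - \<nu>c\<bar> * K i"
        using abs_ge_self[of "(\<nu> i - \<nu>c) * (\<theta> i t - \<theta> 1 t)"] unfolding abs_mult by linarith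
    qed
    moreover have "(R t)\<^sup>2 \<le> 1"
      using order_parameter_le_1[OF N] order_parameter_nonneg by (simp add: power_le_one)
    then have "\<kappa> / 2 * (R t)\<^sup>2 \<le> \<kappa> / 2 * 1" using \<kappa> by (intro mult_left_mono) auto
    moreover have "m / 2 * ?v t \<ge> 0" using m v0[of t] by simp
    ultimately show "- mean N (\<lambda>i. \<bar>\<nu> i - \<nu>c\<bar> * K i) - \<kappa> / 2 \<le> energy t"
      unfolding energy_def by simp
  qed
  then obtain l where l: "(energy \<longlongrightarrow> l) at_top" by blast
  have "((\<lambda>t. - ?v t) \<longlongrightarrow> 0) at_top"
  proof (rule deriv_tendsto_zero_of_convergent[OF l, of t1])
    fix t assume t: "t1 \<le> t"
    then have t0: "t > 0" using t1 by simp
    show "(energy has_real_derivative - ?v t) (at t)" by (rule DERIV_energy[OF t0])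
    have "(?v has_real_derivative mean N (\<lambda>i. 2 * (\<omega> i t - \<nu>c) * acc i t)) (at t)"
    proof (rule DERIV_mean)
      fix i assume i: "i \<in> {1..N}"
      show "((\<lambda>t. (\<omega> i t - \<nu>c)\<^sup>2) has_real_derivative 2 * (\<omega> i t - \<nu>c) * acc i t) (at t)"
        by (rule DERIV_cong[OF DERIV_power[OF DERIV_diff[OF deriv_\<omega>'[OF i t0] DERIV_const], where n = 2]]) simp
    qed
    then show "((\<lambda>t. - ?v t) has_real_derivative - mean N (\<lambda>i. 2 * (\<omega> i t - \<nu>c) * acc i t)) (at t)"
      by (rule DERIV_minus)
    have "\<bar>mean N (\<lambda>i. 2 * (\<omega> i t - \<nu>c) * acc i t)\<bar> \<le> 2 * (C + \<bar>\<nu>c\<bar>) * D"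
    proof (rule abs_mean_le_bound[OF N])
      fix i assume i: "i \<in> {1..N}"
      have "\<bar>\<omega> i t - \<nu>c\<bar> \<le> C + \<bar>\<nu>c\<bar>" using C[OF i, of t] t0 by linarith
      then have "\<bar>\<omega> i t - \<nu>c\<bar> * \<bar>acc i t\<bar> \<le> (C + \<bar>\<nu>c\<bar>) * D"
        using D[OF i, of t] t0 CD by (intro mult_mono) auto
      then show "\<bar>2 * (\<omega> i t - \<nu>c) * acc i t\<bar> \<le> 2 * (C + \<bar>\<nu>c\<bar>) * D"
        unfolding abs_mult by (simp only: mult.assoc abs_numeral mult_le_cancel_left_pos zero_less_numeral)
    qed
    then show "\<bar>- mean N (\<lambda>i. 2 * (\<omega> i t - \<nu>c) * acc i t)\<bar> \<le> 2 * (C + \<bar>\<nu>c\<bar>) * D" by simp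
  qed
  then have v: "(?v \<longlongrightarrow> 0) at_top" using tendsto_minus by fastforce
  have "((\<lambda>t. (\<omega> i t - \<nu>c)\<^sup>2) \<longlongrightarrow> 0) at_top"
  proof (rule tendsto_sandwich[OF _ _ tendsto_const])
    show "((\<lambda>t. real N * ?v t) \<longlongrightarrow> 0) at_top" using tendsto_mult_right_zero[OF v, of "real N"] by simp
    show "\<forall>\<^sub>F t in at_top. (\<omega> i t - \<nu>c)\<^sup>2 \<le> real N * ?v t"
    proof (rule always_eventually, rule allI)
      fix t
      have "(\<omega> i t - \<nu>c)\<^sup>2 \<le> (\<Sum>i\<in>{1..N}. (\<omega> i t - \<nu>c)\<^sup>2)" using i by (intro member_le_sum) auto
      then show "(\<omega> i t - \<nu>c)\<^sup>2 \<le> real N * ?v t" using N by (simp add: mean_def)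
    qed
  qed simp
  then have "((\<lambda>t. \<omega> i t - \<nu>c) \<longlongrightarrow> 0) at_top" by (simp add: tendsto_power_zero power_tendsto_0_iff)
  then show lim: "(\<omega> i \<longlongrightarrow> \<nu>c) at_top" by (simp add: LIM_zero_iff)
  let ?F' = "\<lambda>t. mean N (\<lambda>k. cos (\<theta> i t - \<theta> k t) * (\<omega> i t - \<omega> k t))"
  show "(acc i \<longlongrightarrow> 0) at_top"
  proof (rule deriv_tendsto_zero_of_convergent[OF lim, of t1])
    fix t assume t: "t1 \<le> t"
    then have t0: "t > 0" using t1 by simp
    show "(\<omega> i has_real_derivative acc i t) (at t)" by (rule deriv_\<omega>'[OF i t0])
    have dF: "(F i has_real_derivative ?F' t) (at t)"
      by (rule DERIV_coupling) (use deriv_\<theta> t0 i in auto)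
    show "(acc i has_real_derivative (- acc i t - \<kappa> * ?F' t) / m) (at t)"
      unfolding acc_def[abs_def]
      by (rule DERIV_cong[OF DERIV_cdivide[OF DERIV_diff[OF DERIV_diff[OF DERIV_const deriv_\<omega>'[OF i t0]] DERIV_cmult[OF dF]]]])
         (simp add: acc_def)
    have "\<bar>?F' t\<bar> \<le> 2 * C"
    proof (rule abs_mean_le_bound[OF N])
      fix k assume k: "k \<in> {1..N}"
      have "\<bar>cos (\<theta> i t - \<theta> k t) * (\<omega> i t - \<omega> k t)\<bar> \<le> 1 * \<bar>\<omega> i t - \<omega> k t\<bar>"
        unfolding abs_mult by (intro mult_right_mono) auto
      moreover have "\<bar>\<omega> i t\<bar> \<le> C" "\<bar>\<omega> k t\<bar> \<le> C" using C[OF i, of t] C[OF k, of t] t0 by simp_all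
      then have "1 * \<bar>\<omega> i t - \<omega> k t\<bar> \<le> 2 * C"
        using abs_triangle_ineq4[of "\<omega> i t" "\<omega> k t"] by simp
      ultimately show "\<bar>cos (\<theta> i t - \<theta> k t) * (\<omega> i t - \<omega> k t)\<bar> \<le> 2 * C"
        by (meson order_trans)
    qed
    then have "\<bar>\<kappa> * ?F' t\<bar> \<le> \<kappa> * (2 * C)" unfolding abs_mult using \<kappa> by (intro mult_mono) auto
    moreover have "\<bar>- acc i t\<bar> \<le> D" using D[OF i, of t] t0 by simp
    ultimately have "\<bar>- acc i t - \<kappa> * ?F' t\<bar> \<le> D + \<kappa> * (2 * C)"
      using abs_triangle_ineq4[of "- acc i t" "\<kappa> * ?F' t"] add_mono order_trans by blast
    then show "\<bar>(- acc i t - \<kappa> * ?F' t) / m\<bar> \<le> (D + \<kappa> * (2 * C)) / m"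
      using m by (simp add: divide_right_mono)
  qed
qed

lemma coupling_limit:
  assumes bd: "\<And>i j. i \<in> {1..N} \<Longrightarrow> j \<in> {1..N} \<Longrightarrow> \<exists>K. \<forall>t\<ge>t1. \<bar>\<theta> i t - \<theta> j t\<bar> \<le> K"
    and t1: "t1 > 0" and i: "i \<in> {1..N}"
  shows "((\<lambda>t. F i t) \<longlongrightarrow> (\<nu> i - \<nu>c) / \<kappa>) at_top"
proof -
  have "((\<lambda>t. (\<nu> i - \<omega> i t - m * acc i t) / \<kappa>) \<longlongrightarrow> (\<nu> i - \<nu>c - m * 0) / \<kappa>) at_top"
    by (intro tendsto_intros velocity_and_acceleration_limits[OF bd t1 i]) (use \<kappa> in auto)
  moreover have "(\<nu> i - \<omega> i t - m * acc i t) / \<kappa> = F i t" for t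
    using m \<kappa> by (simp add: acc_def)
  ultimately show ?thesis by simp
qed

text \<open>
Averaging the equations removes the coupling, so that \<open>mean N (\<lambda>i. \<theta> i t) - \<nu>c * t + m * mean N (\<lambda>i. \<omega> i t)\<close> is
a conserved quantity.
\<close>
lemma mean_phase_limit:
  assumes lim: "\<And>i. i \<in> {1..N} \<Longrightarrow> (\<omega> i \<longlongrightarrow> \<nu>c) at_top"
  shows "\<exists>l. ((\<lambda>t. mean N (\<lambda>i. \<theta> i t) - \<nu>c * t) \<longlongrightarrow> l) at_top"
proof -
  let ?q = "\<lambda>t. mean N (\<lambda>i. \<theta> i t) - \<nu>c * t + m * mean N (\<lambda>i. \<omega> i t)"
  have d: "(?q has_real_derivative 0) (at t)" if t: "t > 0" for t
  proof -
    have 1: "((\<lambda>t. mean N (\<lambda>i. \<theta> i t)) has_real_derivative mean N (\<lambda>i. \<omega> i t)) (at t)"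
      by (rule DERIV_mean) (rule deriv_\<theta>[OF _ t])
    have 2: "((\<lambda>t. mean N (\<lambda>i. \<omega> i t)) has_real_derivative mean N (\<lambda>i. acc i t)) (at t)"
      by (rule DERIV_mean) (rule deriv_\<omega>'[OF _ t])
    have "m * mean N (\<lambda>i. acc i t) = mean N (\<lambda>i. m * acc i t)" by (simp only: mean_cmult)
    also have "\<dots> = mean N (\<lambda>i. \<nu> i - \<omega> i t - \<kappa> * F i t)"
      by (rule mean_cong) (use m in \<open>simp add: acc_def\<close>)
    also have "\<dots> = \<nu>c - mean N (\<lambda>i. \<omega> i t)"
      using mean_coupling[of N "\<lambda>k. \<theta> k t"] by (simp only: mean_diff mean_cmult \<nu>c_def)
    finally have "m * mean N (\<lambda>i. acc i t) = \<nu>c - mean N (\<lambda>i. \<omega> i t)" .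
    then show ?thesis
      by (intro DERIV_cong[OF DERIV_add[OF DERIV_diff[OF 1 DERIV_cmult[OF DERIV_ident]] DERIV_cmult[OF 2]]]) simp
  qed
  have const: "?q t = ?q 1" if "t \<ge> 1" for t
  proof -
    have "\<bar>?q t - ?q 1\<bar> \<le> (0::real) - 0"
    proof (rule abs_increment_le_of_abs_deriv_le[OF that, where g = "\<lambda>_. 0" and f' = "\<lambda>_. 0" and g' = "\<lambda>_. 0"])
      show "continuous_on {1..t} ?q"
      proof (rule DERIV_atLeastAtMost_imp_continuous_on)
        fix r :: real assume "1 \<le> r"
        then have "r > 0" by simp
        then show "\<exists>y. (?q has_real_derivative y) (at r)" using d by blast
      qed
      show "(?q has_real_derivative 0) (at r)" if "1 < r" for r using d that by simp
    qed auto
    then show ?thesis by simp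
  qed
  have "((\<lambda>t. ?q 1 - m * mean N (\<lambda>i. \<omega> i t)) \<longlongrightarrow> ?q 1 - m * mean N (\<lambda>i. \<nu>c)) at_top"
    by (intro tendsto_intros tendsto_mean lim)
  moreover have "\<forall>\<^sub>F t in at_top. ?q 1 - m * mean N (\<lambda>i. \<omega> i t) = mean N (\<lambda>i. \<theta> i t) - \<nu>c * t"
    using eventually_ge_at_top[of 1]
  proof eventually_elim
    case (elim t)
    then show ?case using const[OF elim] by simp
  qed
  ultimately have "((\<lambda>t. mean N (\<lambda>i. \<theta> i t) - \<nu>c * t) \<longlongrightarrow> ?q 1 - m * mean N (\<lambda>i. \<nu>c)) at_top"
    by (rule Lim_transform_eventually)
  then show ?thesis by blast
qed

lemma phase_limit:
  assumes lim: "\<And>i. i \<in> {1..N} \<Longrightarrow> (\<omega> i \<longlongrightarrow> \<nu>c) at_top"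
    and diff: "\<And>i j. i \<in> {1..N} \<Longrightarrow> j \<in> {1..N} \<Longrightarrow> \<exists>L. ((\<lambda>t. \<theta> i t - \<theta> j t) \<longlongrightarrow> L) at_top"
    and i: "i \<in> {1..N}"
  shows "\<exists>l. ((\<lambda>t. \<theta> i t - \<nu>c * t) \<longlongrightarrow> l) at_top"
proof -
  obtain l where l: "((\<lambda>t. mean N (\<lambda>i. \<theta> i t) - \<nu>c * t) \<longlongrightarrow> l) at_top" using mean_phase_limit[OF lim] by blast
  have "\<forall>j\<in>{1..N}. \<exists>L. ((\<lambda>t. \<theta> i t - \<theta> j t) \<longlongrightarrow> L) at_top" using diff[OF i] by blast
  then obtain L where L: "\<And>j. j \<in> {1..N} \<Longrightarrow> ((\<lambda>t. \<theta> i t - \<theta> j t) \<longlongrightarrow> L j) at_top"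
    unfolding bchoice_iff by blast
  have "((\<lambda>t. mean N (\<lambda>j. \<theta> i t - \<theta> j t) + (mean N (\<lambda>i. \<theta> i t) - \<nu>c * t)) \<longlongrightarrow> mean N L + l) at_top"
    by (intro tendsto_add tendsto_mean L l)
  then show ?thesis by (auto simp: mean_diff mean_const[OF N])
qed

end

section \<open>Phase locking\<close>

lemma abs_diff_le_spread:
  assumes "finite A" "i \<in> A" "j \<in> A"
  shows "\<bar>v i - v j\<bar> \<le> spread A v"
  unfolding spread_def by (rule Max_ge) (use assms in \<open>auto intro!: image_eqI[of _ _ "(i, j)"]\<close>)

lemma spread_le:
  assumes "finite A" "A \<noteq> {}" "\<And>i j. i \<in> A \<Longrightarrow> j \<in> A \<Longrightarrow> \<bar>v i - v j\<bar> \<le> c"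
  shows "spread A v \<le> c"
  unfolding spread_def using assms by (subst Max_le_iff) auto

text \<open>
Redefining the velocity at time \<open>0\<close> as the one-sided derivative makes it continuous on \<open>{0..}\<close>.
\<close>
lemma inertial_kuramoto_of_solution:
  assumes N: "N \<ge> 1" and m: "m > 0" and \<kappa>: "\<kappa> > 0"
    and sol: "inertial_kuramoto_solution N m \<kappa> \<nu> \<theta>0 \<omega>0 \<theta>"
  shows "inertial_kuramoto N m \<kappa> \<nu> \<theta> (\<lambda>i t. if t = 0 then \<omega>0 i else deriv (\<theta> i) t)"
proof
  note S = sol[unfolded inertial_kuramoto_solution_def, rule_format]
  let ?\<omega> = "\<lambda>i t. if t = 0 then \<omega>0 i else deriv (\<theta> i) t"
  show d: "(\<theta> i has_real_derivative ?\<omega> i t) (at t)" if "i \<in> {1..N}" "t > 0" for i t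
  proof -
    have "\<theta> i differentiable (at t)" using S that by blast
    then show ?thesis using that by (simp add: DERIV_deriv_iff_real_differentiable)
  qed
  have dd: "(?\<omega> i has_real_derivative deriv (deriv (\<theta> i)) t) (at t)" if "i \<in> {1..N}" "t > 0" for i t
  proof -
    have "deriv (\<theta> i) differentiable (at t)" using S that by blast
    then have "(deriv (\<theta> i) has_real_derivative deriv (deriv (\<theta> i)) t) (at t)"
      by (simp add: DERIV_deriv_iff_real_differentiable)
    then show ?thesis
    proof (rule DERIV_cong_ev[OF refl _ refl, THEN iffD1, rotated])
      show "\<forall>\<^sub>F x in nhds t. deriv (\<theta> i) x = ?\<omega> i x"
        by (rule eventually_mono[OF eventually_nhds_in_open[of "{0<..}" t]]) (use that(2) in auto)
    qed
  qed
  show "continuous_on {0..} (\<theta> i)" if i: "i \<in> {1..N}" for i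
    unfolding continuous_on_eq_continuous_within
  proof
    fix t :: real assume t: "t \<in> {0..}"
    show "continuous (at t within {0..}) (\<theta> i)"
    proof (cases "t = 0")
      case True
      have "(\<theta> i has_real_derivative \<omega>0 i) (at 0 within {0..})" using S i by blast
      then show ?thesis using True DERIV_continuous by blast
    next
      case False
      then show ?thesis
        using DERIV_isCont[OF d[OF i, of t]] t by (auto intro: continuous_at_imp_continuous_at_within)
    qed
  qed
  show "continuous_on {0..} (?\<omega> i)" if i: "i \<in> {1..N}" for i
    unfolding continuous_on_eq_continuous_within
  proof
    fix t :: real assume t: "t \<in> {0..}"
    show "continuous (at t within {0..}) (?\<omega> i)"
    proof (cases "t = 0")
      case True
      have "(deriv (\<theta> i) \<longlongrightarrow> \<omega>0 i) (at_right 0)" using S i by blast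
      moreover have "\<forall>\<^sub>F x in at_right 0. deriv (\<theta> i) x = ?\<omega> i x"
        by (auto simp: eventually_at_right_field intro!: exI[of _ 1])
      ultimately have "(?\<omega> i \<longlongrightarrow> \<omega>0 i) (at_right 0)" by (rule Lim_transform_eventually)
      then show ?thesis unfolding True continuous_within by (simp add: at_within_Ici_at_right)
    next
      case False
      then show ?thesis
        using DERIV_isCont[OF dd[OF i, of t]] t by (auto intro: continuous_at_imp_continuous_at_within)
    qed
  qed
  show "(?\<omega> i has_real_derivative (\<nu> i - ?\<omega> i t - \<kappa> * coupling N (\<lambda>k. \<theta> k t) i) / m) (at t)"
    if i: "i \<in> {1..N}" and t: "t > 0" for i t
  proof -
    have "m * deriv (deriv (\<theta> i)) t + deriv (\<theta> i) t = \<nu> i + \<kappa> / real N * (\<Sum>j = 1..N. sin (\<theta> j t - \<theta> i t))"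
      using S i t by blast
    moreover have "\<kappa> / real N * (\<Sum>j = 1..N. sin (\<theta> j t - \<theta> i t)) = - \<kappa> * coupling N (\<lambda>k. \<theta> k t) i"
    proof -
      have "(\<Sum>j = 1..N. sin (\<theta> j t - \<theta> i t)) = - (\<Sum>j = 1..N. sin (\<theta> i t - \<theta> j t))"
        unfolding sum_negf[symmetric]
      proof (rule sum.cong[OF refl])
        fix j show "sin (\<theta> j t - \<theta> i t) = - sin (\<theta> i t - \<theta> j t)"
          using sin_minus[of "\<theta> i t - \<theta> j t"] by simp
      qed
      then show ?thesis by (simp add: coupling_def mean_def)
    qed
    ultimately have "deriv (deriv (\<theta> i)) t = (\<nu> i - ?\<omega> i t - \<kappa> * coupling N (\<lambda>k. \<theta> k t) i) / m"
      using m t by (simp add: field_simps)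
    then show ?thesis using dd[OF i t] by simp
  qed
qed (fact N m \<kappa>)+

lemma framework_bound_attained:
  assumes "x > 0" "y > 0" "z > 0" and inf: "(INF \<eta> \<in> {0<..}. framework_bound x y z \<eta>) < 1"
  obtains \<eta> where "\<eta> > 0" "framework_bound x y z \<eta> < 1"
proof -
  have nonneg: "framework_bound x y z \<eta> \<ge> 0" if "\<eta> > 0" for \<eta>
    unfolding framework_bound_def using assms that
    by (intro add_nonneg_nonneg mult_nonneg_nonneg) (auto simp: less_imp_le)
  have "bdd_below (framework_bound x y z ` {0<..})" by (rule bdd_belowI[of _ 0]) (use nonneg in auto)
  then have "\<exists>\<eta>\<in>{0<..}. framework_bound x y z \<eta> < 1"
    using inf by (subst (asm) cINF_less_iff) auto
  then show thesis using that by auto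
qed

text \<open>
The factor of \<open>3.068\<close> under the square root in \<open>framework_bound\<close>.
\<close>
definition "effective_detuning x y z \<eta> = y * (x + 2) + max 1 \<eta> * exp (- max 1 \<eta>) * y * z + x / 2
          + exp (-\<eta>) / (1 - exp (-\<eta>)) * (z / 2)"

context inertial_kuramoto_spread
begin

text \<open>
The first summand of \<open>framework_bound\<close> bounds the relative loss of the order parameter up to time \<open>\<eta> * m\<close>, so
the hypothesis says that what remains of it is larger than \<open>sqrt (3.068 * effective_detuning x y z \<eta>) * R 0\<close>. The
inequalities use \<open>R 0 \<le> 1\<close> to weaken powers of \<open>R 0\<close>.
\<close>
lemma coherence_after_initial_layer:
  assumes \<eta>: "\<eta> > 0" and pos: "x > 0" "y > 0" "z > 0"
    and R0: "R 0 > 0" "X = x * (R 0)\<^sup>2" "Z = z * (R 0)\<^sup>2" "m * \<kappa> \<le> y * (R 0)\<^sup>2"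
    and fb: "framework_bound x y z \<eta> < 1"
  defines "g \<equiv> effective_detuning x y z \<eta> * (R 0)\<^sup>2"
  shows "(R (\<eta> * m))\<^sup>2 / 3.068 > g" and "g > 0" and "X / 2 \<le> g"
    and "X / 2 + exp (- \<eta>) / (1 - exp (- \<eta>)) * (Z / 2)
      + m * \<kappa> * (max 1 \<eta> * exp (- max 1 \<eta>) * Z + (X + 2)) \<le> g"
proof -
  define r where "r = R 0"
  define w where "w = 1 - exp (- \<eta>)"
  define e where "e = exp (- \<eta>) / (1 - exp (- \<eta>))"
  define M where "M = max 1 \<eta> * exp (- max 1 \<eta>)"
  define G where "G = effective_detuning x y z \<eta>"
  have r: "0 < r" "r \<le> 1" using R0(1) order_parameter_le_1[OF N] by (auto simp: r_def)
  have r2: "0 < r\<^sup>2" "r\<^sup>2 \<le> 1" "r\<^sup>2 \<le> r"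
    using r mult_left_le[of r r] by (auto simp: power_le_one) (simp add: power2_eq_square)
  have w: "0 < w" "w < 1" using \<eta> by (auto simp: w_def)
  have e: "e > 0" using \<eta> by (simp add: e_def)
  have M: "M > 0" by (simp add: M_def)
  have XZ: "X = x * r\<^sup>2" "Z = z * r\<^sup>2" "m * \<kappa> \<le> y * r\<^sup>2" using R0 by (auto simp: r_def)
  have XZ1: "X \<le> x" "Z \<le> z" using XZ r2 pos by (auto simp: mult_left_le)
  have G: "G = y * (x + 2) + M * y * z + x / 2 + e * (z / 2)"
    by (simp add: G_def effective_detuning_def M_def e_def)
  have G0: "G > x / 2" unfolding G using pos e M by (simp add: add_pos_pos)
  have g: "g = G * r\<^sup>2" by (simp add: g_def G_def r_def)
  show "g > 0" unfolding g using G0 pos r2 by (intro mult_pos_pos) auto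
  show "X / 2 \<le> g" unfolding g XZ using G0 r2 by (simp add: mult_right_mono)
  have mk: "m * \<kappa> > 0" using m \<kappa> by simp
  have "M * Z + (X + 2) \<le> M * z + (x + 2)"
    using XZ1 M by (intro add_mono mult_left_mono) auto
  then have "m * \<kappa> * (M * Z + (X + 2)) \<le> y * r\<^sup>2 * (M * z + (x + 2))"
    by (rule mult_mono[OF XZ(3)]) (use pos r2 M Z X in auto)
  then show "X / 2 + exp (- \<eta>) / (1 - exp (- \<eta>)) * (Z / 2)
      + m * \<kappa> * (max 1 \<eta> * exp (- max 1 \<eta>) * Z + (X + 2)) \<le> g"
    unfolding g G e_def[symmetric] M_def[symmetric] XZ(1,2) by (simp add: algebra_simps)
  define B where "B = w * (1/2 * (z + \<eta> * x) + w\<^sup>2 * y * (3/4 * z + \<eta> * x + 2 * \<eta>))"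
  have c1: "3/4 * Z + \<eta> * (X + 2) \<le> 3/4 * z + \<eta> * (x + 2)"
    using XZ1 \<eta> by (intro add_mono mult_left_mono) auto
  have c2: "m * \<kappa> \<le> y" using order_trans[OF XZ(3) mult_left_le[of "r\<^sup>2" y]] r2 pos by simp
  have "(m * \<kappa>) * (3/4 * Z + \<eta> * (X + 2)) \<le> y * (3/4 * z + \<eta> * (x + 2))"
    by (rule mult_mono[OF c2 c1]) (use pos \<eta> X Z in auto)
  then have c3: "w\<^sup>2 * (m * \<kappa>) * (3/4 * Z + \<eta> * (X + 2)) \<le> w\<^sup>2 * y * (3/4 * z + \<eta> * (x + 2))"
    unfolding mult.assoc by (rule mult_left_mono) simp
  have c4: "1/2 * (Z + \<eta> * X) \<le> 1/2 * (z + \<eta> * x)"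
    using XZ1 \<eta> by (intro mult_left_mono add_mono) auto
  have "w * (1/2 * (Z + \<eta> * X) + w\<^sup>2 * (m * \<kappa>) * (3/4 * Z + \<eta> * (X + 2)))
      \<le> w * (1/2 * (z + \<eta> * x) + w\<^sup>2 * y * (3/4 * z + \<eta> * (x + 2)))"
    by (rule mult_left_mono[OF add_mono[OF c4 c3]]) (use w in simp)
  also have "\<dots> = B" by (simp add: B_def algebra_simps)
  finally have lossB: "loss \<eta> \<le> B" using loss_le[of \<eta>] \<eta> by (simp add: w_def)
  have B0: "B \<ge> 0" unfolding B_def using w pos \<eta> by (intro mult_nonneg_nonneg add_nonneg_nonneg) auto
  have "m * \<kappa> * loss \<eta> \<le> m * \<kappa> * B" using lossB mk by (intro mult_left_mono) auto
  also have "\<dots> \<le> (y * r\<^sup>2) * B" using XZ(3) B0 by (intro mult_right_mono)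
  also have "\<dots> \<le> (y * r) * B" using r2 pos B0 by (intro mult_right_mono mult_left_mono) auto
  finally have "R (\<eta> * m) \<ge> r - r * (y * B)"
    using order_parameter_loss[of "\<eta> * m"] \<eta> m by (simp add: r_def algebra_simps)
  moreover have "framework_bound x y z \<eta> = y * B + sqrt (3.068 * G)"
    unfolding framework_bound_def G_def effective_detuning_def B_def w_def by (simp add: algebra_simps)
  then have "r * sqrt (3.068 * G) < r * (1 - y * B)" using fb r by (intro mult_strict_left_mono) auto
  ultimately have lt: "r * sqrt (3.068 * G) < R (\<eta> * m)" by (simp add: algebra_simps)
  have G00: "0 \<le> G" using G0 pos by linarith
  have "(r * sqrt (3.068 * G))\<^sup>2 < (R (\<eta> * m))\<^sup>2"
    by (rule power_strict_mono[OF lt]) (use r G00 in auto)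
  then show "(R (\<eta> * m))\<^sup>2 / 3.068 > g"
    unfolding g power_mult_distrib using G00 by (simp add: field_simps)
qed

lemma phase_locking:
  assumes \<eta>: "\<eta> > 0" and pos: "x > 0" "y > 0" "z > 0"
    and R0: "R 0 > 0" "X = x * (R 0)\<^sup>2" "Z = z * (R 0)\<^sup>2" "m * \<kappa> \<le> y * (R 0)\<^sup>2"
    and fb: "framework_bound x y z \<eta> < 1"
  shows "\<And>i. i \<in> {1..N} \<Longrightarrow> \<exists>l. ((\<lambda>t. \<theta> i t - mean N \<nu> * t) \<longlongrightarrow> l) at_top"
    and "\<And>i. i \<in> {1..N} \<Longrightarrow> (\<omega> i \<longlongrightarrow> mean N \<nu>) at_top"
    and "\<exists>(A :: nat set) (k :: nat \<Rightarrow> int). A \<subseteq> {1..N} \<and> real (card A) > real N / 2 \<and>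
         Limsup at_top (\<lambda>t. ereal (spread A (\<lambda>i. \<theta> i t - 2 * of_int (k i) * pi))) < ereal (pi / 2) \<and>
         (\<forall>i \<in> A. \<forall>j \<in> A. \<nu> i \<ge> \<nu> j \<longrightarrow>
            (\<exists>L. ((\<lambda>t. \<theta> i t - \<theta> j t - 2 * of_int (k i - k j) * pi) \<longlongrightarrow> L) at_top \<and>
                 (\<nu> i - \<nu> j) / \<kappa> \<le> L \<and> L \<le> 8 / X * ((\<nu> i - \<nu> j) / \<kappa>)))" (is ?locked)
proof -
  define g where "g = effective_detuning x y z \<eta> * (R 0)\<^sup>2"
  note coh = coherence_after_initial_layer[OF \<eta> pos R0 fb, folded g_def]
  interpret p: perturbed_kuramoto N \<kappa> \<theta> \<omega> forcing "\<lambda>t. 1 - exp (- (t / m))" "\<eta> * m" g "1 - exp (- \<eta>)"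
    by (rule perturbed[OF \<eta> coh(2,4)])
  have "\<eta> * m > 0" using \<eta> m by simp
  obtain t1 A b n where t1: "t1 \<ge> \<eta> * m" and A: "A \<subseteq> {1..N}" and b: "0 < b" "b \<le> pi / 3"
    and l: "real (card A) / real N > 1 / 2"
    and gain: "cluster_gain (real (card A) / real N) b > g"
      "b \<le> pi / 6 \<or> cluster_gain (real (card A) / real N) (pi / 6) > g"
    and near: "\<And>i j t. i \<in> A \<Longrightarrow> j \<in> A \<Longrightarrow> t \<ge> t1 \<Longrightarrow>
      (\<theta> i t - 2 * of_int (n i) * pi) - (\<theta> j t - 2 * of_int (n j) * pi) \<le> 2 * b"
    and bd: "\<And>i j. i \<in> {1..N} \<Longrightarrow> j \<in> {1..N} \<Longrightarrow> \<exists>K. \<forall>t\<ge>t1. \<bar>\<theta> i t - \<theta> j t\<bar> \<le> K"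
    by (rule p.cluster_formation[OF coh(1)]) (rule that)
  have t1p: "t1 > 0" using t1 \<open>\<eta> * m > 0\<close> by linarith
  have Ane: "A \<noteq> {}" using l by auto
  have fin: "finite A" using A finite_subset by blast
  have bpi: "b \<le> pi" "0 \<le> b" using b pi_gt_zero by linarith+
  define \<rho> where "\<rho> = real (card A) / real N * (1 + cos b) - 1"
  have "sin b > 0" using b pi_gt_zero by (intro sin_gt_zero) linarith+
  then have \<rho>: "\<rho> > 0"
    using gain(1) coh(2) unfolding cluster_gain_def \<rho>_def[symmetric]
    by (meson less_trans zero_less_mult_pos)
  have Rlow: "R t \<ge> \<rho>" if "t \<ge> t1" for t
    using order_parameter_ge_of_cluster[OF N A Ane bpi(2,1), of "\<lambda>k. \<theta> k t - 2 * of_int (n k) * pi"] near that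
    unfolding order_parameter_shift \<rho>_def by blast
  note lims = velocity_and_acceleration_limits[OF bd t1p]
  show vel: "(\<omega> i \<longlongrightarrow> mean N \<nu>) at_top" if "i \<in> {1..N}" for i
    using lims(1)[OF _ _ that] unfolding \<nu>c_def by blast
  have diff: "\<exists>L. ((\<lambda>t. \<theta> i t - \<theta> j t) \<longlongrightarrow> L) at_top" if "i \<in> {1..N}" "j \<in> {1..N}" for i j
  proof (rule phases_converge_of_coupling_converge[OF N _ bd \<rho> Rlow _ that])
    show "continuous_on {t1..} (\<theta> k)" if "k \<in> {1..N}" for k
      by (rule continuous_on_subset[OF cont_\<theta>[OF that]]) (use t1p in auto)
    show "((\<lambda>t. F k t) \<longlongrightarrow> (\<nu> k - \<nu>c) / \<kappa>) at_top" if "k \<in> {1..N}" for k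
      by (rule coupling_limit[OF bd t1p that])
  qed
  show "\<exists>l. ((\<lambda>t. \<theta> i t - mean N \<nu> * t) \<longlongrightarrow> l) at_top" if "i \<in> {1..N}" for i
    using phase_limit[OF _ diff that] vel unfolding \<nu>c_def by blast
  have one: "1 \<in> {1..N}" using N by simp
  have "\<forall>k\<in>{1..N}. \<exists>L. ((\<lambda>t. \<theta> k t - \<theta> 1 t) \<longlongrightarrow> L) at_top" using diff one by blast
  then obtain u0 where u0: "\<And>k. k \<in> {1..N} \<Longrightarrow> ((\<lambda>t. \<theta> k t - \<theta> 1 t) \<longlongrightarrow> u0 k) at_top"
    unfolding bchoice_iff by blast
  define u where "u k = u0 k - 2 * of_int (n k) * pi" for k
  have u: "((\<lambda>t. \<theta> i t - \<theta> j t - 2 * of_int (n i - n j) * pi) \<longlongrightarrow> u i - u j) at_top"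
    if "i \<in> {1..N}" "j \<in> {1..N}" for i j
  proof -
    have "((\<lambda>t. (\<theta> i t - \<theta> 1 t) - (\<theta> j t - \<theta> 1 t) - 2 * of_int (n i - n j) * pi)
       \<longlongrightarrow> u0 i - u0 j - 2 * of_int (n i - n j) * pi) at_top"
      by (intro tendsto_intros u0 that)
    then show ?thesis by (simp add: u_def algebra_simps)
  qed
  have eq: "coupling N u k = (\<nu> k - \<nu>c) / \<kappa>" if k: "k \<in> {1..N}" for k
  proof (rule tendsto_unique[OF trivial_limit_at_top_linorder])
    have "((\<lambda>t. coupling N (\<lambda>l. \<theta> l t - \<theta> 1 t) k) \<longlongrightarrow> coupling N u0 k) at_top"
      unfolding coupling_def by (intro tendsto_mean tendsto_intros u0 k)
    then show "((\<lambda>t. F k t) \<longlongrightarrow> coupling N u k) at_top"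
      unfolding coupling_translate u_def coupling_shift .
    show "((\<lambda>t. F k t) \<longlongrightarrow> (\<nu> k - \<nu>c) / \<kappa>) at_top" by (rule coupling_limit[OF bd t1p k])
  qed
  have near_u: "u i - u j \<le> 2 * b" if "i \<in> A" "j \<in> A" for i j
  proof (rule tendsto_upperbound[OF u])
    show "\<forall>\<^sub>F t in at_top. \<theta> i t - \<theta> j t - 2 * of_int (n i - n j) * pi \<le> 2 * b"
      using eventually_ge_at_top[of t1]
    proof eventually_elim
      case (elim t)
      then show ?case using near[OF that elim] by (simp add: algebra_simps)
    qed
  qed (use that A in auto)
  have X0: "X > 0" using R0 pos by simp
  have spr: "\<bar>(\<nu> i - \<nu>c) / \<kappa> - (\<nu> j - \<nu>c) / \<kappa>\<bar> \<le> X" if "i \<in> {1..N}" "j \<in> {1..N}" for i j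
  proof -
    have "(\<nu> i - \<nu>c) / \<kappa> - (\<nu> j - \<nu>c) / \<kappa> = (\<nu> i - \<nu> j) / \<kappa>" by (simp add: diff_divide_distrib)
    then show ?thesis using \<nu>_spread[OF that] \<kappa> by (simp add: abs_divide pos_divide_le_eq mult.commute)
  qed
  note ce = cluster_equilibrium[OF N A Ane refl l b gain near_u eq X0 coh(3) spr]
  have third: "u i - u j \<le> pi / 3" if "i \<in> A" "j \<in> A" for i j
    by (rule ce(1)[OF _ _ _ _ _ that]) 
  have bounds: "(\<nu> i - \<nu> j) / \<kappa> \<le> u i - u j \<and> u i - u j \<le> 8 / X * ((\<nu> i - \<nu> j) / \<kappa>)"
    if "i \<in> A" "j \<in> A" "\<nu> i \<ge> \<nu> j" for i j
  proof -
    have e: "(\<nu> i - \<nu>c) / \<kappa> - (\<nu> j - \<nu>c) / \<kappa> = (\<nu> i - \<nu> j) / \<kappa>" by (simp add: diff_divide_distrib)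
    have "(\<nu> i - \<nu>c) / \<kappa> \<ge> (\<nu> j - \<nu>c) / \<kappa>" using that \<kappa> by (simp add: divide_right_mono)
    from ce(2)[OF _ _ _ _ _ that(1,2) this] show ?thesis unfolding e by blast
  qed
  have "Limsup at_top (\<lambda>t. ereal (spread A (\<lambda>i. \<theta> i t - 2 * of_int (n i) * pi))) \<le> ereal (5 * pi / 12)"
  proof (rule Limsup_bounded)
    have "\<forall>\<^sub>F t in at_top. \<theta> i t - \<theta> j t - 2 * of_int (n i - n j) * pi \<le> 5 * pi / 12"
      if "i \<in> A" "j \<in> A" for i j
    proof -
      have "u i - u j < 5 * pi / 12" using third[OF that] pi_gt_zero by linarith
      moreover have "i \<in> {1..N}" "j \<in> {1..N}" using that A by auto
      ultimately have "\<forall>\<^sub>F t in at_top. \<theta> i t - \<theta> j t - 2 * of_int (n i - n j) * pi < 5 * pi / 12"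
        using order_tendstoD(2)[OF u] by blast
      then show ?thesis by (rule eventually_mono) (rule less_imp_le)
    qed
    then have "\<forall>\<^sub>F t in at_top. \<forall>p\<in>A \<times> A. \<theta> (fst p) t - \<theta> (snd p) t - 2 * of_int (n (fst p) - n (snd p)) * pi \<le> 5 * pi / 12"
      using fin by (intro eventually_ball_finite) auto
    then show "\<forall>\<^sub>F t in at_top. ereal (spread A (\<lambda>i. \<theta> i t - 2 * of_int (n i) * pi)) \<le> ereal (5 * pi / 12)"
    proof eventually_elim
      case (elim t)
      have "spread A (\<lambda>i. \<theta> i t - 2 * of_int (n i) * pi) \<le> 5 * pi / 12"
      proof (rule spread_le[OF fin Ane])
        fix i j assume "i \<in> A" "j \<in> A"
        then have "\<theta> i t - \<theta> j t - 2 * of_int (n i - n j) * pi \<le> 5 * pi / 12"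
            "\<theta> j t - \<theta> i t - 2 * of_int (n j - n i) * pi \<le> 5 * pi / 12"
          using elim[rule_format, of "(i, j)"] elim[rule_format, of "(j, i)"] by auto
        then show "\<bar>(\<theta> i t - 2 * of_int (n i) * pi) - (\<theta> j t - 2 * of_int (n j) * pi)\<bar> \<le> 5 * pi / 12"
          unfolding abs_le_iff by (simp add: algebra_simps)
      qed
      then show ?case by simp
    qed
  qed
  also have "ereal (5 * pi / 12) < ereal (pi / 2)" using pi_gt_zero by simp
  finally have ls: "Limsup at_top (\<lambda>t. ereal (spread A (\<lambda>i. \<theta> i t - 2 * of_int (n i) * pi))) < ereal (pi / 2)" .
  show ?locked
  proof (intro exI[of _ A] exI[of _ n] conjI ballI impI)
    show "A \<subseteq> {1..N}" by (rule A)
    show "real N / 2 < real (card A)" using l N by (simp add: field_simps)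
    show "Limsup at_top (\<lambda>t. ereal (spread A (\<lambda>i. \<theta> i t - 2 * of_int (n i) * pi))) < ereal (pi / 2)" by (rule ls)
    fix i j assume ij: "i \<in> A" "j \<in> A" "\<nu> j \<le> \<nu> i"
    then have "i \<in> {1..N}" "j \<in> {1..N}" using A by auto
    from u[OF this] bounds[OF ij]
    show "\<exists>L. ((\<lambda>t. \<theta> i t - \<theta> j t - 2 * of_int (n i - n j) * pi) \<longlongrightarrow> L) at_top \<and>
        (\<nu> i - \<nu> j) / \<kappa> \<le> L \<and> L \<le> 8 / X * ((\<nu> i - \<nu> j) / \<kappa>)" by blast
  qed
qed

end

theorem theorem1p1:
  "\<exists>c :: real \<Rightarrow> real \<Rightarrow> real \<Rightarrow> real \<Rightarrow> real.
    \<forall>(N :: nat) (m :: real) (\<kappa> :: real) (\<nu> :: nat \<Rightarrow> real) (\<theta>0 :: nat \<Rightarrow> real) (\<omega>0 :: nat \<Rightarrow> real)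
      (\<theta> :: nat \<Rightarrow> real \<Rightarrow> real) (x :: real) (y :: real) (z :: real) (R0 :: real).
      N \<ge> 1 \<longrightarrow> m > 0 \<longrightarrow> \<kappa> > 0 \<longrightarrow>
      inertial_kuramoto_solution N m \<kappa> \<nu> \<theta>0 \<omega>0 \<theta> \<longrightarrow>
      R0 = order_parameter N \<theta>0 \<longrightarrow>
      x > 0 \<longrightarrow> y > 0 \<longrightarrow> z > 0 \<longrightarrow>
      spread {1..N} \<nu> / \<kappa> \<le> x * R0\<^sup>2 \<longrightarrow>
      m * \<kappa> \<le> y * R0\<^sup>2 \<longrightarrow>
      spread {1..N} \<omega>0 / \<kappa> \<le> z * R0\<^sup>2 \<longrightarrow>
      (INF \<eta> \<in> {0<..}. framework_bound x y z \<eta>) < 1 \<longrightarrow>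
      (\<forall>i \<in> {1..N}.
         (\<exists>l. ((\<lambda>t. \<theta> i t - mean N \<nu> * t) \<longlongrightarrow> l) at_top) \<and>
         (deriv (\<theta> i) \<longlongrightarrow> mean N \<nu>) at_top) \<and>
      (\<exists>(A :: nat set) (k :: nat \<Rightarrow> int).
         A \<subseteq> {1..N} \<and> real (card A) > real N / 2 \<and>
         Limsup at_top (\<lambda>t. ereal (spread A (\<lambda>i. \<theta> i t - 2 * of_int (k i) * pi))) < ereal (pi / 2) \<and>
         (\<forall>i \<in> A. \<forall>j \<in> A. \<nu> i \<ge> \<nu> j \<longrightarrow>
            (\<exists>L. ((\<lambda>t. \<theta> i t - \<theta> j t - 2 * of_int (k i - k j) * pi) \<longlongrightarrow> L) at_top \<and>
                 (\<nu> i - \<nu> j) / \<kappa> \<le> L \<and>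
                 L \<le> c x y z R0 * ((\<nu> i - \<nu> j) / \<kappa>))))"
proof (rule exI[of _ "\<lambda>x y z R0. 8 / (x * R0\<^sup>2)"], intro allI impI)
  fix N :: nat and m \<kappa> :: real and \<nu> \<theta>0 \<omega>0 :: "nat \<Rightarrow> real" and \<theta> :: "nat \<Rightarrow> real \<Rightarrow> real" and x y z R0 :: real
  assume N: "N \<ge> 1" and m: "m > 0" and \<kappa>: "\<kappa> > 0"
    and sol: "inertial_kuramoto_solution N m \<kappa> \<nu> \<theta>0 \<omega>0 \<theta>"
    and R0: "R0 = order_parameter N \<theta>0"
    and pos: "x > 0" "y > 0" "z > 0"
    and \<nu>: "spread {1..N} \<nu> / \<kappa> \<le> x * R0\<^sup>2" and mk: "m * \<kappa> \<le> y * R0\<^sup>2"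
    and \<omega>0: "spread {1..N} \<omega>0 / \<kappa> \<le> z * R0\<^sup>2"
    and inf: "(INF \<eta> \<in> {0<..}. framework_bound x y z \<eta>) < 1"
  obtain \<eta> where \<eta>: "\<eta> > 0" "framework_bound x y z \<eta> < 1"
    using framework_bound_attained[OF pos inf] by blast
  define \<omega> where "\<omega> i t = (if t = 0 then \<omega>0 i else deriv (\<theta> i) t)" for i t
  have ik: "inertial_kuramoto N m \<kappa> \<nu> \<theta> \<omega>"
    using inertial_kuramoto_of_solution[OF N m \<kappa> sol] unfolding \<omega>_def[abs_def] .
  have R00: "order_parameter N (\<lambda>k. \<theta> k 0) = R0"
  proof -
    have "\<theta> k 0 = \<theta>0 k" if "k \<in> {1..N}" for k using sol that unfolding inertial_kuramoto_solution_def by blast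
    then show ?thesis unfolding R0 order_parameter_def by simp
  qed
  have "0 < m * \<kappa>" using m \<kappa> by simp
  with mk have "R0 \<noteq> 0" by auto
  then have R0p: "R0 > 0" using R0 order_parameter_nonneg[of N \<theta>0] by linarith
  interpret s: inertial_kuramoto_spread N m \<kappa> \<nu> \<theta> \<omega> "x * R0\<^sup>2" "z * R0\<^sup>2"
  proof (intro inertial_kuramoto_spread.intro inertial_kuramoto_spread_axioms.intro ik)
    show "0 \<le> x * R0\<^sup>2" "0 \<le> z * R0\<^sup>2" using pos by simp_all
    show "\<bar>\<nu> i - \<nu> j\<bar> \<le> \<kappa> * (x * R0\<^sup>2)" if "i \<in> {1..N}" "j \<in> {1..N}" for i j
      using abs_diff_le_spread[of "{1..N}" i j \<nu>] that \<nu> \<kappa> by (simp add: pos_divide_le_eq mult.commute)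
    show "\<bar>\<omega> i 0 - \<omega> j 0\<bar> \<le> \<kappa> * (z * R0\<^sup>2)" if "i \<in> {1..N}" "j \<in> {1..N}" for i j
      using abs_diff_le_spread[of "{1..N}" i j \<omega>0] that \<omega>0 \<kappa> by (simp add: pos_divide_le_eq mult.commute \<omega>_def)
  qed
  note pl = s.phase_locking[OF \<eta>(1) pos, unfolded R00, OF R0p refl refl mk \<eta>(2)]
  have "(deriv (\<theta> i) \<longlongrightarrow> mean N \<nu>) at_top" if "i \<in> {1..N}" for i
  proof (rule Lim_transform_eventually[OF pl(2)[OF that]])
    show "\<forall>\<^sub>F t in at_top. \<omega> i t = deriv (\<theta> i) t"
      using eventually_gt_at_top[of 0] by eventually_elim (simp add: \<omega>_def)
  qed
  then show "(\<forall>i \<in> {1..N}.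
         (\<exists>l. ((\<lambda>t. \<theta> i t - mean N \<nu> * t) \<longlongrightarrow> l) at_top) \<and>
         (deriv (\<theta> i) \<longlongrightarrow> mean N \<nu>) at_top) \<and>
      (\<exists>(A :: nat set) (k :: nat \<Rightarrow> int).
         A \<subseteq> {1..N} \<and> real (card A) > real N / 2 \<and>
         Limsup at_top (\<lambda>t. ereal (spread A (\<lambda>i. \<theta> i t - 2 * of_int (k i) * pi))) < ereal (pi / 2) \<and>
         (\<forall>i \<in> A. \<forall>j \<in> A. \<nu> i \<ge> \<nu> j \<longrightarrow>
            (\<exists>L. ((\<lambda>t. \<theta> i t - \<theta> j t - 2 * of_int (k i - k j) * pi) \<longlongrightarrow> L) at_top \<and>
                 (\<nu> i - \<nu> j) / \<kappa> \<le> L \<and>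
                 L \<le> 8 / (x * R0\<^sup>2) * ((\<nu> i - \<nu> j) / \<kappa>))))"
    using pl(1,3) by blast
qed

end
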